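(* Let $k$ be a field of odd characteristic, $C_2=\langle g\mid g^2=1\rangle$, and let $A=k_J[u,v]=k\langle u,v\rangle/(vu-uv+v^2)$ be the Jordan plane with $kC_2$-action $g\cdot u=-u$, $g\cdot v=-v$. Let $\mathsf c$ be the braiding of $kC_2$-modules given by the R-matrix $\mathrm R=\frac12(1\otimes1+1\otimes g+g\otimes1-g\otimes g)$. Then $A\otimes^{\mathsf c}A^{\mathrm{op}_{\mathsf c}}$ is the algebra generated by $u,v,u',v'$ subject to the relations $$r_1:=vu-uv+v^2,\quad r_2:=v'u'-u'v'-v'^2,\quad r_3:=uu'+u'u,$$ $$r_4:=vu'+u'v,\quad r_5:=uv'+v'u,\quad r_6:=vv'+v'v.$$ The algebra $(A\otimes^{\mathsf c}A^{\mathrm{op}_{\mathsf c}})\# kC_2$ admits a 3-parameter PBW deformation $$\mathcal{D}_{A\otimes^{\mathsf c}A^{\mathrm{op}_{\mathsf c}},\kappa}=\frac{k\langle u,v,u',v'\rangle\# kC_2}{(r_i-\kappa(r_i)\mid 1\le i\le 6)},$$ where $\kappa(r_1)=\lambda_1$, $\kappa(r_2)=\lambda_2$, $\kappa(r_3)=\lambda_3g$ for $\lambda_1,\lambda_2,\lambda_3\in k$, and $\kappa(r_i)=0$ for $i=4,5,6$. Moreover, all PBW deformations $\mathcal{D}_{A\otimes^{\mathsf c}A^{\mathrm{op}_{\mathsf c}},\kappa}$ with $\kappa$ a $k$-linear map from $I=\operatorname{span}_k(r_1,\dots,r_6)$ to $kC_2$ are of this form.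
   Context: The braiding associated with an R-matrix $\mathrm R$ is $\mathsf c=\mathrm R\circ\sigma$, $\sigma$ the flip. For module algebras $A,B$ over a Hopf algebra, the braided product $A\otimes^{\mathsf c}B$ is $A\otimes B$ with multiplication $(m_A\otimes m_B)\circ(1\otimes\mathsf c_{B,A}\otimes1)$, and the braided opposite $A^{\mathrm{op}_{\mathsf c}}$ is $A$ with multiplication $m_A\circ\mathsf c_{A,A}$ and the same Hopf action; both are module algebras. $u',v'$ denote the copies of $u,v$ in $A^{\mathrm{op}_{\mathsf c}}$, with $g\cdot u'=-u'$, $g\cdot v'=-v'$. For a Hopf algebra $H$ and an $H$-module algebra $R$, $R\# H$ is $R\otimes H$ with product $(a\otimes h)(a'\otimes h')=\sum a(h_1\cdot a')\otimes h_2h'$. The algebra $\mathcal{D}_{R,\kappa}$ is filtered by giving $H$ degree $0$ and the generators $u,v,u',v'$ degree $1$; it is a PBW deformation of $R\# H$ if its associated graded algebra is isomorphic to $R\# H$ as an $\mathbb{N}$-graded algebra. *)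

theory Defs
  imports
    "HOL-Library.Poly_Mapping"
    "HOL-Library.Z2"
    "HOL-Algebra.QuotRing"
    "HOL-Algebra.Module"
begin

text \<open>
  A unital associative algebra over a field is given by a \<^type>\<open>module\<close> record, whose first type
  parameter is the type of scalars.  The ground field is a type of class \<^class>\<open>field\<close>.
\<close>

section \<open>Linear algebra\<close>

inductive_set lspan :: "('k::field, 'a, 'm) module_scheme \<Rightarrow> 'a set \<Rightarrow> 'a set"
  for M :: "('k, 'a, 'm) module_scheme" and S :: "'a set"
where
  zero: "\<zero>\<^bsub>M\<^esub> \<in> lspan M S"
| step: "x \<in> S \<Longrightarrow> y \<in> lspan M S \<Longrightarrow> (c \<odot>\<^bsub>M\<^esub> x) \<oplus>\<^bsub>M\<^esub> y \<in> lspan M S"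

definition linear_on ::
  "('k::field, 'a, 'm) module_scheme \<Rightarrow> 'a set \<Rightarrow> ('k, 'b, 'n) module_scheme \<Rightarrow> ('a \<Rightarrow> 'b) \<Rightarrow> bool"
where
  "linear_on M U N f \<longleftrightarrow>
     f ` U \<subseteq> carrier N \<and>
     (\<forall>x\<in>U. \<forall>y\<in>U. f (x \<oplus>\<^bsub>M\<^esub> y) = f x \<oplus>\<^bsub>N\<^esub> f y) \<and>
     (\<forall>c. \<forall>x\<in>U. f (c \<odot>\<^bsub>M\<^esub> x) = c \<odot>\<^bsub>N\<^esub> f x)"

definition alg_iso ::
  "('k::field, 'a, 'm) module_scheme \<Rightarrow> ('k, 'b, 'n) module_scheme \<Rightarrow> ('a \<Rightarrow> 'b) set"
where
  "alg_iso M N = {f \<in> ring_iso M N. \<forall>c. \<forall>x\<in>carrier M. f (c \<odot>\<^bsub>M\<^esub> x) = c \<odot>\<^bsub>N\<^esub> f x}"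

text \<open>
  The ring \<^term>\<open>M Quot I\<close> with the induced scalar multiplication; used both for quotients of
  algebras by ideals and (ignoring the product) for quotients of vector spaces.
\<close>
definition quot_alg :: "('k::field, 'a, 'm) module_scheme \<Rightarrow> 'a set \<Rightarrow> ('k, 'a set) module" where
  "quot_alg M I =
     \<lparr>carrier = carrier (M Quot I), mult = mult (M Quot I), one = one (M Quot I),
      zero = zero (M Quot I), add = add (M Quot I),
      smult = (\<lambda>c X. \<Union>x\<in>X. I +>\<^bsub>M\<^esub> (c \<odot>\<^bsub>M\<^esub> x))\<rparr>"

section \<open>Monoid algebras\<close>

definition pm_scale :: "'k::field \<Rightarrow> ('b \<Rightarrow>\<^sub>0 'k) \<Rightarrow> ('b \<Rightarrow>\<^sub>0 'k)" where
  "pm_scale c = Poly_Mapping.map ((*) c)"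

text \<open>
  Monoids are written additively, since the product of \<^typ>\<open>'m \<Rightarrow>\<^sub>0 'k\<close> is convolution with respect to
  \<^term>\<open>(+) :: 'm::monoid_add \<Rightarrow> 'm \<Rightarrow> 'm\<close>.
\<close>
definition monoid_alg :: "('k::field, 'm::monoid_add \<Rightarrow>\<^sub>0 'k) module" where
  "monoid_alg =
     \<lparr>carrier = UNIV, mult = (*), one = 1, zero = 0, add = (+), smult = pm_scale\<rparr>"

text \<open>
  Lists form the free monoid under concatenation, so that \<^typ>\<open>'x list \<Rightarrow>\<^sub>0 'k\<close> is the free algebra
  on the set of all elements of \<^typ>\<open>'x\<close>.
\<close>
instantiation list :: (type) monoid_add
begin
definition zero_list :: "'a list" where "0 = []"
definition plus_list :: "'a list \<Rightarrow> 'a list \<Rightarrow> 'a list" where "xs + ys = xs @ ys"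
instance by standard (simp_all add: zero_list_def plus_list_def)
end

definition gen :: "'x \<Rightarrow> ('x list \<Rightarrow>\<^sub>0 'k::field)" where
  "gen x = Poly_Mapping.single [x] 1"

section \<open>Tensor products\<close>

text \<open>
  The tensor product of \<open>V\<close> and \<open>W\<close> is the space of formal linear combinations of pairs modulo the
  bilinear relations.  The product and the unit of \<open>formal_sums\<close> play no role; hence those of
  \<open>tensor V W\<close> are meaningless and are replaced by the actual ones below.
\<close>
type_synonym ('k, 'a, 'b) tens = "('a \<times> 'b \<Rightarrow>\<^sub>0 'k) set"

definition formal_sums ::
  "('k::field, 'a, 'm) module_scheme \<Rightarrow> ('k, 'b, 'n) module_scheme \<Rightarrow> ('k, 'a \<times> 'b \<Rightarrow>\<^sub>0 'k) module"
where
  "formal_sums V W =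
     \<lparr>carrier = {p. Poly_Mapping.keys p \<subseteq> carrier V \<times> carrier W},
      mult = undefined, one = undefined, zero = 0, add = (+), smult = pm_scale\<rparr>"

definition bilinear_rels ::
  "('k::field, 'a, 'm) module_scheme \<Rightarrow> ('k, 'b, 'n) module_scheme \<Rightarrow> ('a \<times> 'b \<Rightarrow>\<^sub>0 'k) set"
where
  "bilinear_rels V W =
     {Poly_Mapping.single (a \<oplus>\<^bsub>V\<^esub> a', b) 1 - Poly_Mapping.single (a, b) 1 - Poly_Mapping.single (a', b) 1
        | a a' b. a \<in> carrier V \<and> a' \<in> carrier V \<and> b \<in> carrier W} \<union>
     {Poly_Mapping.single (a, b \<oplus>\<^bsub>W\<^esub> b') 1 - Poly_Mapping.single (a, b) 1 - Poly_Mapping.single (a, b') 1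
        | a b b'. a \<in> carrier V \<and> b \<in> carrier W \<and> b' \<in> carrier W} \<union>
     {Poly_Mapping.single (c \<odot>\<^bsub>V\<^esub> a, b) 1 - Poly_Mapping.single (a, b) c
        | c a b. a \<in> carrier V \<and> b \<in> carrier W} \<union>
     {Poly_Mapping.single (a, c \<odot>\<^bsub>W\<^esub> b) 1 - Poly_Mapping.single (a, b) c
        | c a b. a \<in> carrier V \<and> b \<in> carrier W}"

definition tensor_null ::
  "('k::field, 'a, 'm) module_scheme \<Rightarrow> ('k, 'b, 'n) module_scheme \<Rightarrow> ('a \<times> 'b \<Rightarrow>\<^sub>0 'k) set"
where
  "tensor_null V W = lspan (formal_sums V W) (bilinear_rels V W)"

definition tensor ::
  "('k::field, 'a, 'm) module_scheme \<Rightarrow> ('k, 'b, 'n) module_scheme \<Rightarrow> ('k, ('k, 'a, 'b) tens) module"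
where
  "tensor V W = quot_alg (formal_sums V W) (tensor_null V W)"

definition pure ::
  "('k::field, 'a, 'm) module_scheme \<Rightarrow> ('k, 'b, 'n) module_scheme \<Rightarrow> 'a \<Rightarrow> 'b \<Rightarrow> ('k, 'a, 'b) tens"
where
  "pure V W a b = tensor_null V W +>\<^bsub>formal_sums V W\<^esub> Poly_Mapping.single (a, b) 1"

text \<open>
  The linear map into \<open>U\<close> on a tensor product induced by a bilinear map \<open>f\<close>; for bilinear \<open>f\<close> the
  choice of the representative is immaterial.
\<close>
definition tlift ::
  "('k::field, 'c, 'm) module_scheme \<Rightarrow> ('a \<Rightarrow> 'b \<Rightarrow> 'c) \<Rightarrow> ('k, 'a, 'b) tens \<Rightarrow> 'c"
where
  "tlift U f X =
     (let p = (SOME p. p \<in> X)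
      in \<Oplus>\<^bsub>U\<^esub>z\<in>Poly_Mapping.keys p. Poly_Mapping.lookup p z \<odot>\<^bsub>U\<^esub> f (fst z) (snd z))"

section \<open>Graded (module) algebras\<close>

text \<open>\<open>hcomp A n\<close> is the homogeneous component of degree \<open>n\<close>.\<close>
record ('k, 'a) graded_alg = "('k, 'a) module" +
  hcomp :: "nat \<Rightarrow> 'a set"

text \<open>\<open>act A h a\<close> is the action of the Hopf algebra element \<open>h\<close> on \<open>a\<close>.\<close>
record ('k, 'a, 'h) graded_modalg = "('k, 'a) graded_alg" +
  act :: "'h \<Rightarrow> 'a \<Rightarrow> 'a"

text \<open>
  Of the structure maps of a Hopf algebra, only the comultiplication enters the constructions
  below.
\<close>
record (overloaded) ('k, 'h) hopf = "('k, 'h) module" +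
  comult :: "'h \<Rightarrow> ('k, 'h, 'h) tens"

definition quot_modalg ::
  "('k::field, 'a, 'h) graded_modalg \<Rightarrow> 'a set \<Rightarrow> ('k, 'a set, 'h) graded_modalg"
where
  "quot_modalg A I =
     \<lparr>carrier = carrier (quot_alg A I), mult = mult (quot_alg A I), one = one (quot_alg A I),
      zero = zero (quot_alg A I), add = add (quot_alg A I), smult = smult (quot_alg A I),
      hcomp = (\<lambda>n. (\<lambda>x. I +>\<^bsub>A\<^esub> x) ` hcomp A n),
      act = (\<lambda>h X. \<Union>x\<in>X. I +>\<^bsub>A\<^esub> act A h x)\<rparr>"

text \<open>
  The braiding \<open>V \<otimes> W \<rightarrow> W \<otimes> V\<close>: the flip followed by the action of \<open>R \<in> H \<otimes> H\<close> on \<open>W \<otimes> V\<close>.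
\<close>
definition braiding ::
  "('k, 'h, 'h) tens \<Rightarrow> ('k::field, 'a, 'h) graded_modalg \<Rightarrow> ('k, 'b, 'h) graded_modalg
    \<Rightarrow> ('k, 'a, 'b) tens \<Rightarrow> ('k, 'b, 'a) tens"
where
  "braiding R V W =
     tlift (tensor W V) (\<lambda>v w. tlift (tensor W V) (\<lambda>h h'. pure W V (act W h w) (act V h' v)) R)"

definition braided_op ::
  "('k, 'h, 'h) tens \<Rightarrow> ('k::field, 'a, 'h) graded_modalg \<Rightarrow> ('k, 'a, 'h) graded_modalg"
where
  "braided_op R A = A\<lparr>mult := (\<lambda>a b. tlift A (mult A) (braiding R A A (pure A A a b)))\<rparr>"

definition braided_tensor ::
  "('k::field, 'h, 'l) hopf_scheme \<Rightarrow> ('k, 'h, 'h) tens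
    \<Rightarrow> ('k, 'a, 'h) graded_modalg \<Rightarrow> ('k, 'b, 'h) graded_modalg
    \<Rightarrow> ('k, ('k, 'a, 'b) tens, 'h) graded_modalg"
where
  "braided_tensor H R A B = (let T = tensor A B in
     \<lparr>carrier = carrier T,
      mult = (\<lambda>x y.
        tlift T (\<lambda>a b.
          tlift T (\<lambda>a' b'.
            tlift T (\<lambda>a'' b''. pure A B (a \<otimes>\<^bsub>A\<^esub> a'') (b'' \<otimes>\<^bsub>B\<^esub> b'))
              (braiding R B A (pure B A b a'))) y) x),
      one = pure A B \<one>\<^bsub>A\<^esub> \<one>\<^bsub>B\<^esub>,
      zero = zero T, add = add T, smult = smult T,
      hcomp = (\<lambda>n. lspan T {pure A B a b | a b i j. a \<in> hcomp A i \<and> b \<in> hcomp B j \<and> i + j = n}),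
      act = (\<lambda>h. tlift T (\<lambda>a b.
        tlift T (\<lambda>h1 h2. pure A B (act A h1 a) (act B h2 b)) (comult H h)))\<rparr>)"

text \<open>The smash product of \<open>A\<close> with \<open>H\<close>, where \<open>H\<close> is placed in degree 0.\<close>
definition smash ::
  "('k, 'a, 'h) graded_modalg \<Rightarrow> ('k::field, 'h, 'l) hopf_scheme
    \<Rightarrow> ('k, ('k, 'a, 'h) tens) graded_alg"
where
  "smash A H = (let T = tensor A H in
     \<lparr>carrier = carrier T,
      mult = (\<lambda>x y.
        tlift T (\<lambda>a h.
          tlift T (\<lambda>a' h'.
            tlift T (\<lambda>h1 h2. pure A H (a \<otimes>\<^bsub>A\<^esub> act A h1 a') (h2 \<otimes>\<^bsub>H\<^esub> h')) (comult H h)) y) x),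
      one = pure A H \<one>\<^bsub>A\<^esub> \<one>\<^bsub>H\<^esub>,
      zero = zero T, add = add T, smult = smult T,
      hcomp = (\<lambda>n. lspan T {pure A H a h | a h. a \<in> hcomp A n \<and> h \<in> carrier H})\<rparr>)"

section \<open>Filtrations and PBW deformations\<close>

text \<open>The filtration on a quotient of a graded algebra by a possibly inhomogeneous ideal.\<close>
definition quot_filtration ::
  "('k::field, 'a) graded_alg \<Rightarrow> 'a set \<Rightarrow> nat \<Rightarrow> 'a set set"
where
  "quot_filtration F J n = (\<lambda>x. J +>\<^bsub>F\<^esub> x) ` lspan F (\<Union>i\<le>n. hcomp F i)"

definition filt_pred :: "('k, 'a, 'm) module_scheme \<Rightarrow> (nat \<Rightarrow> 'a set) \<Rightarrow> nat \<Rightarrow> 'a set" where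
  "filt_pred M f n = (case n of 0 \<Rightarrow> {\<zero>\<^bsub>M\<^esub>} | Suc m \<Rightarrow> f m)"

text \<open>
  The associated graded algebra of \<open>M\<close> with respect to the increasing filtration \<open>f\<close>: its elements
  are the finitely supported families of cosets \<open>X n \<in> f n / f (n - 1)\<close>, with \<open>f (-1) = {0}\<close>.
\<close>
definition assoc_graded ::
  "('k::field, 'a, 'm) module_scheme \<Rightarrow> (nat \<Rightarrow> 'a set) \<Rightarrow> ('k, nat \<Rightarrow> 'a set) graded_alg"
where
  "assoc_graded M f =
     (let N = filt_pred M f;
          C = {X. (\<forall>n. \<exists>x\<in>f n. X n = N n +>\<^bsub>M\<^esub> x) \<and> finite {n. X n \<noteq> N n}}
      in
     \<lparr>carrier = C,
      mult = (\<lambda>X Y n. \<Union>{N n +>\<^bsub>M\<^esub> (\<Oplus>\<^bsub>M\<^esub>i\<in>{..n}. x i \<otimes>\<^bsub>M\<^esub> y (n - i))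
                          | x y. \<forall>i\<le>n. x i \<in> X i \<and> y i \<in> Y i}),
      one = (\<lambda>n. if n = 0 then N 0 +>\<^bsub>M\<^esub> \<one>\<^bsub>M\<^esub> else N n),
      zero = N,
      add = (\<lambda>X Y n. X n <+>\<^bsub>M\<^esub> Y n),
      smult = (\<lambda>c X n. \<Union>x\<in>X n. N n +>\<^bsub>M\<^esub> (c \<odot>\<^bsub>M\<^esub> x)),
      hcomp = (\<lambda>n. {X \<in> C. \<forall>m. m \<noteq> n \<longrightarrow> X m = N m})\<rparr>)"

definition graded_isomorphic ::
  "('k::field, 'a) graded_alg \<Rightarrow> ('k, 'b) graded_alg \<Rightarrow> bool"
where
  "graded_isomorphic G G' \<longleftrightarrow> (\<exists>f\<in>alg_iso G G'. \<forall>n. f ` hcomp G n = hcomp G' n)"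

section \<open>The group algebra of the cyclic group of order two\<close>

text \<open>The group is the additive group of \<^typ>\<open>bit\<close>; its generator is \<^term>\<open>1 :: bit\<close>.\<close>
definition kC2 :: "('k::field, bit \<Rightarrow>\<^sub>0 'k) hopf" where
  "kC2 =
     \<lparr>carrier = UNIV, mult = (*), one = 1, zero = 0, add = (+), smult = pm_scale,
      comult = (\<lambda>h. let T = tensor monoid_alg monoid_alg in
        \<Oplus>\<^bsub>T\<^esub>e\<in>Poly_Mapping.keys h. Poly_Mapping.lookup h e \<odot>\<^bsub>T\<^esub>
           pure monoid_alg monoid_alg (Poly_Mapping.single e 1) (Poly_Mapping.single e 1))\<rparr>"

definition grp_g :: "bit \<Rightarrow>\<^sub>0 'k::field" where
  "grp_g = Poly_Mapping.single 1 1"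

definition R_matrix :: "('k::field, bit \<Rightarrow>\<^sub>0 'k, bit \<Rightarrow>\<^sub>0 'k) tens" where
  "R_matrix = (let T = tensor kC2 kC2; p = pure kC2 kC2 in
     (1 / 2) \<odot>\<^bsub>T\<^esub> (p 1 1 \<oplus>\<^bsub>T\<^esub> p 1 grp_g \<oplus>\<^bsub>T\<^esub> p grp_g 1 \<ominus>\<^bsub>T\<^esub> p grp_g grp_g))"

text \<open>The algebra endomorphism of the free algebra that maps every generator \<open>x\<close> to \<open>-x\<close>.\<close>
definition neg_gens :: "('x list \<Rightarrow>\<^sub>0 'k::field) \<Rightarrow> ('x list \<Rightarrow>\<^sub>0 'k)" where
  "neg_gens p = (\<Sum>w\<in>Poly_Mapping.keys p.
     pm_scale (Poly_Mapping.lookup p w) (prod_list (map (\<lambda>x. - gen x) w)))"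

text \<open>The free algebra, graded by word length, on which the generator of the group acts by \<open>neg_gens\<close>.\<close>
definition free_modalg :: "('k::field, 'x list \<Rightarrow>\<^sub>0 'k, bit \<Rightarrow>\<^sub>0 'k) graded_modalg" where
  "free_modalg =
     \<lparr>carrier = UNIV, mult = (*), one = 1, zero = 0, add = (+), smult = pm_scale,
      hcomp = (\<lambda>n. {p. \<forall>w\<in>Poly_Mapping.keys p. length w = n}),
      act = (\<lambda>h p. pm_scale (Poly_Mapping.lookup h 0) p +
                   pm_scale (Poly_Mapping.lookup h 1) (neg_gens p))\<rparr>"

section \<open>The Jordan plane and its braided double\<close>

datatype jordan_gen = Ju | Jv

definition jordan_ideal :: "(jordan_gen list \<Rightarrow>\<^sub>0 'k::field) set" where
  "jordan_ideal = Idl\<^bsub>free_modalg\<^esub> {gen Jv * gen Ju - gen Ju * gen Jv + gen Jv ^ 2}"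

definition jordan :: "('k::field, (jordan_gen list \<Rightarrow>\<^sub>0 'k) set, bit \<Rightarrow>\<^sub>0 'k) graded_modalg" where
  "jordan = quot_modalg free_modalg jordan_ideal"

definition jordan_el :: "jordan_gen \<Rightarrow> (jordan_gen list \<Rightarrow>\<^sub>0 'k::field) set" where
  "jordan_el x = jordan_ideal +>\<^bsub>free_modalg\<^esub> gen x"

definition jordan_op :: "('k::field, (jordan_gen list \<Rightarrow>\<^sub>0 'k) set, bit \<Rightarrow>\<^sub>0 'k) graded_modalg" where
  "jordan_op = braided_op R_matrix jordan"

type_synonym 'k jtens =
  "('k, (jordan_gen list \<Rightarrow>\<^sub>0 'k) set, (jordan_gen list \<Rightarrow>\<^sub>0 'k) set) tens"

definition jordan_double :: "('k::field, 'k jtens, bit \<Rightarrow>\<^sub>0 'k) graded_modalg" where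
  "jordan_double = braided_tensor kC2 R_matrix jordan jordan_op"

text \<open>The letters \<open>Gu'\<close> and \<open>Gv'\<close> stand for the copies of \<open>u\<close> and \<open>v\<close> in the braided opposite.\<close>
datatype double_gen = Gu | Gv | Gu' | Gv'

type_synonym 'k free4 = "double_gen list \<Rightarrow>\<^sub>0 'k"

text \<open>Only the values of \<open>rel\<close> at \<open>1, \<dots>, 6\<close> are used.\<close>
definition rel :: "nat \<Rightarrow> 'k::field free4" where
  "rel i =
     [gen Gv * gen Gu - gen Gu * gen Gv + gen Gv ^ 2,
      gen Gv' * gen Gu' - gen Gu' * gen Gv' - gen Gv' ^ 2,
      gen Gu * gen Gu' + gen Gu' * gen Gu,
      gen Gv * gen Gu' + gen Gu' * gen Gv,
      gen Gu * gen Gv' + gen Gv' * gen Gu,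
      gen Gv * gen Gv' + gen Gv' * gen Gv] ! (i - 1)"

definition rel_ideal :: "'k::field free4 set" where
  "rel_ideal = Idl\<^bsub>free_modalg\<^esub> (rel ` {1..6})"

definition rel_space :: "'k::field free4 set" where
  "rel_space = lspan free_modalg (rel ` {1..6})"

definition free4_smash :: "('k::field, ('k, 'k free4, bit \<Rightarrow>\<^sub>0 'k) tens) graded_alg" where
  "free4_smash = smash free_modalg kC2"

definition deform_ideal ::
  "('k free4 \<Rightarrow> (bit \<Rightarrow>\<^sub>0 'k::field)) \<Rightarrow> ('k, 'k free4, bit \<Rightarrow>\<^sub>0 'k) tens set"
where
  "deform_ideal \<kappa> = Idl\<^bsub>free4_smash\<^esub>
     ((\<lambda>i. pure free_modalg kC2 (rel i) 1 \<ominus>\<^bsub>free4_smash\<^esub> pure free_modalg kC2 1 (\<kappa> (rel i))) ` {1..6})"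

definition deform_alg ::
  "('k free4 \<Rightarrow> (bit \<Rightarrow>\<^sub>0 'k::field)) \<Rightarrow> ('k, ('k, 'k free4, bit \<Rightarrow>\<^sub>0 'k) tens set) module"
where
  "deform_alg \<kappa> = quot_alg free4_smash (deform_ideal \<kappa>)"

definition is_PBW_deformation :: "('k free4 \<Rightarrow> (bit \<Rightarrow>\<^sub>0 'k::field)) \<Rightarrow> bool" where
  "is_PBW_deformation \<kappa> \<longleftrightarrow>
     graded_isomorphic
       (assoc_graded (deform_alg \<kappa>) (quot_filtration free4_smash (deform_ideal \<kappa>)))
       (smash jordan_double kC2)"

definition kappa_form ::
  "'k \<Rightarrow> 'k \<Rightarrow> 'k \<Rightarrow> ('k free4 \<Rightarrow> (bit \<Rightarrow>\<^sub>0 'k::field)) \<Rightarrow> bool"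
where
  "kappa_form l1 l2 l3 \<kappa> \<longleftrightarrow>
     \<kappa> (rel 1) = l1 \<odot>\<^bsub>kC2\<^esub> \<one>\<^bsub>kC2\<^esub> \<and>
     \<kappa> (rel 2) = l2 \<odot>\<^bsub>kC2\<^esub> \<one>\<^bsub>kC2\<^esub> \<and>
     \<kappa> (rel 3) = l3 \<odot>\<^bsub>kC2\<^esub> grp_g \<and>
     (\<forall>i\<in>{4..6}. \<kappa> (rel i) = \<zero>\<^bsub>kC2\<^esub>)"

end

theory Submission
  imports Defs "HOL.Vector_Spaces"
begin

text \<open>
  Every space in sight gets an explicit basis, so that quotients, tensor products and smash products
  become spaces of finitely supported functions, and linear or bilinear identities are checked on
  basis vectors.

  For \<open>\<kappa>\<close> of the stated form, the formulas for left multiplication on the monomials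
  \<open>v\<^sup>j u\<^sup>i v'\<^sup>l u'\<^sup>k g\<^sup>e\<close> define operators on the space with this basis that satisfy the deformed
  relations. Since rewriting reduces every word to a combination of these monomials, they form a
  basis of the deformed algebra. The operators with parameters \<open>\<lambda>\<close> and with parameters 0 have the
  same top degree part, which gives the isomorphism of the associated graded algebra with the smash
  product.

  Conversely, in a PBW deformation a count of dimensions in degree one (a surjective endomorphism of
  an 8-dimensional space is injective) shows that no nonzero combination of the elements \<open>x g\<^sup>e\<close>, \<open>x\<close> a
  generator, lies in the deformation ideal. Resolving the ambiguities \<open>u' v u\<close>, \<open>v' v u\<close> and
  \<open>u v' u'\<close> in two ways produces such combinations; their coefficients are, up to factors 2, the
  coefficients of \<open>\<kappa>(r\<^sub>i)\<close> that have to vanish.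
\<close>

text \<open>Why the answer has this shape: an element of the group algebra is K = a + b g, and g
  anticommutes with every generator x, so K x - x K = - 2 b x g and K x + x K = 2 a x. In the
  overlaps the values of \<kappa> on \<open>r\<^sub>1\<close> and \<open>r\<^sub>2\<close> occur in
  commutators only, which kills their coefficients at g; the value on \<open>r\<^sub>3\<close>
  occurs in anticommutators only, which kills its scalar coefficient; those on
  \<open>r\<^sub>4\<close>, \<open>r\<^sub>5\<close>, \<open>r\<^sub>6\<close> occur in both ways.
  Since 2 is invertible, three coefficients survive. The isomorphism in the definition of a PBW
  deformation is an arbitrary graded one and need not respect the generators. This is why dimensions
  are counted: degree one of the associated graded algebra is spanned by eight classes and is mapped
  onto a space of dimension 8. On homogeneous elements of degrees m and n the R-matrix acts by
  (-1)^(m n), so the braided constructions are those of superalgebras; this and the action of g are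
  the sources of the signs below.\<close>

abbreviation (input) "lookup \<equiv> Poly_Mapping.lookup"
abbreviation (input) "keys \<equiv> Poly_Mapping.keys"
abbreviation (input) "single \<equiv> Poly_Mapping.single"

section \<open>Linear maps between spaces with a basis\<close>

lemma lookup_pm_scale [simp]: "lookup (pm_scale c p) i = c * lookup p i"
  unfolding pm_scale_def by transfer (auto simp: when_def)

lemma pm_scale_single [simp]: "pm_scale c (single i d) = single i (c * d)"
  by (rule poly_mapping_eqI) (simp add: lookup_single when_def)

lemma pm_scale_add: "pm_scale c (x + y) = pm_scale c x + pm_scale c y"
  by (rule poly_mapping_eqI) (simp add: lookup_add algebra_simps)

lemma pm_scale_diff: "pm_scale c (x - y) = pm_scale c x - pm_scale c y"
  by (rule poly_mapping_eqI) (simp add: lookup_minus algebra_simps)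

lemma pm_scale_add_left: "pm_scale (c + d) x = pm_scale c x + pm_scale d x"
  by (rule poly_mapping_eqI) (simp add: lookup_add algebra_simps)

lemma pm_scale_pm_scale [simp]: "pm_scale c (pm_scale d x) = pm_scale (c * d) x"
  by (rule poly_mapping_eqI) (simp add: algebra_simps)

lemma pm_scale_0 [simp]: "pm_scale c 0 = 0" "pm_scale 0 x = 0"
  by (rule poly_mapping_eqI, simp)+

lemma pm_scale_1 [simp]: "pm_scale 1 x = x"
  by (rule poly_mapping_eqI, simp)

lemma pm_scale_uminus [simp]: "pm_scale (- c) x = - pm_scale c x" "pm_scale c (- x) = - pm_scale c x"
  by (rule poly_mapping_eqI, simp)+

lemma pm_scale_sum: "pm_scale c (sum f A) = (\<Sum>x\<in>A. pm_scale c (f x))"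
  by (induction A rule: infinite_finite_induct) (auto simp: pm_scale_add)

lemma pm_scale_conv_mult: "pm_scale c x = single 0 c * x"
  for x :: "'m::monoid_add \<Rightarrow>\<^sub>0 'k::field"
  unfolding pm_scale_def by (rule mult_map_scale_conv_mult)

lemma keys_pm_scale: "keys (pm_scale c p) \<subseteq> keys p"
  by (auto simp: in_keys_iff)

lemma poly_mapping_sum_single: "(p :: 'i \<Rightarrow>\<^sub>0 'k::field) = (\<Sum>i\<in>keys p. single i (lookup p i))"
proof (rule poly_mapping_eqI)
  fix j
  show "lookup p j = lookup (\<Sum>i\<in>keys p. single i (lookup p i)) j"
    by (cases "j \<in> keys p")
      (auto simp: lookup_sum lookup_single when_def in_keys_iff sum.delta)
qed

lemma pm_induct [case_names zero step]:
  fixes p :: "'i \<Rightarrow>\<^sub>0 'k::field"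
  assumes "P 0" "\<And>i c x. c \<noteq> 0 \<Longrightarrow> P x \<Longrightarrow> P (single i c + x)"
  shows "P p"
proof -
  have "finite A \<Longrightarrow> A \<subseteq> keys p \<Longrightarrow> P (\<Sum>i\<in>A. single i (lookup p i))" for A
    by (induction A rule: finite_induct) (auto simp: assms in_keys_iff)
  then show ?thesis
    using poly_mapping_sum_single[of p] by (metis finite_keys order_refl)
qed

definition plin :: "(('i \<Rightarrow>\<^sub>0 'k::field) \<Rightarrow> ('j \<Rightarrow>\<^sub>0 'k)) \<Rightarrow> bool" where
  "plin f \<longleftrightarrow> (\<forall>x y. f (x + y) = f x + f y) \<and> (\<forall>c x. f (pm_scale c x) = pm_scale c (f x))"

text \<open>The linear extension of a map on basis vectors. By \<open>plin_conv_lin\<close> every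
  linear map arises in this way, which is how identities are reduced to basis vectors.\<close>

definition lin :: "('i \<Rightarrow> ('j \<Rightarrow>\<^sub>0 'k::field)) \<Rightarrow> ('i \<Rightarrow>\<^sub>0 'k) \<Rightarrow> ('j \<Rightarrow>\<^sub>0 'k)" where
  "lin b p = (\<Sum>i\<in>keys p. pm_scale (lookup p i) (b i))"

lemma lin_superset:
  assumes "finite A" "keys p \<subseteq> A"
  shows "lin b p = (\<Sum>i\<in>A. pm_scale (lookup p i) (b i))"
  unfolding lin_def using assms by (intro sum.mono_neutral_left) (auto simp: in_keys_iff)

lemma plinI:
  "(\<And>x y. f (x + y) = f x + f y) \<Longrightarrow> (\<And>c x. f (pm_scale c x) = pm_scale c (f x)) \<Longrightarrow> plin f"
  by (simp add: plin_def)

lemma plin_add: "plin f \<Longrightarrow> f (x + y) = f x + f y"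
  and plin_scale: "plin f \<Longrightarrow> f (pm_scale c x) = pm_scale c (f x)"
  by (simp_all add: plin_def)

lemma plin_0: "plin f \<Longrightarrow> f 0 = 0"
  by (metis pm_scale_0(2) plin_scale)

lemma plin_uminus: "plin f \<Longrightarrow> f (- x) = - f x"
  by (metis plin_scale pm_scale_1 pm_scale_uminus(1))

lemma plin_diff: "plin f \<Longrightarrow> f (x - y) = f x - f y"
  using plin_add[of f x "- y"] by (simp add: plin_uminus)

lemma plin_sum: "plin f \<Longrightarrow> f (sum g A) = (\<Sum>x\<in>A. f (g x))"
  by (induction A rule: infinite_finite_induct) (auto simp: plin_0 plin_add)

lemma plin_lin [intro, simp]: "plin (lin b)"
proof (rule plinI)
  fix x y
  show "lin b (x + y) = lin b x + lin b y"
    using keys_add[of x y] lin_superset[of "keys x \<union> keys y" _ b]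
    by (simp add: lookup_add pm_scale_add_left sum.distrib)
next
  fix c x
  show "lin b (pm_scale c x) = pm_scale c (lin b x)"
    using lin_superset[of "keys x" _ b] keys_pm_scale[of c x]
    by (simp add: pm_scale_sum)
qed

lemmas lin_add = plin_add[OF plin_lin] and lin_scale = plin_scale[OF plin_lin]
  and lin_0 [simp] = plin_0[OF plin_lin] and lin_uminus = plin_uminus[OF plin_lin]
  and lin_diff = plin_diff[OF plin_lin] and lin_sum = plin_sum[OF plin_lin]

lemma lin_single [simp]: "lin b (single i c) = pm_scale c (b i)"
  by (cases "c = 0") (auto simp: lin_def)

lemma plin_eqI:
  assumes "plin f" "plin g" "\<And>i. f (single i 1) = g (single i 1)"
  shows "f x = g x"
proof (induction x rule: pm_induct)
  case (step i c x)
  have "f (single i c) = g (single i c)"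
    using assms(3)[of i] plin_scale[OF assms(1), of c "single i 1"]
      plin_scale[OF assms(2), of c "single i 1"] by simp
  then show ?case using step by (simp add: plin_add[OF assms(1)] plin_add[OF assms(2)])
qed (simp add: assms plin_0)

lemma plin_conv_lin: "plin f \<Longrightarrow> f x = lin (\<lambda>i. f (single i 1)) x"
  by (rule plin_eqI) auto

lemma lin_id: "lin (\<lambda>i. single i 1) x = x"
  using plin_conv_lin[of "\<lambda>x. x" x] by (simp add: plin_def)

lemma plin_id [intro, simp]: "plin (\<lambda>x. x)" and plin_zero [intro, simp]: "plin (\<lambda>x. 0)"
  by (auto intro!: plinI)

lemma plin_pm_scale [intro]: "plin f \<Longrightarrow> plin (\<lambda>x. pm_scale c (f x))"
  by (auto intro!: plinI simp: plin_add plin_scale pm_scale_add mult.commute)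

lemma plin_plus [intro]: "plin f \<Longrightarrow> plin g \<Longrightarrow> plin (\<lambda>x. f x + g x)"
  by (auto intro!: plinI simp: plin_add plin_scale pm_scale_add)

lemma plin_minus [intro]: "plin f \<Longrightarrow> plin g \<Longrightarrow> plin (\<lambda>x. f x - g x)"
  by (auto intro!: plinI simp: plin_add plin_scale pm_scale_diff)

lemma plin_sumI [intro]: "(\<And>i. i \<in> A \<Longrightarrow> plin (f i)) \<Longrightarrow> plin (\<lambda>x. \<Sum>i\<in>A. f i x)"
  by (induction A rule: infinite_finite_induct) auto

lemma plin_comp: "plin f \<Longrightarrow> plin g \<Longrightarrow> plin (\<lambda>x. f (g x))"
  by (auto intro!: plinI simp: plin_add plin_scale)

lemma plin_lin_comp [intro]: "plin f \<Longrightarrow> plin (\<lambda>x. lin b (f x))"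
  by (rule plin_comp) auto

lemma plin_lin_param [intro]: "(\<And>i. plin (\<lambda>x. b x i)) \<Longrightarrow> plin (\<lambda>x. lin (b x) y)"
  unfolding lin_def by (intro plin_sumI plin_pm_scale)

lemma plin_mult_left [intro]: "plin f \<Longrightarrow> plin (\<lambda>x. a * f x)"
  for a :: "'m::monoid_add \<Rightarrow>\<^sub>0 'k::field"
proof (rule plinI, goal_cases)
  case (2 c x)
  have "a * (single 0 c * f x) = single 0 c * (a * f x)"
  proof -
    have "a * single 0 c = single 0 c * a"
      by (subst poly_mapping_sum_single[of a], subst (3) poly_mapping_sum_single[of a])
        (simp add: sum_distrib_left sum_distrib_right mult_single mult.commute)
    then show ?thesis by (metis mult.assoc)
  qed
  then show ?case using 2 by (simp add: plin_scale pm_scale_conv_mult)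
qed (simp add: plin_add algebra_simps)

lemma plin_mult_right [intro]: "plin f \<Longrightarrow> plin (\<lambda>x. f x * a)"
  for a :: "'m::monoid_add \<Rightarrow>\<^sub>0 'k::field"
  by (rule plinI) (auto simp: plin_add plin_scale algebra_simps pm_scale_conv_mult)

lemma pm_scale_mult_left: "pm_scale c x * y = pm_scale c (x * y)"
  and pm_scale_mult_right: "x * pm_scale c y = pm_scale c (x * y)"
  for x y :: "'m::monoid_add \<Rightarrow>\<^sub>0 'k::field"
  using plin_scale[OF plin_mult_right[OF plin_id], of c x y]
    plin_scale[OF plin_mult_left[OF plin_id], of x c y] by simp_all

section \<open>Bilinear maps and the tensor product of coordinate vectors\<close>

definition bilin :: "(('i \<Rightarrow>\<^sub>0 'k::field) \<Rightarrow> ('j \<Rightarrow>\<^sub>0 'k) \<Rightarrow> ('l \<Rightarrow>\<^sub>0 'k)) \<Rightarrow> bool" where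
  "bilin B \<longleftrightarrow> (\<forall>y. plin (\<lambda>x. B x y)) \<and> (\<forall>x. plin (B x))"

definition bext ::
  "('i \<Rightarrow> 'j \<Rightarrow> ('l \<Rightarrow>\<^sub>0 'k::field)) \<Rightarrow> ('i \<Rightarrow>\<^sub>0 'k) \<Rightarrow> ('j \<Rightarrow>\<^sub>0 'k) \<Rightarrow> ('l \<Rightarrow>\<^sub>0 'k)" where
  "bext b x y = lin (\<lambda>i. lin (b i) y) x"

lemma bilinI: "(\<And>y. plin (\<lambda>x. B x y)) \<Longrightarrow> (\<And>x. plin (B x)) \<Longrightarrow> bilin B"
  by (simp add: bilin_def)

lemma bilin_left: "bilin B \<Longrightarrow> plin (\<lambda>x. B x y)" and bilin_right: "bilin B \<Longrightarrow> plin (B x)"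
  by (simp_all add: bilin_def)

lemma bilin_left_comp: "bilin B \<Longrightarrow> plin f \<Longrightarrow> plin (\<lambda>x. B (f x) y)"
  by (rule plin_comp[OF bilin_left])

lemma bilin_right_comp: "bilin B \<Longrightarrow> plin f \<Longrightarrow> plin (\<lambda>x. B y (f x))"
  by (rule plin_comp[OF bilin_right])

lemma bilin_bext [intro, simp]: "bilin (bext b)"
  unfolding bext_def by (rule bilinI) auto

lemma bext_single [simp]: "bext b (single i c) (single j d) = pm_scale (c * d) (b i j)"
  by (simp add: bext_def)

lemma bilin_eqI:
  assumes "bilin B" "bilin C" "\<And>i j. B (single i 1) (single j 1) = C (single i 1) (single j 1)"
  shows "B x y = C x y"
proof -
  have "B (single i 1) y = C (single i 1) y" for i
    by (rule plin_eqI[OF bilin_right[OF assms(1)] bilin_right[OF assms(2)]]) (rule assms)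
  then show ?thesis
    by (rule plin_eqI[OF bilin_left[OF assms(1)] bilin_left[OF assms(2)]])
qed

definition tens :: "('i \<Rightarrow>\<^sub>0 'k::field) \<Rightarrow> ('j \<Rightarrow>\<^sub>0 'k) \<Rightarrow> ('i \<times> 'j \<Rightarrow>\<^sub>0 'k)" where
  "tens = bext (\<lambda>i j. single (i, j) 1)"

lemma bilin_tens [intro, simp]: "bilin tens"
  by (simp add: tens_def)

lemma tens_single [simp]: "tens (single i c) (single j d) = single (i, j) (c * d)"
  by (simp add: tens_def)

lemma lin_tens:
  fixes B :: "('a \<Rightarrow>\<^sub>0 'c::field) \<Rightarrow> ('b \<Rightarrow>\<^sub>0 'c) \<Rightarrow> ('d \<Rightarrow>\<^sub>0 'c)"
  assumes "bilin B"
  shows "lin (\<lambda>z. B (single (fst z) 1) (single (snd z) 1)) (tens x y) = B x y"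
proof (rule bilin_eqI[OF bilinI assms])
  show "plin (\<lambda>x. lin b (tens x y))" "plin (\<lambda>y. lin b (tens x y))"
    for b :: "'a \<times> 'b \<Rightarrow> ('d \<Rightarrow>\<^sub>0 'c)" and x :: "'a \<Rightarrow>\<^sub>0 'c" and y
    by (rule plin_lin_comp, rule bilin_left bilin_right, rule bilin_tens)+
qed auto

lemma keys_lin: "keys (lin b x) \<subseteq> (\<Union>i\<in>keys x. keys (b i))"
  unfolding lin_def using keys_pm_scale
  by (intro order_trans[OF keys_sum]) fastforce

section \<open>Coordinates\<close>

text \<open>Only addition and scalars are constrained, because the record of a tensor product
  carries a meaningless product. The laws of an abelian group are not assumed: they are pulled back
  along the injection \<open>r\<close>.\<close>

locale coords =
  fixes U :: "('k::field, 'a, 'm) module_scheme" (structure) and r :: "'a \<Rightarrow> ('i \<Rightarrow>\<^sub>0 'k)"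
  assumes bij: "bij_betw r (carrier U) UNIV"
    and add_closed [simp, intro]: "x \<in> carrier U \<Longrightarrow> y \<in> carrier U \<Longrightarrow> x \<oplus> y \<in> carrier U"
    and r_add [simp]: "x \<in> carrier U \<Longrightarrow> y \<in> carrier U \<Longrightarrow> r (x \<oplus> y) = r x + r y"
    and zero_closed [simp, intro]: "\<zero> \<in> carrier U"
    and r_zero [simp]: "r \<zero> = 0"
    and smult_closed [simp, intro]: "x \<in> carrier U \<Longrightarrow> c \<odot> x \<in> carrier U"
    and r_smult [simp]: "x \<in> carrier U \<Longrightarrow> r (c \<odot> x) = pm_scale c (r x)"
begin

definition el :: "('i \<Rightarrow>\<^sub>0 'k) \<Rightarrow> 'a" where "el = the_inv_into (carrier U) r"

lemma el_closed [simp, intro]: "el p \<in> carrier U"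
  unfolding el_def by (meson UNIV_I bij bij_betwE bij_betw_the_inv_into)

lemma r_el [simp]: "r (el p) = p"
  unfolding el_def by (metis UNIV_I bij f_the_inv_into_f_bij_betw)

lemma r_inj: "x \<in> carrier U \<Longrightarrow> y \<in> carrier U \<Longrightarrow> r x = r y \<longleftrightarrow> x = y"
  using bij by (auto simp: bij_betw_def inj_on_def)

lemma r_eqI: "r x = r y \<Longrightarrow> x \<in> carrier U \<Longrightarrow> y \<in> carrier U \<Longrightarrow> x = y"
  using r_inj by blast

lemma el_r [simp]: "x \<in> carrier U \<Longrightarrow> el (r x) = x"
  by (rule r_eqI) auto

lemma el_eqI: "x \<in> carrier U \<Longrightarrow> r x = p \<Longrightarrow> el p = x"
  by auto

lemma abelian_group: "abelian_group U"
proof (rule abelian_groupI)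
  fix x assume x: "x \<in> carrier U"
  show "\<exists>y\<in>carrier U. y \<oplus> x = \<zero>"
    by (rule bexI[of _ "el (- r x)"]) (auto intro: r_eqI simp: x)
qed (auto intro!: r_eqI simp: add_ac)

sublocale abelian_group U by (rule abelian_group)

lemma r_finsum: "finite A \<Longrightarrow> f \<in> A \<rightarrow> carrier U \<Longrightarrow> r (finsum U f A) = (\<Sum>x\<in>A. r (f x))"
proof (induction A rule: finite_induct)
  case (insert a A)
  then show ?case by (subst finsum_insert) (auto simp: Pi_iff)
qed simp

lemma r_a_inv [simp]: "x \<in> carrier U \<Longrightarrow> r (\<ominus> x) = - r x"
  using r_add[of x "\<ominus> x"] by (simp add: r_neg eq_neg_iff_add_eq_0 add.commute)

lemma r_a_minus [simp]: "x \<in> carrier U \<Longrightarrow> y \<in> carrier U \<Longrightarrow> r (x \<ominus> y) = r x - r y"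
  by (simp add: a_minus_def)

text \<open>Serves to compute graded components and filtration steps that are defined as spans of
  sets such as pure tensors: the generating set needs to be known only up to the bounds given by the
  two assumptions.\<close>

lemma lspan_eq:
  assumes S: "S \<subseteq> {x \<in> carrier U. keys (r x) \<subseteq> P}" and P: "\<And>i. i \<in> P \<Longrightarrow> el (single i 1) \<in> S"
  shows "lspan U S = {x \<in> carrier U. keys (r x) \<subseteq> P}"
proof safe
  fix x assume "x \<in> lspan U S"
  then have "x \<in> carrier U \<and> keys (r x) \<subseteq> P"
  proof induction
    case (step x y c)
    then have "x \<in> carrier U" "keys (r x) \<subseteq> P" using S by auto
    then show ?case
      using step keys_add[of "pm_scale c (r x)" "r y"] keys_pm_scale[of c "r x"] by auto
  qed auto
  then show "x \<in> carrier U" "\<And>i. i \<in> keys (r x) \<Longrightarrow> i \<in> P" by auto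
next
  fix x assume x: "x \<in> carrier U" "keys (r x) \<subseteq> P"
  have "el (\<Sum>i\<in>A. single i (lookup (r x) i)) \<in> lspan U S" if "finite A" "A \<subseteq> P" for A
    using that
  proof (induction A rule: finite_induct)
    case empty
    then show ?case by (subst el_eqI[of \<zero>]) (auto intro: lspan.zero)
  next
    case (insert i A)
    then have "lookup (r x) i \<odot> el (single i 1) \<oplus> el (\<Sum>i\<in>A. single i (lookup (r x) i)) \<in> lspan U S"
      by (intro lspan.step P) auto
    then show ?case using insert by (subst el_eqI) (auto simp: add.commute)
  qed
  from this[of "keys (r x)"] show "x \<in> lspan U S"
    using x by (simp flip: poly_mapping_sum_single)
qed

end

text \<open>When \<open>I\<close> is the kernel of a surjective linear map \<open>\<pi>\<close>, a
  coset is a fibre of \<open>\<pi>\<close>. Hence every operation defined by choosing a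
  representative, or by a union over all of them, can be evaluated through
  \<open>\<pi>\<close>.\<close>

locale lin_quot = abelian_group M
  for M :: "('k::field, 'a, 'm) module_scheme" (structure) +
  fixes \<pi> :: "'a \<Rightarrow> ('i \<Rightarrow>\<^sub>0 'k)" and I :: "'a set"
  assumes pi_add [simp]: "x \<in> carrier M \<Longrightarrow> y \<in> carrier M \<Longrightarrow> \<pi> (x \<oplus> y) = \<pi> x + \<pi> y"
    and smult_closed [simp, intro]: "x \<in> carrier M \<Longrightarrow> c \<odot> x \<in> carrier M"
    and pi_smult [simp]: "x \<in> carrier M \<Longrightarrow> \<pi> (c \<odot> x) = pm_scale c (\<pi> x)"
    and surj: "\<pi> ` carrier M = UNIV"
    and I_eq: "I = {x \<in> carrier M. \<pi> x = 0}"
begin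

definition rq :: "'a set \<Rightarrow> ('i \<Rightarrow>\<^sub>0 'k)" where "rq X = \<pi> (SOME x. x \<in> X)"

lemma pi_zero [simp]: "\<pi> \<zero> = 0"
  using pi_add[of \<zero> \<zero>] by simp

lemma pi_a_inv [simp]: "x \<in> carrier M \<Longrightarrow> \<pi> (\<ominus> x) = - \<pi> x"
  using pi_add[of x "\<ominus> x"] by (simp add: r_neg eq_neg_iff_add_eq_0 add.commute)

lemma coset: "x \<in> carrier M \<Longrightarrow> I +> x = {y \<in> carrier M. \<pi> y = \<pi> x}"
proof safe
  fix y assume x: "x \<in> carrier M" and "y \<in> I +> x"
  then show "y \<in> carrier M" "\<pi> y = \<pi> x"
    by (auto simp: a_r_coset_def' I_eq)
next
  fix y assume *: "x \<in> carrier M" "y \<in> carrier M" "\<pi> y = \<pi> x"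
  have "y \<ominus> x \<in> I" using * by (simp add: I_eq a_minus_def)
  moreover have "y = (y \<ominus> x) \<oplus> x" using * by (simp add: a_minus_def a_assoc l_neg)
  ultimately show "y \<in> I +> x" by (auto simp: a_r_coset_def')
qed

lemma rq_level [simp]: "x \<in> carrier M \<Longrightarrow> rq {y \<in> carrier M. \<pi> y = \<pi> x} = \<pi> x"
  unfolding rq_def using someI[of "\<lambda>y. y \<in> carrier M \<and> \<pi> y = \<pi> x" x] by simp

lemma rq_coset [simp]: "x \<in> carrier M \<Longrightarrow> rq (I +> x) = \<pi> x"
  by (simp add: coset)

lemma carrier_quot: "carrier (quot_alg M I) = (\<lambda>x. I +> x) ` carrier M"
  by (auto simp: quot_alg_def FactRing_def A_RCOSETS_def')

lemma coset_closed [simp, intro]: "x \<in> carrier M \<Longrightarrow> I +> x \<in> carrier (quot_alg M I)"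
  by (simp add: carrier_quot)

lemma coset_add:
  assumes "x \<in> carrier M" "y \<in> carrier M"
  shows "(I +> x) \<oplus>\<^bsub>quot_alg M I\<^esub> (I +> y) = I +> (x \<oplus> y)"
proof -
  have "(\<Union>a\<in>{z \<in> carrier M. \<pi> z = \<pi> x}. \<Union>b\<in>{z \<in> carrier M. \<pi> z = \<pi> y}. {a \<oplus> b}) =
    {z \<in> carrier M. \<pi> z = \<pi> (x \<oplus> y)}" (is "?L = ?R")
  proof safe
    fix z assume z: "z \<in> carrier M" "\<pi> z = \<pi> (x \<oplus> y)"
    have "z = x \<oplus> (\<ominus> x \<oplus> z)" using assms z by (simp add: r_neg2)
    moreover have "\<ominus> x \<oplus> z \<in> {z \<in> carrier M. \<pi> z = \<pi> y}" using assms z by simp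
    ultimately show "z \<in> ?L" using assms by (intro UN_I[of x] UN_I[of "\<ominus> x \<oplus> z"]) simp_all
  qed (use assms in auto)
  then show ?thesis using assms
    by (simp add: quot_alg_def FactRing_def set_add_def' coset)
qed

lemma coset_eqI: "x \<in> carrier M \<Longrightarrow> y \<in> carrier M \<Longrightarrow> \<pi> x = \<pi> y \<Longrightarrow> I +> x = I +> y"
  by (simp add: coset)

lemma coset_smult:
  assumes "x \<in> carrier M"
  shows "c \<odot>\<^bsub>quot_alg M I\<^esub> (I +> x) = I +> (c \<odot> x)"
proof -
  have "I +> (c \<odot> y) = I +> (c \<odot> x)" if "y \<in> I +> x" for y
    using that assms by (intro coset_eqI) (auto simp: coset)
  moreover have "x \<in> I +> x" using assms by (simp add: coset)
  ultimately have "(\<Union>y\<in>I +> x. I +> (c \<odot> y)) = I +> (c \<odot> x)" by blast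
  then show ?thesis by (simp add: quot_alg_def)
qed

text \<open>Works without a ring or an ideal: it suffices that the product descends along
  \<open>\<pi>\<close> to some operation \<open>B\<close>, for then the product of representatives
  stays in one fibre.\<close>

lemma coset_mult:
  assumes "x \<in> carrier M" "y \<in> carrier M"
    and mult: "\<And>a b. a \<in> carrier M \<Longrightarrow> b \<in> carrier M \<Longrightarrow> a \<otimes> b \<in> carrier M \<and> \<pi> (a \<otimes> b) = B (\<pi> a) (\<pi> b)"
  shows "(I +> x) \<otimes>\<^bsub>quot_alg M I\<^esub> (I +> y) = I +> (x \<otimes> y)"
proof -
  have "I +> (a \<otimes> b) = I +> (x \<otimes> y)" if "a \<in> I +> x" "b \<in> I +> y" for a b
    using that assms by (intro coset_eqI) (auto simp: coset)
  moreover have "x \<in> I +> x" "y \<in> I +> y" using assms by (simp_all add: coset)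
  ultimately have "(\<Union>a\<in>I +> x. \<Union>b\<in>I +> y. I +> (a \<otimes> b)) = I +> (x \<otimes> y)" by blast
  then show ?thesis by (simp add: quot_alg_def FactRing_def rcoset_mult_def)
qed

lemma coset_zero: "I +> \<zero> = \<zero>\<^bsub>quot_alg M I\<^esub>"
  by (auto simp: quot_alg_def FactRing_def coset I_eq)

lemma coset_one: "I +> \<one> = \<one>\<^bsub>quot_alg M I\<^esub>"
  by (simp add: quot_alg_def FactRing_def)

sublocale q: coords "quot_alg M I" rq
proof
  show "bij_betw rq (carrier (quot_alg M I)) UNIV"
  proof (rule bij_betwI')
    fix X Y assume "X \<in> carrier (quot_alg M I)" "Y \<in> carrier (quot_alg M I)"
    then obtain x y where "x \<in> carrier M" "y \<in> carrier M" "X = I +> x" "Y = I +> y"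
      by (auto simp: carrier_quot)
    then show "rq X = rq Y \<longleftrightarrow> X = Y"
      using coset_eqI[of x y] by (metis rq_coset)
  next
    fix p :: "'i \<Rightarrow>\<^sub>0 'k"
    from surj obtain x where "x \<in> carrier M" "p = \<pi> x" by (metis UNIV_I imageE)
    then show "\<exists>X\<in>carrier (quot_alg M I). p = rq X" by (metis coset_closed rq_coset)
  qed auto
qed (auto simp: carrier_quot coset_add coset_smult simp flip: coset_zero)

end

section \<open>Tensor products in coordinates\<close>

definition tmap :: "('a \<Rightarrow> ('i \<Rightarrow>\<^sub>0 'k)) \<Rightarrow> ('b \<Rightarrow> ('j \<Rightarrow>\<^sub>0 'k)) \<Rightarrow> ('a \<times> 'b \<Rightarrow>\<^sub>0 'k::field) \<Rightarrow> ('i \<times> 'j \<Rightarrow>\<^sub>0 'k)"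
  where "tmap rV rW = lin (\<lambda>z. tens (rV (fst z)) (rW (snd z)))"

text \<open>The coordinate map \<open>rq\<close> of the quotient, but stated outside any locale and
  independently of \<open>V\<close> and \<open>W\<close>, so that it can serve as coordinates for
  the constructions built on a tensor product.\<close>

definition tco :: "('a \<Rightarrow> ('i \<Rightarrow>\<^sub>0 'k)) \<Rightarrow> ('b \<Rightarrow> ('j \<Rightarrow>\<^sub>0 'k)) \<Rightarrow> ('k::field, 'a, 'b) tens \<Rightarrow> ('i \<times> 'j \<Rightarrow>\<^sub>0 'k)"
  where "tco rV rW X = tmap rV rW (SOME p. p \<in> X)"

lemma formal_sums_simps [simp]:
  "carrier (formal_sums V W) = {p. keys p \<subseteq> carrier V \<times> carrier W}"
  "zero (formal_sums V W) = 0" "add (formal_sums V W) = (+)" "smult (formal_sums V W) = pm_scale"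
  by (simp_all add: formal_sums_def)

lemma abelian_group_formal_sums: "abelian_group (formal_sums V W)"
proof (rule abelian_groupI)
  fix x assume "x \<in> carrier (formal_sums V W)"
  then show "\<exists>y\<in>carrier (formal_sums V W). y \<oplus>\<^bsub>formal_sums V W\<^esub> x = \<zero>\<^bsub>formal_sums V W\<^esub>"
    by (intro bexI[of _ "- x"]) (auto simp: in_keys_iff)
next
  fix x y assume "x \<in> carrier (formal_sums V W)" "y \<in> carrier (formal_sums V W)"
  then show "x \<oplus>\<^bsub>formal_sums V W\<^esub> y \<in> carrier (formal_sums V W)"
    using keys_add[of x y] by auto
qed (auto simp: add_ac)

lemma tensor_null_closed:
  shows tensor_null_0: "0 \<in> tensor_null V W"
    and tensor_null_add: "x \<in> tensor_null V W \<Longrightarrow> y \<in> tensor_null V W \<Longrightarrow> x + y \<in> tensor_null V W"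
    and tensor_null_scale: "x \<in> tensor_null V W \<Longrightarrow> pm_scale c x \<in> tensor_null V W"
    and tensor_null_rel: "x \<in> bilinear_rels V W \<Longrightarrow> x \<in> tensor_null V W"
proof -
  show z: "0 \<in> tensor_null V W"
    unfolding tensor_null_def using lspan.zero[of "formal_sums V W"] by simp
  have step: "s \<in> bilinear_rels V W \<Longrightarrow> y \<in> tensor_null V W \<Longrightarrow> pm_scale c s + y \<in> tensor_null V W" for s y c
    unfolding tensor_null_def using lspan.step[of s "bilinear_rels V W" y "formal_sums V W" c] by simp
  show "x \<in> tensor_null V W \<Longrightarrow> y \<in> tensor_null V W \<Longrightarrow> x + y \<in> tensor_null V W"
    by (unfold tensor_null_def, induction rule: lspan.induct)
      (auto simp: add.assoc intro: step[unfolded tensor_null_def])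
  show "x \<in> tensor_null V W \<Longrightarrow> pm_scale c x \<in> tensor_null V W"
    by (unfold tensor_null_def, induction rule: lspan.induct)
      (auto simp: pm_scale_add intro: step[unfolded tensor_null_def] z[unfolded tensor_null_def])
  show "x \<in> bilinear_rels V W \<Longrightarrow> x \<in> tensor_null V W"
    using step[of x 0 1] z by simp
qed

locale tensor_coords = V: coords V rV + W: coords W rW
  for V :: "('k::field, 'a, 'm) module_scheme" and rV :: "'a \<Rightarrow> ('i \<Rightarrow>\<^sub>0 'k)"
    and W :: "('k, 'b, 'n) module_scheme" and rW :: "'b \<Rightarrow> ('j \<Rightarrow>\<^sub>0 'k)"
begin

lemma plin_tmap: "plin (tmap rV rW)"
  by (simp add: tmap_def)

lemma tmap_single [simp]: "tmap rV rW (single (a, b) c) = pm_scale c (tens (rV a) (rW b))"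
  by (simp add: tmap_def)

lemma tmap_null: "x \<in> tensor_null V W \<Longrightarrow> tmap rV rW x = 0 \<and> keys x \<subseteq> carrier V \<times> carrier W"
  unfolding tensor_null_def
proof (induction rule: lspan.induct)
  case (step x y c)
  note [simp] = plin_add[OF plin_tmap] plin_diff[OF plin_tmap] plin_scale[OF plin_tmap]
    plin_add[OF bilin_left[OF bilin_tens]] plin_scale[OF bilin_left[OF bilin_tens]]
    plin_add[OF bilin_right[OF bilin_tens]] plin_scale[OF bilin_right[OF bilin_tens]]
  have "tmap rV rW x = 0" using step(1) by (auto simp: bilinear_rels_def)
  moreover have "keys x \<subseteq> carrier V \<times> carrier W"
    using step(1)
    by (auto simp: bilinear_rels_def in_keys_iff lookup_add lookup_minus lookup_single when_def
        split: if_splits)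
  ultimately show ?case
    using step keys_add[of "pm_scale c x" y] keys_pm_scale[of c x] by auto
qed (auto simp: plin_0[OF plin_tmap])

text \<open>A section of \<open>tmap\<close>: the representative of a tensor that uses only pairs of
  basis vectors.\<close>

definition nform :: "('i \<times> 'j \<Rightarrow>\<^sub>0 'k) \<Rightarrow> ('a \<times> 'b \<Rightarrow>\<^sub>0 'k)" where
  "nform = lin (\<lambda>(i, j). single (V.el (single i 1), W.el (single j 1)) 1)"

lemma plin_nform: "plin nform"
  by (simp add: nform_def)

lemma null_expand_left:
  assumes b: "b \<in> carrier W"
  shows "single (V.el p, b) 1 - lin (\<lambda>i. single (V.el (single i 1), b) 1) p \<in> tensor_null V W"
proof (induction p rule: pm_induct)
  case zero
  \<comment> \<open>The scalar relation with c = 0: since 0 times \<open>el 0\<close> is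
    \<open>el 0\<close> again, it says that the pair \<open>(el 0, b)\<close> itself is
    null.\<close>
  have "single (0 \<odot>\<^bsub>V\<^esub> V.el 0, b) 1 - single (V.el 0, b) 0 \<in> bilinear_rels V W"
    using b unfolding bilinear_rels_def by blast
  moreover have "0 \<odot>\<^bsub>V\<^esub> V.el 0 = V.el 0" by (intro V.r_eqI) auto
  ultimately show ?case by (auto intro: tensor_null_rel)
next
  case (step i c x)
  let ?e = "V.el (single i 1)"
  have 1: "single (c \<odot>\<^bsub>V\<^esub> ?e, b) 1 - single (?e, b) c \<in> tensor_null V W"
    using b by (intro tensor_null_rel) (unfold bilinear_rels_def, blast)
  have 2: "single ((c \<odot>\<^bsub>V\<^esub> ?e) \<oplus>\<^bsub>V\<^esub> V.el x, b) 1 - single (c \<odot>\<^bsub>V\<^esub> ?e, b) 1 - single (V.el x, b) 1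
    \<in> tensor_null V W"
    using b by (intro tensor_null_rel) (unfold bilinear_rels_def, blast)
  have 3: "(c \<odot>\<^bsub>V\<^esub> ?e) \<oplus>\<^bsub>V\<^esub> V.el x = V.el (single i c + x)" by (intro V.r_eqI) auto
  have *: "single (V.el (single i c + x), b) 1 - single (?e, b) c - single (V.el x, b) 1
    \<in> tensor_null V W"
    using tensor_null_add[OF 1 2] by (simp add: 3 diff_right_commute)
  from tensor_null_add[OF * step(2)] show ?case
    by (simp add: lin_add algebra_simps)
qed

lemma null_expand_right:
  assumes a: "a \<in> carrier V"
  shows "single (a, W.el p) 1 - lin (\<lambda>j. single (a, W.el (single j 1)) 1) p \<in> tensor_null V W"
proof (induction p rule: pm_induct)
  case zero
  have "single (a, 0 \<odot>\<^bsub>W\<^esub> W.el 0) 1 - single (a, W.el 0) 0 \<in> bilinear_rels V W"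
    using a unfolding bilinear_rels_def by blast
  moreover have "0 \<odot>\<^bsub>W\<^esub> W.el 0 = W.el 0" by (intro W.r_eqI) auto
  ultimately show ?case by (auto intro: tensor_null_rel)
next
  case (step i c x)
  let ?e = "W.el (single i 1)"
  have 1: "single (a, c \<odot>\<^bsub>W\<^esub> ?e) 1 - single (a, ?e) c \<in> tensor_null V W"
    using a by (intro tensor_null_rel) (unfold bilinear_rels_def, blast)
  have 2: "single (a, (c \<odot>\<^bsub>W\<^esub> ?e) \<oplus>\<^bsub>W\<^esub> W.el x) 1 - single (a, c \<odot>\<^bsub>W\<^esub> ?e) 1 - single (a, W.el x) 1
    \<in> tensor_null V W"
    using a by (intro tensor_null_rel) (unfold bilinear_rels_def, blast)
  have 3: "(c \<odot>\<^bsub>W\<^esub> ?e) \<oplus>\<^bsub>W\<^esub> W.el x = W.el (single i c + x)" by (intro W.r_eqI) auto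
  have *: "single (a, W.el (single i c + x)) 1 - single (a, ?e) c - single (a, W.el x) 1
    \<in> tensor_null V W"
    using tensor_null_add[OF 1 2] by (simp add: 3 diff_right_commute)
  from tensor_null_add[OF * step(2)] show ?case
    by (simp add: lin_add algebra_simps)
qed

lemma null_lin:
  assumes "\<And>i. f i - g i \<in> tensor_null V W"
  shows "lin f p - lin g p \<in> tensor_null V W"
proof (induction p rule: pm_induct)
  case (step i c x)
  from tensor_null_add[OF tensor_null_scale[OF assms[of i], of c] step(2)] show ?case
    by (simp add: lin_add pm_scale_diff algebra_simps)
qed (simp add: tensor_null_0)

lemma null_expand:
  assumes "a \<in> carrier V" "b \<in> carrier W"
  shows "single (a, b) 1 - nform (tens (rV a) (rW b)) \<in> tensor_null V W"
proof -
  have "lin (\<lambda>i. single (V.el (single i 1), b) 1) p -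
    lin (\<lambda>i. lin (\<lambda>j. single (V.el (single i 1), W.el (single j 1)) 1) (rW b)) p \<in> tensor_null V W" for p
    using null_expand_right[of _ "rW b"] assms by (intro null_lin) auto
  note 1 = this[of "rV a"]
  have 2: "lin (\<lambda>i. lin (\<lambda>j. single (V.el (single i 1), W.el (single j 1)) 1) (rW b)) (rV a)
     = nform (tens (rV a) (rW b))"
    using lin_tens[of "bext (\<lambda>i j. single (V.el (single i 1), W.el (single j 1)) 1)" "rV a" "rW b"]
    by (simp add: nform_def bext_def case_prod_beta')
  from tensor_null_add[OF null_expand_left[of b "rV a"] 1] show ?thesis
    using assms by (simp add: 2)
qed

text \<open>With \<open>tmap_null\<close> this identifies the kernel of \<open>tmap\<close> with
  \<open>tensor_null\<close>: if \<open>tmap\<close> kills \<open>p\<close>, the subtracted normal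
  form is 0 and \<open>p\<close> itself is null.\<close>

lemma null_expand_formal:
  assumes "keys p \<subseteq> carrier V \<times> carrier W"
  shows "p - nform (tmap rV rW p) \<in> tensor_null V W"
proof -
  \<comment> \<open>Induction over subsets of the support; \<open>pm_induct\<close> would lose the
    condition that the pairs lie in the carriers.\<close>
  have "finite A \<Longrightarrow> A \<subseteq> carrier V \<times> carrier W \<Longrightarrow>
    (\<Sum>z\<in>A. single z (lookup p z)) - nform (tmap rV rW (\<Sum>z\<in>A. single z (lookup p z))) \<in> tensor_null V W" for A
  proof (induction A rule: finite_induct)
    case (insert z A)
    obtain a b where z: "z = (a, b)" by force
    have "pm_scale (lookup p z) (single (a, b) 1 - nform (tens (rV a) (rW b))) \<in> tensor_null V W"
      using insert z by (intro tensor_null_scale null_expand) auto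
    from tensor_null_add[OF this insert.IH] insert show ?case
      by (simp add: z plin_add[OF plin_nform] plin_add[OF plin_tmap] plin_scale[OF plin_nform]
          plin_scale[OF plin_tmap] pm_scale_diff algebra_simps)
  qed (simp add: plin_0[OF plin_nform] plin_0[OF plin_tmap] tensor_null_0)
  from this[of "keys p"] assms show ?thesis by (simp flip: poly_mapping_sum_single)
qed

lemma keys_nform: "keys (nform p) \<subseteq> carrier V \<times> carrier W"
  unfolding nform_def by (rule order_trans[OF keys_lin]) (auto split: prod.splits)

lemma tmap_nform: "tmap rV rW (nform p) = p"
  by (rule plin_eqI[where g = "\<lambda>x. x"])
    (auto intro: plin_comp plin_tmap plin_nform simp: nform_def)

sublocale Q: lin_quot "formal_sums V W" "tmap rV rW" "tensor_null V W"
proof -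
  interpret abelian_group "formal_sums V W" by (rule abelian_group_formal_sums)
  show "lin_quot (formal_sums V W) (tmap rV rW) (tensor_null V W)"
  proof
    show "tmap rV rW ` carrier (formal_sums V W) = UNIV"
      using tmap_nform keys_nform by (metis (mono_tags, lifting) UNIV_eq_I formal_sums_simps(1) mem_Collect_eq rangeI rev_image_eqI)
    show "tensor_null V W = {x \<in> carrier (formal_sums V W). tmap rV rW x = 0}"
    proof (intro equalityI subsetI)
      fix x assume "x \<in> {x \<in> carrier (formal_sums V W). tmap rV rW x = 0}"
      then show "x \<in> tensor_null V W"
        using null_expand_formal[of x] plin_0[OF plin_nform] by simp
    qed (simp add: tmap_null)
    show "\<And>x c. x \<in> carrier (formal_sums V W) \<Longrightarrow>
      c \<odot>\<^bsub>formal_sums V W\<^esub> x \<in> carrier (formal_sums V W)"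
      using keys_pm_scale by fastforce
  qed (simp_all add: plin_add[OF plin_tmap] plin_scale[OF plin_tmap])
qed

lemma rq_eq_tco: "Q.rq = tco rV rW"
  by (rule ext) (simp add: Q.rq_def tco_def)

lemma coords_tensor: "coords (tensor V W) (tco rV rW)"
  using Q.q.coords_axioms by (simp add: rq_eq_tco tensor_def)

sublocale T: coords "tensor V W" "tco rV rW" by (rule coords_tensor)

lemma pure_closed [simp, intro]: "a \<in> carrier V \<Longrightarrow> b \<in> carrier W \<Longrightarrow> pure V W a b \<in> carrier (tensor V W)"
  unfolding pure_def tensor_def by (rule Q.coset_closed) auto

lemma tco_pure [simp]:
  "a \<in> carrier V \<Longrightarrow> b \<in> carrier W \<Longrightarrow> tco rV rW (pure V W a b) = tens (rV a) (rW b)"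
  unfolding pure_def rq_eq_tco[symmetric] by (subst Q.rq_coset) auto

text \<open>This makes the arbitrary representative chosen by \<open>tlift\<close> harmless: as
  \<open>B\<close> factors through \<open>tens\<close>, the sum over a representative
  \<open>p\<close> depends on \<open>tmap p\<close> only.\<close>

lemma tlift_coords:
  assumes "coords U rU" and "bilin B" and X: "X \<in> carrier (tensor V W)"
    and f: "\<And>a b. a \<in> carrier V \<Longrightarrow> b \<in> carrier W \<Longrightarrow> f a b \<in> carrier U \<and> rU (f a b) = B (rV a) (rW b)"
  shows "tlift U f X \<in> carrier U \<and>
    rU (tlift U f X) = lin (\<lambda>z. B (single (fst z) 1) (single (snd z) 1)) (tco rV rW X)"
proof -
  interpret U: coords U rU by fact
  define p where "p = (SOME p. p \<in> X)"
  have "\<exists>p. p \<in> X"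
    using X by (auto simp: tensor_def Q.carrier_quot Q.coset)
  then have "p \<in> X" unfolding p_def by (rule someI_ex)
  with X have p: "keys p \<subseteq> carrier V \<times> carrier W"
    by (auto simp: tensor_def Q.carrier_quot Q.coset)
  have mem: "fst z \<in> carrier V" "snd z \<in> carrier W" if "z \<in> keys p" for z
    using subsetD[OF p that] by (simp_all add: mem_Times_iff)
  have eq: "tlift U f X = finsum U (\<lambda>z. lookup p z \<odot>\<^bsub>U\<^esub> f (fst z) (snd z)) (keys p)"
    by (simp add: tlift_def p_def Let_def)
  have cl: "(\<lambda>z. lookup p z \<odot>\<^bsub>U\<^esub> f (fst z) (snd z)) \<in> keys p \<rightarrow> carrier U"
    using mem f by (intro Pi_I U.smult_closed) blast
  have "rU (tlift U f X) = (\<Sum>z\<in>keys p. rU (lookup p z \<odot>\<^bsub>U\<^esub> f (fst z) (snd z)))"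
    unfolding eq by (rule U.r_finsum[OF _ cl]) simp
  also have "\<dots> = (\<Sum>z\<in>keys p. pm_scale (lookup p z) (B (rV (fst z)) (rW (snd z))))"
    using mem f by (intro sum.cong refl) simp
  also have "\<dots> = (\<Sum>z\<in>keys p. pm_scale (lookup p z)
       (lin (\<lambda>z. B (single (fst z) 1) (single (snd z) 1)) (tens (rV (fst z)) (rW (snd z)))))"
    by (simp add: lin_tens[OF \<open>bilin B\<close>])
  also have "\<dots> = lin (\<lambda>z. B (single (fst z) 1) (single (snd z) 1)) (tmap rV rW p)"
    by (simp add: tmap_def lin_def[of _ p] lin_sum lin_scale)
  finally show ?thesis
    using U.finsum_closed[OF cl] by (simp add: eq tco_def p_def)
qed

end

lemma tensor_coordsI: "coords V rV \<Longrightarrow> coords W rW \<Longrightarrow> tensor_coords V rV W rW"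
  by (simp add: tensor_coords_def)

section \<open>Braided tensor products and smash products in coordinates\<close>

text \<open>The scalar by which the group element \<open>h\<close> acts on degree
  \<open>n\<close>.\<close>

definition bsg :: "bit \<Rightarrow> nat \<Rightarrow> 'k::field" where
  "bsg h n = (if h = 0 then 1 else (- 1) ^ n)"

lemma bsg_simps [simp]: "bsg 0 n = 1" "bsg 1 n = (- 1) ^ n" "bsg h 0 = 1"
  by (simp_all add: bsg_def)

lemma bsg_add: "bsg h (m + n) = bsg h m * bsg h n"
  by (simp add: bsg_def power_add)

text \<open>A graded algebra in coordinates: \<open>m\<close> is its product, \<open>e\<close> its
  unit, and the basis vector \<open>i\<close> is homogeneous of degree \<open>deg i\<close>. In
  \<open>malg\<close> the group generator acts on degree n by (-1)^n.\<close>

locale galg = coords A r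
  for A :: "('k::field, 'a, 'z) graded_alg_scheme" (structure) and r :: "'a \<Rightarrow> ('i \<Rightarrow>\<^sub>0 'k)" +
  fixes m :: "('i \<Rightarrow>\<^sub>0 'k) \<Rightarrow> ('i \<Rightarrow>\<^sub>0 'k) \<Rightarrow> ('i \<Rightarrow>\<^sub>0 'k)" and e :: "'i \<Rightarrow>\<^sub>0 'k" and deg :: "'i \<Rightarrow> nat"
  assumes bilin_m: "bilin m"
    and mult_closed [simp, intro]: "x \<in> carrier A \<Longrightarrow> y \<in> carrier A \<Longrightarrow> x \<otimes> y \<in> carrier A"
    and r_mult [simp]: "x \<in> carrier A \<Longrightarrow> y \<in> carrier A \<Longrightarrow> r (x \<otimes> y) = m (r x) (r y)"
    and one_closed [simp, intro]: "\<one> \<in> carrier A"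
    and r_one [simp]: "r \<one> = e"
    and hcomp_eq: "hcomp A n = {x \<in> carrier A. keys (r x) \<subseteq> {i. deg i = n}}"

locale malg = galg A r m e deg
  for A :: "('k::field, 'a, bit \<Rightarrow>\<^sub>0 'k) graded_modalg" (structure)
    and r :: "'a \<Rightarrow> ('i \<Rightarrow>\<^sub>0 'k)" and m e deg +
  assumes act_closed [simp, intro]: "x \<in> carrier A \<Longrightarrow> act A h x \<in> carrier A"
    and r_act [simp]: "x \<in> carrier A \<Longrightarrow> r (act A h x) = bext (\<lambda>e i. single i (bsg e (deg i))) h (r x)"

lemma coords_kC2: "coords (kC2 :: ('k::field, _) hopf) (\<lambda>x. x)"
  by unfold_locales (auto simp: kC2_def bij_id[unfolded id_def])

lemma coords_monoid_alg: "coords (monoid_alg :: ('k::field, bit \<Rightarrow>\<^sub>0 'k) module) (\<lambda>x. x)"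
  by unfold_locales (auto simp: monoid_alg_def bij_id[unfolded id_def])

lemma kC2_simps [simp]:
  "carrier kC2 = UNIV" "mult kC2 = (*)" "one kC2 = 1" "zero kC2 = 0" "add kC2 = (+)"
  "smult kC2 = pm_scale"
  by (simp_all add: kC2_def)

lemma carrier_monoid_alg [simp]: "carrier monoid_alg = UNIV"
  by (simp add: monoid_alg_def)

lemma bilin_times: "bilin ((*) :: ('m::monoid_add \<Rightarrow>\<^sub>0 'k::field) \<Rightarrow> _)"
  by (intro bilinI plin_mult_left plin_mult_right plin_id)

text \<open>Basis elements are group-like. The values lie in the tensor square of
  \<open>monoid_alg\<close>, because the definition of \<open>kC2\<close> cannot refer to
  \<open>kC2\<close>; the R-matrix on the other hand lies in that of \<open>kC2\<close>.\<close>

lemma tco_comult: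
  fixes h :: "bit \<Rightarrow>\<^sub>0 'k::field"
  shows "comult kC2 h \<in> carrier (tensor monoid_alg monoid_alg :: ('k, _) module)"
    and "tco (\<lambda>x. x) (\<lambda>x. x) (comult kC2 h) = lin (\<lambda>e. single (e, e) 1) h"
proof -
  interpret K: tensor_coords "monoid_alg :: ('k, bit \<Rightarrow>\<^sub>0 'k) module" "\<lambda>x. x"
      "monoid_alg :: ('k, bit \<Rightarrow>\<^sub>0 'k) module" "\<lambda>x. x"
    by (intro tensor_coordsI coords_monoid_alg)
  let ?f = "\<lambda>e. lookup h e \<odot>\<^bsub>tensor monoid_alg monoid_alg\<^esub>
           pure monoid_alg monoid_alg (single e 1) (single e (1 :: 'k))"
  have f: "?f \<in> keys h \<rightarrow> carrier (tensor monoid_alg monoid_alg)" by auto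
  have eq: "comult kC2 h = finsum (tensor monoid_alg monoid_alg) ?f (keys h)"
    by (simp add: kC2_def Let_def)
  show "comult kC2 h \<in> carrier (tensor monoid_alg monoid_alg :: ('k, _) module)"
    unfolding eq by (rule K.T.finsum_closed[OF f])
  show "tco (\<lambda>x. x) (\<lambda>x. x) (comult kC2 h) = lin (\<lambda>e. single (e, e) 1) h"
    unfolding eq by (subst K.T.r_finsum[OF _ f]) (simp_all add: lin_def)
qed

lemma tco_R_matrix:
  shows "R_matrix \<in> carrier (tensor kC2 kC2 :: ('k::field, _) module)"
    and "tco (\<lambda>x. x) (\<lambda>x. x) (R_matrix :: ('k, _, _) tens) = pm_scale (1 / 2)
      (single (0, 0) 1 + single (0, 1) 1 + single (1, 0) 1 - single (1, 1) 1)"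
proof -
  interpret K: tensor_coords "kC2 :: ('k, _) hopf" "\<lambda>x. x" kC2 "\<lambda>x. x"
    by (intro tensor_coordsI coords_kC2)
  have 1: "(1 :: bit \<Rightarrow>\<^sub>0 'k) = single 0 1" by simp
  show "R_matrix \<in> carrier (tensor kC2 kC2 :: ('k::field, _) module)"
    by (simp add: R_matrix_def Let_def)
  show "tco (\<lambda>x. x) (\<lambda>x. x) (R_matrix :: ('k, _, _) tens) = pm_scale (1 / 2)
      (single (0, 0) 1 + single (0, 1) 1 + single (1, 0) 1 - single (1, 1) 1)"
    by (simp add: R_matrix_def Let_def grp_g_def 1 del: single_one)
qed

lemma bilin_comp2: "bilin B \<Longrightarrow> plin f \<Longrightarrow> plin g \<Longrightarrow> bilin (\<lambda>x y. B (f x) (g y))"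
  by (rule bilinI[OF bilin_left_comp bilin_right_comp])

lemma bilin_swap: "bilin B \<Longrightarrow> bilin (\<lambda>x y. B y x)"
  by (simp add: bilin_def)

lemma bilin_lin: "bilin B \<Longrightarrow> bilin (\<lambda>x y. lin b (B x y))"
  by (rule bilinI[OF plin_lin_comp[OF bilin_left] plin_lin_comp[OF bilin_right]])

lemma bilin_lin_param:
  assumes "\<And>i. bilin (\<lambda>x y. b x y i)"
  shows "bilin (\<lambda>x y. lin (b x y) p)"
proof (rule bilinI)
  show "plin (\<lambda>x. lin (b x y) p)" for y
    by (rule plin_lin_param) (rule bilin_left[OF assms])
  show "plin (\<lambda>y. lin (b x y) p)" for x
    by (rule plin_lin_param) (rule bilin_right[OF assms])
qed

lemma keys_tens: "keys (tens x y) \<subseteq> keys x \<times> keys y"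
proof -
  have 1: "keys (lin (\<lambda>j. single (i, j) 1) y) \<subseteq> {i} \<times> keys y" for i
    by (rule order_trans[OF keys_lin]) auto
  have "(\<Union>i\<in>keys x. keys (lin (\<lambda>j. single (i, j) 1) y)) \<subseteq> keys x \<times> keys y"
    by (rule UN_least, rule order_trans[OF 1]) auto
  then show ?thesis
    unfolding tens_def bext_def by (rule order_trans[OF keys_lin])
qed

text \<open>On degrees m and n the R-matrix acts by half of 1 + (-1)^m + (-1)^n - (-1)^(m + n). This
  is -1 if both are odd and 1 otherwise, that is (-1)^(m n), so the braiding is the flip of
  superspaces.\<close>

lemma braiding_coords:
  assumes "malg V rV mV eV dV" "malg W rW mW eW dW" and two: "(2 :: 'k) \<noteq> 0"
    and X: "X \<in> carrier (tensor V W)"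
  shows "braiding R_matrix V W X \<in> carrier (tensor (W :: ('k::field, _, _) graded_modalg) V) \<and>
    tco rW rV (braiding R_matrix V W X) =
      lin (\<lambda>(i, j). single (j, i) ((- 1) ^ (dV i * dW j))) (tco rV rW X)"
proof -
  interpret V: malg V rV mV eV dV by fact
  interpret W: malg W rW mW eW dW by fact
  interpret VW: tensor_coords V rV W rW ..
  interpret WV: tensor_coords W rW V rV ..
  interpret K: tensor_coords "kC2 :: ('k, _) hopf" "\<lambda>x. x" kC2 "\<lambda>x. x"
    by (intro tensor_coordsI coords_kC2)
  let ?aV = "bext (\<lambda>e i. single i (bsg e (dV i) :: 'k))" and ?aW = "bext (\<lambda>e i. single i (bsg e (dW i) :: 'k))"
  let ?R = "pm_scale (1 / 2) (single (0, 0) 1 + single (0, 1) 1 + single (1, 0) 1 - single (1, 1) (1 :: 'k)) :: bit \<times> bit \<Rightarrow>\<^sub>0 'k"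
  define F where "F v w = lin (\<lambda>z. tens (?aW (single (fst z) 1) w) (?aV (single (snd z) 1) v)) ?R" for v w
  have bF: "bilin F"
    unfolding F_def
    by (rule bilin_lin_param,
        rule bilin_swap[OF bilin_comp2[OF bilin_tens bilin_right[OF bilin_bext] bilin_right[OF bilin_bext]]])
  have inner: "tlift (tensor W V) (\<lambda>h h'. pure W V (act W h w) (act V h' v)) R_matrix \<in> carrier (tensor W V) \<and>
    tco rW rV (tlift (tensor W V) (\<lambda>h h'. pure W V (act W h w) (act V h' v)) R_matrix) = F (rV v) (rW w)"
    if "v \<in> carrier V" "w \<in> carrier W" for v w
  proof -
    have "bilin (\<lambda>h h'. tens (?aW h (rW w)) (?aV h' (rV v)))"
      by (rule bilin_comp2[OF bilin_tens bilin_left[OF bilin_bext] bilin_left[OF bilin_bext]])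
    from K.tlift_coords[OF WV.coords_tensor this tco_R_matrix(1),
        of "\<lambda>h h'. pure W V (act W h w) (act V h' v)"]
    show ?thesis using that by (simp add: tco_R_matrix F_def)
  qed
  have four: "(4 :: 'k) \<noteq> 0" using two no_zero_divisors[of "2 :: 'k" 2] by simp
  have sgn: "F (single i 1) (single j 1) = single (j, i) ((- 1) ^ (dV i * dW j))" for i j
    using two four
    by (cases "even (dV i)"; cases "even (dW j)")
      (simp_all add: F_def lin_add lin_diff pm_scale_add pm_scale_diff lin_scale field_simps
        flip: single_add single_uminus single_diff)
  show ?thesis
    using VW.tlift_coords[OF WV.coords_tensor bF X inner]
    by (simp add: braiding_def sgn case_prod_beta')
qed

lemma braided_op_malg:
  assumes "malg A r m e deg" and two: "(2 :: 'k) \<noteq> 0"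
  shows "malg (braided_op R_matrix (A :: ('k::field, _, _) graded_modalg)) r
    (bext (\<lambda>i j. pm_scale ((- 1) ^ (deg i * deg j)) (m (single j 1) (single i 1)))) e deg"
proof -
  interpret A: malg A r m e deg by fact
  interpret T: tensor_coords A r A r ..
  let ?m = "bext (\<lambda>i j. pm_scale ((- 1) ^ (deg i * deg j)) (m (single j 1) (single i 1)))"
  define C where "C x y = lin (\<lambda>z. m (single (fst z) 1) (single (snd z) 1))
    (lin (\<lambda>(i, j). single (j, i) ((- 1) ^ (deg i * deg j))) (tens x y))" for x y
  have C: "C x y = ?m x y" for x y
    unfolding C_def
    by (rule bilin_eqI[where B = "\<lambda>x y. lin _ (lin _ (tens x y))"])
      (intro bilin_lin bilin_tens bilin_bext | simp)+
  have mult: "x \<otimes>\<^bsub>braided_op R_matrix A\<^esub> y \<in> carrier A \<and> r (x \<otimes>\<^bsub>braided_op R_matrix A\<^esub> y) = ?m (r x) (r y)"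
    if "x \<in> carrier A" "y \<in> carrier A" for x y
    using T.tlift_coords[OF A.coords_axioms A.bilin_m, of "braiding R_matrix A A (pure A A x y)" "mult A"]
      braiding_coords[OF assms(1) assms(1) two, of "pure A A x y"] that
    by (simp add: C[symmetric] C_def braided_op_def)
  show ?thesis
    by unfold_locales
      (use mult in \<open>auto simp: braided_op_def A.bij A.hcomp_eq\<close>)
qed

text \<open>The sign rule for tensor products of superalgebras: \<open>b\<close> has to pass
  \<open>a'\<close>, which costs the braiding sign of their degrees. The nested
  \<open>tlift\<close>s are evaluated from the inside outwards, each level by
  \<open>tlift_coords\<close>.\<close>

lemma braided_tensor_malg:
  assumes "malg A rA mA eA dA" "malg B rB mB eB dB" and two: "(2 :: 'k) \<noteq> 0"
  shows "malg (braided_tensor kC2 R_matrix (A :: ('k::field, _, _) graded_modalg) B) (tco rA rB)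
    (bext (\<lambda>(i, j) (i', j'). pm_scale ((- 1) ^ (dB j * dA i'))
       (tens (mA (single i 1) (single i' 1)) (mB (single j 1) (single j' 1)))))
    (tens eA eB) (\<lambda>(i, j). dA i + dB j)"
proof -
  interpret A: malg A rA mA eA dA by fact
  interpret B: malg B rB mB eB dB by fact
  interpret AB: tensor_coords A rA B rB ..
  interpret BA: tensor_coords B rB A rA ..
  interpret K: tensor_coords "monoid_alg :: ('k, bit \<Rightarrow>\<^sub>0 'k) module" "\<lambda>x. x"
      "monoid_alg :: ('k, bit \<Rightarrow>\<^sub>0 'k) module" "\<lambda>x. x"
    by (intro tensor_coordsI coords_monoid_alg)
  let ?D = "braided_tensor kC2 R_matrix A B"
  let ?m = "bext (\<lambda>(i, j) (i', j'). pm_scale ((- 1) ^ (dB j * dA i'))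
       (tens (mA (single i 1) (single i' 1)) (mB (single j 1) (single j' 1))))"
  let ?s = "\<lambda>(i, j). single (j, i) ((- 1) ^ (dB i * dA j) :: 'k)"
  let ?T = "tensor A B"
  \<comment> \<open>The innermost level as a function of coordinates; \<open>tlift_coords\<close>
    needs it to be linear in each of its four arguments.\<close>
  define G where "G a b a' b' = lin (\<lambda>z. tens (mA a (single (fst z) 1)) (mB (single (snd z) 1) b'))
    (lin ?s (tens b a'))" for a b a' b'
  note plins = plin_lin_param plin_lin_comp bilin_left_comp[OF bilin_tens] bilin_right_comp[OF bilin_tens]
    bilin_left_comp[OF A.bilin_m] bilin_right_comp[OF A.bilin_m]
    bilin_left_comp[OF B.bilin_m] bilin_right_comp[OF B.bilin_m] plin_id
  define f3 where "f3 a b a' b' = tlift ?T (\<lambda>a'' b''. pure A B (a \<otimes>\<^bsub>A\<^esub> a'') (b'' \<otimes>\<^bsub>B\<^esub> b'))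
              (braiding R_matrix B A (pure B A b a'))" for a b a' b'
  have l3: "f3 a b a' b' \<in> carrier ?T \<and> tco rA rB (f3 a b a' b') = G (rA a) (rB b) (rA a') (rB b')"
    if "a \<in> carrier A" "b \<in> carrier B" "a' \<in> carrier A" "b' \<in> carrier B" for a b a' b'
  proof -
    have "bilin (\<lambda>a'' b''. tens (mA (rA a) a'') (mB b'' (rB b')))"
      by (rule bilin_comp2[OF bilin_tens bilin_right[OF A.bilin_m] bilin_left[OF B.bilin_m]])
    from AB.tlift_coords[OF AB.coords_tensor this,
        of "braiding R_matrix B A (pure B A b a')" "\<lambda>a'' b''. pure A B (a \<otimes>\<^bsub>A\<^esub> a'') (b'' \<otimes>\<^bsub>B\<^esub> b')"]
      braiding_coords[OF assms(2) assms(1) two, of "pure B A b a'"]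
    show ?thesis using that by (simp add: f3_def G_def)
  qed
  define f2 where "f2 a b y = tlift ?T (\<lambda>a' b'. f3 a b a' b') y" for a b y
  have l2: "f2 a b y \<in> carrier ?T \<and> tco rA rB (f2 a b y) =
      lin (\<lambda>z. G (rA a) (rB b) (single (fst z) 1) (single (snd z) 1)) (tco rA rB y)"
    if "a \<in> carrier A" "b \<in> carrier B" "y \<in> carrier ?T" for a b y
    unfolding f2_def
    by (rule AB.tlift_coords[OF AB.coords_tensor])
      (use that l3 in \<open>auto simp: G_def intro!: bilinI plins\<close>)
  have l1: "tlift ?T (\<lambda>a b. f2 a b y) x \<in> carrier ?T \<and> tco rA rB (tlift ?T (\<lambda>a b. f2 a b y) x) =
      lin (\<lambda>w. lin (\<lambda>z. G (single (fst w) 1) (single (snd w) 1) (single (fst z) 1) (single (snd z) 1))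
        (tco rA rB y)) (tco rA rB x)"
    if "x \<in> carrier ?T" "y \<in> carrier ?T" for x y
    by (rule AB.tlift_coords[OF AB.coords_tensor])
      (use that l2 in \<open>auto simp: G_def intro!: bilinI plins\<close>)
  have mult_eq: "mult ?D = (\<lambda>x y. tlift ?T (\<lambda>a b. f2 a b y) x)"
    by (simp add: braided_tensor_def Let_def f2_def f3_def)
  have mult: "x \<otimes>\<^bsub>?D\<^esub> y \<in> carrier ?T \<and> tco rA rB (x \<otimes>\<^bsub>?D\<^esub> y) = ?m (tco rA rB x) (tco rA rB y)"
    if "x \<in> carrier ?T" "y \<in> carrier ?T" for x y
    using l1[OF that] by (simp add: mult_eq G_def bext_def case_prod_beta' lin_scale)
  let ?aA = "bext (\<lambda>e i. single i (bsg e (dA i) :: 'k))" and ?aB = "bext (\<lambda>e i. single i (bsg e (dB i) :: 'k))"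
  let ?cm = "lin (\<lambda>e. single (e, e) (1 :: 'k))"
  define H where "H h a b = lin (\<lambda>z. tens (?aA (single (fst z) 1) a) (?aB (single (snd z) 1) b)) (?cm h)" for h a b
  define g where "g h a b = tlift ?T (\<lambda>h1 h2. pure A B (act A h1 a) (act B h2 b)) (comult kC2 h)" for h a b
  have g: "g h a b \<in> carrier ?T \<and> tco rA rB (g h a b) = H h (rA a) (rB b)"
    if "a \<in> carrier A" "b \<in> carrier B" for h a b
  proof -
    have "bilin (\<lambda>h h'. tens (?aA h (rA a)) (?aB h' (rB b)))"
      by (rule bilin_comp2[OF bilin_tens bilin_left[OF bilin_bext] bilin_left[OF bilin_bext]])
    from K.tlift_coords[OF AB.coords_tensor this tco_comult(1),
        of "\<lambda>h1 h2. pure A B (act A h1 a) (act B h2 b)" h]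
    show ?thesis using that by (simp add: tco_comult g_def H_def)
  qed
  have bH: "bilin (H h)" for h
    unfolding H_def by (intro bilinI plins bilin_right_comp[OF bilin_bext])
  have act0: "tlift ?T (g h) x \<in> carrier ?T \<and> tco rA rB (tlift ?T (g h) x) =
      lin (\<lambda>z. H h (single (fst z) 1) (single (snd z) 1)) (tco rA rB x)"
    if "x \<in> carrier ?T" for x h
    by (rule AB.tlift_coords[OF AB.coords_tensor bH that g])
  \<comment> \<open>Group-like elements act on both factors at once, so two signs multiply and by
    \<open>bsg_add\<close> the degrees add up.\<close>
  have H: "lin (\<lambda>z. H h (single (fst z) 1) (single (snd z) 1)) p =
    bext (\<lambda>e z. single z (bsg e (case z of (i, j) \<Rightarrow> dA i + dB j))) h p" for h p
    by (rule bilin_eqI[where B = "\<lambda>h p. lin (\<lambda>z. H h (single (fst z) 1) (single (snd z) 1)) p"])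
      (auto intro!: bilinI plins simp: H_def case_prod_beta' bsg_add)
  have act_eq: "act ?D = (\<lambda>h. tlift ?T (g h))"
    by (simp add: braided_tensor_def Let_def g_def[abs_def])
  have hcomp: "hcomp ?D n = {x \<in> carrier ?T. keys (tco rA rB x) \<subseteq> {i. (case i of (i, j) \<Rightarrow> dA i + dB j) = n}}" for n
  proof -
    have "hcomp ?D n = lspan ?T {pure A B a b | a b i j. a \<in> hcomp A i \<and> b \<in> hcomp B j \<and> i + j = n}"
      by (simp add: braided_tensor_def Let_def)
    also have "\<dots> = {x \<in> carrier ?T. keys (tco rA rB x) \<subseteq> {i. (case i of (i, j) \<Rightarrow> dA i + dB j) = n}}"
    proof (rule AB.T.lspan_eq)
      show "{pure A B a b | a b i j. a \<in> hcomp A i \<and> b \<in> hcomp B j \<and> i + j = n}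
        \<subseteq> {x \<in> carrier ?T. keys (tco rA rB x) \<subseteq> {i. (case i of (i, j) \<Rightarrow> dA i + dB j) = n}}"
        using keys_tens by (fastforce simp: A.hcomp_eq B.hcomp_eq)
      fix z assume z: "z \<in> {i. (case i of (i, j) \<Rightarrow> dA i + dB j) = n}"
      obtain i j where ij: "z = (i, j)" by force
      have "AB.T.el (single z 1) = pure A B (A.el (single i 1)) (B.el (single j 1))"
        by (rule AB.T.el_eqI) (auto simp: ij)
      moreover have "A.el (single i 1) \<in> hcomp A (dA i)" "B.el (single j 1) \<in> hcomp B (dB j)"
        by (simp_all add: A.hcomp_eq B.hcomp_eq)
      ultimately show "AB.T.el (single z 1) \<in> {pure A B a b | a b i j. a \<in> hcomp A i \<and> b \<in> hcomp B j \<and> i + j = n}"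
        using z ij by auto
    qed
    finally show ?thesis .
  qed
  have simps: "carrier ?D = carrier ?T" "add ?D = add ?T" "zero ?D = zero ?T" "smult ?D = smult ?T"
    "one ?D = pure A B \<one>\<^bsub>A\<^esub> \<one>\<^bsub>B\<^esub>"
    by (simp_all add: braided_tensor_def Let_def)
  show ?thesis
    by unfold_locales
      (use mult act0 in \<open>simp_all add: simps AB.T.bij hcomp act_eq H\<close>)
qed

text \<open>For a group element h the product is a (h . a') tensor h h', since h is group-like, and
  h acts on a homogeneous a' by a sign. The evaluation of nested \<open>tlift\<close>s is the same
  as for the braided product.\<close>

lemma smash_galg:
  assumes "malg A r m e deg"
  shows "galg (smash (A :: ('k::field, _, _) graded_modalg) kC2) (tco r (\<lambda>x. x))
    (bext (\<lambda>(i, h) (i', h'). pm_scale (bsg h (deg i')) (tens (m (single i 1) (single i' 1)) (single (h + h') 1))))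
    (tens e 1) (\<lambda>z. deg (fst z))"
proof -
  interpret A: malg A r m e deg by fact
  interpret H: coords "kC2 :: ('k, _) hopf" "\<lambda>x. x" by (rule coords_kC2)
  interpret AH: tensor_coords A r "kC2 :: ('k, _) hopf" "\<lambda>x. x" ..
  interpret K: tensor_coords "monoid_alg :: ('k, bit \<Rightarrow>\<^sub>0 'k) module" "\<lambda>x. x"
      "monoid_alg :: ('k, bit \<Rightarrow>\<^sub>0 'k) module" "\<lambda>x. x"
    by (intro tensor_coordsI coords_monoid_alg)
  let ?D = "smash A kC2" and ?T = "tensor A (kC2 :: ('k, _) hopf)" and ?r = "tco r (\<lambda>x. x)"
  let ?m = "bext (\<lambda>(i, h) (i', h'). pm_scale (bsg h (deg i')) (tens (m (single i 1) (single i' 1)) (single (h + h') 1)))"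
  let ?a = "bext (\<lambda>e i. single i (bsg e (deg i) :: 'k))"
  let ?cm = "lin (\<lambda>e. single (e, e) (1 :: 'k))"
  define G where "G a h a' h' = lin (\<lambda>z. tens (m a (?a (single (fst z) 1) a')) (single (snd z) 1 * h')) (?cm h)"
    for a h a' h'
  note plins = plin_lin_param plin_lin_comp bilin_left_comp[OF bilin_tens] bilin_right_comp[OF bilin_tens]
    bilin_left_comp[OF A.bilin_m] bilin_right_comp[OF A.bilin_m] plin_mult_left plin_mult_right
    bilin_right_comp[OF bilin_bext] bilin_left_comp[OF bilin_bext] plin_id
  define f3 where "f3 a h a' h' = tlift ?T (\<lambda>h1 h2. pure A kC2 (a \<otimes>\<^bsub>A\<^esub> act A h1 a') (h2 \<otimes>\<^bsub>kC2\<^esub> h')) (comult kC2 h)"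
    for a h a' h'
  have l3: "f3 a h a' h' \<in> carrier ?T \<and> ?r (f3 a h a' h') = G (r a) h (r a') h'"
    if "a \<in> carrier A" "a' \<in> carrier A" for a h a' h'
  proof -
    have "bilin (\<lambda>h1 h2. tens (m (r a) (?a h1 (r a'))) (h2 * h'))"
      by (rule bilin_comp2[OF bilin_tens bilin_right_comp[OF A.bilin_m bilin_left[OF bilin_bext]]
            bilin_left[OF bilin_times]])
    from K.tlift_coords[OF AH.coords_tensor this tco_comult(1),
        of "\<lambda>h1 h2. pure A kC2 (a \<otimes>\<^bsub>A\<^esub> act A h1 a') (h2 \<otimes>\<^bsub>kC2\<^esub> h')" h]
    show ?thesis using that by (simp add: f3_def G_def tco_comult)
  qed
  define f2 where "f2 a h y = tlift ?T (\<lambda>a' h'. f3 a h a' h') y" for a h y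
  have l2: "f2 a h y \<in> carrier ?T \<and> ?r (f2 a h y) =
      lin (\<lambda>z. G (r a) h (single (fst z) 1) (single (snd z) 1)) (?r y)"
    if "a \<in> carrier A" "y \<in> carrier ?T" for a h y
    unfolding f2_def
    by (rule AH.tlift_coords[OF AH.coords_tensor])
      (use that l3 in \<open>auto simp: G_def intro!: bilinI plins\<close>)
  have l1: "tlift ?T (\<lambda>a h. f2 a h y) x \<in> carrier ?T \<and> ?r (tlift ?T (\<lambda>a h. f2 a h y) x) =
      lin (\<lambda>w. lin (\<lambda>z. G (single (fst w) 1) (single (snd w) 1) (single (fst z) 1) (single (snd z) 1)) (?r y)) (?r x)"
    if "x \<in> carrier ?T" "y \<in> carrier ?T" for x y
    by (rule AH.tlift_coords[OF AH.coords_tensor])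
      (use that l2 in \<open>auto simp: G_def intro!: bilinI plins\<close>)
  have mult_eq: "mult ?D = (\<lambda>x y. tlift ?T (\<lambda>a h. f2 a h y) x)"
    by (simp add: smash_def Let_def f2_def f3_def)
  have mult: "x \<otimes>\<^bsub>?D\<^esub> y \<in> carrier ?T \<and> ?r (x \<otimes>\<^bsub>?D\<^esub> y) = ?m (?r x) (?r y)"
    if "x \<in> carrier ?T" "y \<in> carrier ?T" for x y
  proof -
    have "single i (c :: 'k) = pm_scale c (single i 1)" for i :: 'c and c by simp
    then have "m p (single i (bsg h n)) = pm_scale (bsg h n) (m p (single i 1))" for p i h n
      by (metis plin_scale[OF bilin_right[OF A.bilin_m]])
    then show ?thesis
      using l1[OF that]
      by (simp add: mult_eq G_def bext_def case_prod_beta' mult_single plin_scale[OF bilin_left[OF bilin_tens]])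
  qed
  have hcomp: "hcomp ?D n = {x \<in> carrier ?T. keys (?r x) \<subseteq> {i. deg (fst i) = n}}" for n
  proof -
    have "hcomp ?D n = lspan ?T {pure A kC2 a h | a h. a \<in> hcomp A n \<and> h \<in> carrier kC2}"
      by (simp add: smash_def Let_def)
    also have "\<dots> = {x \<in> carrier ?T. keys (?r x) \<subseteq> {i. deg (fst i) = n}}"
    proof (rule AH.T.lspan_eq)
      show "{pure A kC2 a h | a h. a \<in> hcomp A n \<and> h \<in> carrier kC2}
        \<subseteq> {x \<in> carrier ?T. keys (?r x) \<subseteq> {i. deg (fst i) = n}}"
        using keys_tens by (fastforce simp: A.hcomp_eq)
      fix z :: "_ \<times> bit" assume z: "z \<in> {i. deg (fst i) = n}"
      obtain i j where ij: "z = (i, j)" by force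
      have "AH.T.el (single z 1) = pure A kC2 (A.el (single i 1)) (single j 1)"
        by (rule AH.T.el_eqI) (auto simp: ij)
      moreover have "A.el (single i 1) \<in> hcomp A (deg i)"
        by (simp add: A.hcomp_eq)
      ultimately show "AH.T.el (single z 1) \<in> {pure A kC2 a h | a h. a \<in> hcomp A n \<and> h \<in> carrier kC2}"
        using z ij by auto
    qed
    finally show ?thesis .
  qed
  have simps: "carrier ?D = carrier ?T" "add ?D = add ?T" "zero ?D = zero ?T" "smult ?D = smult ?T"
    "one ?D = pure A kC2 \<one>\<^bsub>A\<^esub> \<one>\<^bsub>kC2\<^esub>"
    by (simp_all add: smash_def Let_def)
  show ?thesis
    by unfold_locales
      (use mult in \<open>simp_all add: simps AH.T.bij hcomp\<close>)
qed

section \<open>Homogeneous parts\<close>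

definition gpart :: "('i \<Rightarrow> nat) \<Rightarrow> nat \<Rightarrow> ('i \<Rightarrow>\<^sub>0 'k::field) \<Rightarrow> ('i \<Rightarrow>\<^sub>0 'k)" where
  "gpart deg n = lin (\<lambda>i. if deg i = n then single i 1 else 0)"

lemma plin_gpart [simp, intro]: "plin (gpart deg n)"
  by (simp add: gpart_def)

lemma lookup_gpart [simp]: "lookup (gpart deg n x) i = (if deg i = n then lookup x i else 0)"
proof (induction x rule: pm_induct)
  case (step j c x)
  have "lookup (gpart deg n (single j c)) i = (if deg i = n then lookup (single j c) i else 0)"
    by (auto simp: gpart_def lookup_single when_def)
  then show ?case using step by (simp add: plin_add[OF plin_gpart] lookup_add)
qed (simp add: plin_0)

lemma gpart_eq_iff: "gpart deg n x = x \<longleftrightarrow> keys x \<subseteq> {i. deg i = n}"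
  by (auto simp: poly_mapping_eq_iff fun_eq_iff in_keys_iff)

lemma keys_gpart: "keys (gpart deg n x) \<subseteq> {i. deg i = n}"
  by (auto simp: in_keys_iff split: if_splits)

lemma gpart_homogeneous: "keys x \<subseteq> {i. deg i = n} \<Longrightarrow> gpart deg m x = (if m = n then x else 0)"
  by (rule poly_mapping_eqI) (auto simp: in_keys_iff)

lemma lin_homogeneous:
  assumes "keys x \<subseteq> {i. deg i = n}"
  shows "lin (\<lambda>i. single i (f (deg i))) x = pm_scale (f n) x"
proof -
  have "lin (\<lambda>i. single i (f (deg i))) x = (\<Sum>i\<in>keys x. single i (f n * lookup x i))"
    unfolding lin_def using assms by (intro sum.cong) (auto simp: mult.commute)
  also have "\<dots> = pm_scale (f n) (\<Sum>i\<in>keys x. single i (lookup x i))"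
    by (simp add: pm_scale_sum)
  finally show ?thesis by (simp flip: poly_mapping_sum_single)
qed

lemma keys_lin_subset: "(\<And>i. i \<in> keys x \<Longrightarrow> keys (b i) \<subseteq> P) \<Longrightarrow> keys (lin b x) \<subseteq> P"
  by (rule order_trans[OF keys_lin]) auto

section \<open>Ideals of the free algebra\<close>

text \<open>Ideals expressed in the type class of rings, where \<open>algebra_simps\<close> is
  available; \<open>ideal_free_iff\<close> translates to ideals of the record.\<close>

definition two_sided :: "'r::ring_1 set \<Rightarrow> bool" where
  "two_sided K \<longleftrightarrow> 0 \<in> K \<and> (\<forall>a\<in>K. \<forall>b\<in>K. a + b \<in> K) \<and> (\<forall>a\<in>K. \<forall>r. r * a \<in> K \<and> a * r \<in> K)"

lemma two_sidedI:
  "0 \<in> K \<Longrightarrow> (\<And>a b. a \<in> K \<Longrightarrow> b \<in> K \<Longrightarrow> a + b \<in> K) \<Longrightarrow> (\<And>a r. a \<in> K \<Longrightarrow> r * a \<in> K) \<Longrightarrow>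
   (\<And>a r. a \<in> K \<Longrightarrow> a * r \<in> K) \<Longrightarrow> two_sided K"
  by (auto simp: two_sided_def)

context
  fixes K :: "'r::ring_1 set"
  assumes K: "two_sided K"
begin

lemma two_sided_0: "0 \<in> K"
  and two_sided_add: "a \<in> K \<Longrightarrow> b \<in> K \<Longrightarrow> a + b \<in> K"
  and two_sided_left: "a \<in> K \<Longrightarrow> r * a \<in> K"
  and two_sided_right: "a \<in> K \<Longrightarrow> a * r \<in> K"
  using K by (auto simp: two_sided_def)

lemma two_sided_uminus: "a \<in> K \<Longrightarrow> - a \<in> K"
  using two_sided_left[of a "- 1"] by simp

lemma two_sided_diff: "a \<in> K \<Longrightarrow> b \<in> K \<Longrightarrow> a - b \<in> K"
  using two_sided_add[of a "- b"] two_sided_uminus[of b] by simp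

end

lemma two_sided_scale: "two_sided K \<Longrightarrow> a \<in> K \<Longrightarrow> pm_scale c a \<in> K"
  for a :: "'m::monoid_add \<Rightarrow>\<^sub>0 'k::field"
  by (simp add: pm_scale_conv_mult two_sided_left)

lemma free_modalg_simps [simp]:
  "carrier free_modalg = UNIV" "mult free_modalg = (*)" "one free_modalg = 1"
  "zero free_modalg = 0" "add free_modalg = (+)" "smult free_modalg = pm_scale"
  "hcomp free_modalg n = {p. \<forall>w\<in>keys p. length w = n}"
  by (simp_all add: free_modalg_def)

lemma ring_free_modalg: "ring (free_modalg :: ('k::field, 'x list \<Rightarrow>\<^sub>0 'k, bit \<Rightarrow>\<^sub>0 'k) graded_modalg)"
proof (rule ringI)
  show "abelian_group (free_modalg :: ('k::field, 'x list \<Rightarrow>\<^sub>0 'k, bit \<Rightarrow>\<^sub>0 'k) graded_modalg)"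
    by (rule abelian_groupI) (auto simp: add_ac intro: exI[of _ "- x" for x])
  show "monoid (free_modalg :: ('k::field, 'x list \<Rightarrow>\<^sub>0 'k, bit \<Rightarrow>\<^sub>0 'k) graded_modalg)"
    by (rule monoidI) (auto simp: mult.assoc)
qed (auto simp: algebra_simps)

lemma ideal_free_iff: "ideal K (free_modalg :: ('k::field, 'x list \<Rightarrow>\<^sub>0 'k, bit \<Rightarrow>\<^sub>0 'k) graded_modalg) \<longleftrightarrow> two_sided K"
proof
  assume "ideal K (free_modalg :: ('k::field, 'x list \<Rightarrow>\<^sub>0 'k, bit \<Rightarrow>\<^sub>0 'k) graded_modalg)"
  then interpret ideal K "free_modalg :: ('k::field, 'x list \<Rightarrow>\<^sub>0 'k, bit \<Rightarrow>\<^sub>0 'k) graded_modalg" .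
  show "two_sided K"
    using additive_subgroup.zero_closed[OF additive_subgroup_axioms]
      additive_subgroup.a_closed[OF additive_subgroup_axioms] I_l_closed I_r_closed
    by (intro two_sidedI) auto
next
  assume K: "two_sided K"
  interpret R: ring "free_modalg :: ('k::field, 'x list \<Rightarrow>\<^sub>0 'k, bit \<Rightarrow>\<^sub>0 'k) graded_modalg"
    by (rule ring_free_modalg)
  have inv: "a_inv (free_modalg :: ('k::field, 'x list \<Rightarrow>\<^sub>0 'k, bit \<Rightarrow>\<^sub>0 'k) graded_modalg) a = - a" for a
    using R.minus_equality[of "- a" a] by simp
  show "ideal K (free_modalg :: ('k::field, 'x list \<Rightarrow>\<^sub>0 'k, bit \<Rightarrow>\<^sub>0 'k) graded_modalg)"
    by (rule idealI[OF ring_free_modalg], rule R.add.subgroupI)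
      (use K in \<open>auto simp: inv two_sided_left two_sided_right two_sided_add two_sided_uminus dest: two_sided_0\<close>)
qed

lemma two_sided_Idl: "two_sided (Idl\<^bsub>free_modalg\<^esub> S)"
  and Idl_self: "S \<subseteq> Idl\<^bsub>free_modalg\<^esub> S"
  and Idl_minimal: "two_sided K \<Longrightarrow> S \<subseteq> K \<Longrightarrow> Idl\<^bsub>free_modalg\<^esub> S \<subseteq> K"
  for S :: "('x list \<Rightarrow>\<^sub>0 'k::field) set"
proof -
  interpret R: ring "free_modalg :: ('k::field, 'x list \<Rightarrow>\<^sub>0 'k, bit \<Rightarrow>\<^sub>0 'k) graded_modalg"
    by (rule ring_free_modalg)
  show "two_sided (Idl\<^bsub>free_modalg\<^esub> S)"
    using R.genideal_ideal[of S] by (simp add: ideal_free_iff)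
  show "S \<subseteq> Idl\<^bsub>free_modalg\<^esub> S"
    using R.genideal_self[of S] by simp
  show "two_sided K \<Longrightarrow> S \<subseteq> K \<Longrightarrow> Idl\<^bsub>free_modalg\<^esub> S \<subseteq> K"
    using R.genideal_minimal[of K S] by (simp add: ideal_free_iff)
qed

section \<open>Representations of free algebras and normal forms\<close>

lemma single_Nil [simp]: "single [] 1 = 1"
  by (metis single_one zero_list_def)

lemma single_append: "single (v @ w) 1 = single v 1 * single w (1 :: 'k::field)"
  by (simp add: mult_single plus_list_def)

lemma single_Cons: "single (x # w) 1 = gen x * single w (1 :: 'k::field)"
  using single_append[of "[x]" w] by (simp add: gen_def)

lemma single_replicate: "single (replicate n x) 1 = (gen x :: _ \<Rightarrow>\<^sub>0 'k::field) ^ n"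
  by (induction n) (auto simp: single_Cons simp del: single_one)

text \<open>The representation of the free algebra in which the letter \<open>x\<close> acts as
  \<open>f x\<close>; a word acts with its last letter first.\<close>

definition rho ::
  "('x \<Rightarrow> ('i \<Rightarrow>\<^sub>0 'k) \<Rightarrow> ('i \<Rightarrow>\<^sub>0 'k)) \<Rightarrow> ('x list \<Rightarrow>\<^sub>0 'k::field) \<Rightarrow> ('i \<Rightarrow>\<^sub>0 'k) \<Rightarrow> ('i \<Rightarrow>\<^sub>0 'k)"
where
  "rho f p a = lin (\<lambda>w. foldr f w a) p"

context
  fixes f :: "'x \<Rightarrow> ('i \<Rightarrow>\<^sub>0 'k::field) \<Rightarrow> ('i \<Rightarrow>\<^sub>0 'k)"
  assumes f: "\<And>x. plin (f x)"
begin

lemma plin_foldr: "plin (foldr f w)"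
proof (induction w)
  case (Cons x w)
  from plin_comp[OF f Cons] show ?case by (simp add: comp_def)
qed (simp add: id_def)

lemma bilin_rho: "bilin (rho f)"
  unfolding rho_def by (rule bilinI) (auto intro: plin_lin_param plin_foldr)

lemma rho_single [simp]: "rho f (single w c) a = pm_scale c (foldr f w a)"
  by (simp add: rho_def)

lemma rho_1 [simp]: "rho f 1 a = a"
  using rho_single[of "[]" 1 a] by simp

lemma rho_gen [simp]: "rho f (gen x) a = f x a"
  by (simp add: gen_def)

lemma rho_mult: "rho f (p * q) a = rho f p (rho f q a)"
proof (rule bilin_eqI[where B = "\<lambda>p q. rho f (p * q) a" and C = "\<lambda>p q. rho f p (rho f q a)"])
  note rules = bilin_left[OF bilin_rho] bilin_right[OF bilin_rho]
  show "bilin (\<lambda>p q. rho f (p * q) a)"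
    by (rule bilinI; rule plin_comp[OF rules(1)]) (auto intro: plin_mult_left plin_mult_right)
  show "bilin (\<lambda>p q. rho f p (rho f q a))"
    by (rule bilinI) (rule rules plin_comp[OF rules(2) rules(1)])+
qed (simp add: mult_single plus_list_def)

lemmas rho_add = plin_add[OF bilin_left[OF bilin_rho]]
  and rho_diff = plin_diff[OF bilin_left[OF bilin_rho]]
  and rho_scale = plin_scale[OF bilin_left[OF bilin_rho]]
  and rho_0 = plin_0[OF bilin_left[OF bilin_rho]]
  and rho_0_right = plin_0[OF bilin_right[OF bilin_rho]]

lemma two_sided_kernel: "two_sided {p. \<forall>a. rho f p a = 0}"
  by (rule two_sidedI) (auto simp: rho_add rho_mult rho_0 rho_0_right)

end

text \<open>
  A linear basis \<open>wd\<close> of normal words for the quotient of a free algebra by \<open>J\<close> is obtained from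
  a representation of the quotient on the space with basis \<open>'i\<close> which maps the vector \<open>i0\<close> to \<open>i\<close>
  under the word \<open>wd i\<close>: the representation gives independence, rewriting modulo \<open>J\<close> gives generation.
\<close>

locale normal_form =
  fixes f :: "'x \<Rightarrow> ('i \<Rightarrow>\<^sub>0 'k::field) \<Rightarrow> ('i \<Rightarrow>\<^sub>0 'k)" and wd :: "'i \<Rightarrow> 'x list" and i0 :: 'i
    and J :: "('x list \<Rightarrow>\<^sub>0 'k) set"
  assumes plin_f: "\<And>x. plin (f x)"
    and wd_i0: "wd i0 = []"
    and foldr_wd: "\<And>i. foldr f (wd i) (single i0 1) = single i 1"
    and J: "two_sided J"
    and red: "\<And>x i. gen x * single (wd i) 1 - lin (\<lambda>i. single (wd i) 1) (f x (single i 1)) \<in> J"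
    and J_kernel: "\<And>p a. p \<in> J \<Longrightarrow> rho f p a = 0"
begin

text \<open>The coordinates of the class of \<open>p\<close>, read off from its action on the cyclic
  vector \<open>i0\<close>.\<close>

definition eps :: "('x list \<Rightarrow>\<^sub>0 'k) \<Rightarrow> ('i \<Rightarrow>\<^sub>0 'k)" where "eps p = rho f p (single i0 1)"

definition nf :: "('i \<Rightarrow>\<^sub>0 'k) \<Rightarrow> ('x list \<Rightarrow>\<^sub>0 'k)" where "nf = lin (\<lambda>i. single (wd i) 1)"

text \<open>The product of the quotient transported to coordinates, as \<open>eps_mult\<close>
  shows.\<close>

definition ml :: "('i \<Rightarrow>\<^sub>0 'k) \<Rightarrow> ('i \<Rightarrow>\<^sub>0 'k) \<Rightarrow> ('i \<Rightarrow>\<^sub>0 'k)" where "ml a b = rho f (nf a) b"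

lemma plin_eps: "plin eps"
  unfolding eps_def by (rule bilin_left[OF bilin_rho[OF plin_f]])

lemma plin_nf: "plin nf"
  by (simp add: nf_def)

lemma bilin_ml: "bilin ml"
  unfolding ml_def
  by (rule bilinI[OF bilin_left_comp[OF bilin_rho[OF plin_f] plin_nf] bilin_right[OF bilin_rho[OF plin_f]]])

lemma eps_nf [simp]: "eps (nf a) = a"
  by (rule plin_eqI[OF plin_comp[OF plin_eps plin_nf] plin_id])
    (simp add: nf_def eps_def rho_single[OF plin_f] foldr_wd)

text \<open>The generation half: induction on the length of a word. A letter \<open>x\<close> in
  front of a reduced element is absorbed by \<open>red\<close>, which is extended linearly from
  basis vectors to all \<open>a\<close>.\<close>

lemma nf_eps: "p - nf (eps p) \<in> J"
proof (induction p rule: pm_induct)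
  case zero
  then show ?case by (simp add: plin_0[OF plin_eps] plin_0[OF plin_nf] two_sided_0[OF J])
next
  case (step w c p)
  have "single w 1 - nf (eps (single w 1)) \<in> J"
  proof (induction w)
    case Nil
    have "nf (eps (single [] 1)) = 1"
      by (simp add: eps_def rho_1[OF plin_f] nf_def wd_i0)
    then show ?case by (simp add: two_sided_0[OF J])
  next
    case (Cons x w)
    have r: "gen x * nf a - nf (f x a) \<in> J" for a
    proof (induction a rule: pm_induct)
      case zero
      then show ?case by (simp add: plin_0[OF plin_f] plin_0[OF plin_nf] two_sided_0[OF J])
    next
      case (step i c a)
      have "f x (single i c) = pm_scale c (f x (single i 1))"
        by (simp flip: plin_scale[OF plin_f])
      then have "gen x * nf (single i c + a) - nf (f x (single i c + a)) =
        pm_scale c (gen x * single (wd i) 1 - nf (f x (single i 1))) + (gen x * nf a - nf (f x a))"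
        by (simp add: plin_add[OF plin_f] plin_add[OF plin_nf] plin_scale[OF plin_nf] pm_scale_diff
            pm_scale_mult_right[symmetric] algebra_simps) (simp add: nf_def)
      then show ?case
        using step red[of x i] by (simp add: two_sided_add[OF J] two_sided_scale[OF J] nf_def)
    qed
    have "gen x * (single w 1 - nf (eps (single w 1))) + (gen x * nf (eps (single w 1)) - nf (f x (eps (single w 1)))) \<in> J"
      by (intro two_sided_add[OF J] two_sided_left[OF J] Cons r)
    then show ?case
      by (simp add: algebra_simps single_Cons eps_def rho_mult[OF plin_f] rho_gen[OF plin_f])
  qed
  from two_sided_add[OF J two_sided_scale[OF J this, of c] step(2)] show ?case
    by (simp add: plin_add[OF plin_eps] plin_add[OF plin_nf] pm_scale_diff algebra_simps
        flip: plin_scale[OF plin_nf] plin_scale[OF plin_eps])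
qed

lemma J_eq: "J = {p. eps p = 0}"
proof (intro equalityI subsetI)
  fix p assume "p \<in> {p. eps p = 0}"
  then show "p \<in> J" using nf_eps[of p] by (simp add: plin_0[OF plin_nf])
qed (simp add: eps_def J_kernel)

lemma rho_cong: "eps p = eps q \<Longrightarrow> rho f p a = rho f q a"
  using J_kernel[of "p - q" a] by (simp add: J_eq plin_diff[OF plin_eps] rho_diff[OF plin_f])

lemma eps_mult: "eps (p * q) = ml (eps p) (eps q)"
proof -
  have "eps (p * q) = rho f p (eps q)" by (simp add: eps_def rho_mult[OF plin_f])
  also have "\<dots> = ml (eps p) (eps q)" unfolding ml_def by (rule rho_cong) simp
  finally show ?thesis .
qed

lemma surj_eps: "range eps = UNIV"
  by (metis eps_nf surjI)

lemma eps_1 [simp]: "eps 1 = single i0 1"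
  by (simp add: eps_def rho_1[OF plin_f])

lemma eps_gen [simp]: "eps (gen x) = f x (single i0 1)"
  by (simp add: eps_def rho_gen[OF plin_f])

lemma ml_single_left: "ml (single i 1) a = foldr f (wd i) a"
  by (simp add: ml_def nf_def rho_single[OF plin_f])

end

section \<open>The free algebra and its graded quotients as module algebras\<close>

lemma neg_gens_eq: "neg_gens p = lin (\<lambda>w. single w ((- 1) ^ length w)) p"
proof -
  have "prod_list (map (\<lambda>x. - gen x) w) = single w ((- 1) ^ length w :: 'b)" for w :: "'a list"
    by (induction w) (simp_all add: gen_def mult_single plus_list_def flip: single_uminus)
  then show ?thesis by (simp add: neg_gens_def lin_def)
qed

lemma act_free_modalg:
  fixes p :: "'a list \<Rightarrow>\<^sub>0 'b::field"
  shows "act free_modalg h p = bext (\<lambda>e w. single w (bsg e (length w))) h p"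
proof (rule bilin_eqI[where B = "act free_modalg"])
  have "bilin (\<lambda>h p. pm_scale (lookup h 0) p + pm_scale (lookup h 1) (neg_gens p) :: 'a list \<Rightarrow>\<^sub>0 'b)"
    by (rule bilinI; rule plinI)
      (auto simp: neg_gens_eq lin_add lin_scale lookup_add pm_scale_add pm_scale_add_left pm_scale_diff algebra_simps)
  then show "bilin (act (free_modalg :: ('b, 'a list \<Rightarrow>\<^sub>0 'b, bit \<Rightarrow>\<^sub>0 'b) graded_modalg))"
    by (simp add: free_modalg_def)
  show "act free_modalg (single e 1) (single w 1) =
    bext (\<lambda>e w. single w (bsg e (length w))) (single e 1) (single w 1)" for e :: bit and w :: "'a list"
    by (cases e) (simp_all add: free_modalg_def neg_gens_eq lookup_single del: single_one)
qed simp

lemma malg_free: "malg (free_modalg :: ('k::field, 'x list \<Rightarrow>\<^sub>0 'k, bit \<Rightarrow>\<^sub>0 'k) graded_modalg) (\<lambda>p. p) (*) 1 length"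
  by unfold_locales (auto simp: bij_id[unfolded id_def] bilin_times act_free_modalg)

text \<open>The assumption \<open>deg\<close> makes \<open>\<pi>\<close> a graded map. The group
  acts by signs that depend on the degree only, so both the action and the grading of the free
  algebra descend to the quotient.\<close>

lemma malg_quot_free:
  fixes \<pi> :: "('x list \<Rightarrow>\<^sub>0 'k::field) \<Rightarrow> ('i \<Rightarrow>\<^sub>0 'k)"
  assumes "plin \<pi>" "range \<pi> = UNIV" and J: "J = {p. \<pi> p = 0}" and "bilin m"
    and mult: "\<And>p q. \<pi> (p * q) = m (\<pi> p) (\<pi> q)"
    and deg: "\<And>w. keys (\<pi> (single w 1)) \<subseteq> {i. deg i = length w}"
  shows "\<exists>r. malg (quot_modalg free_modalg J) r m (\<pi> 1) deg \<and> (\<forall>p. r (J +>\<^bsub>free_modalg\<^esub> p) = \<pi> p) \<and>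
    (\<forall>p. J +>\<^bsub>free_modalg\<^esub> p \<in> carrier (quot_modalg free_modalg J))"
proof -
  let ?F = "free_modalg :: ('k, 'x list \<Rightarrow>\<^sub>0 'k, bit \<Rightarrow>\<^sub>0 'k) graded_modalg"
  let ?Q = "quot_modalg ?F J"
  interpret F: ring ?F by (rule ring_free_modalg)
  interpret Q: lin_quot ?F \<pi> J
    by unfold_locales (auto simp: assms plin_add plin_scale)
  have simps: "carrier ?Q = carrier (quot_alg ?F J)" "add ?Q = add (quot_alg ?F J)"
    "zero ?Q = zero (quot_alg ?F J)" "smult ?Q = smult (quot_alg ?F J)" "one ?Q = one (quot_alg ?F J)"
    "mult ?Q = mult (quot_alg ?F J)" "hcomp ?Q n = (\<lambda>x. J +>\<^bsub>?F\<^esub> x) ` hcomp ?F n"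
    "act ?Q h X = (\<Union>x\<in>X. J +>\<^bsub>?F\<^esub> act ?F h x)" for n h X
    by (simp_all add: quot_modalg_def)
  have bact: "bilin (\<lambda>h p. \<pi> (act ?F h p))"
    unfolding act_free_modalg
    by (rule bilinI[OF plin_comp[OF assms(1) bilin_left] plin_comp[OF assms(1) bilin_right]]) auto
  have \<pi>_act: "\<pi> (act ?F h p) = bext (\<lambda>e i. single i (bsg e (deg i))) h (\<pi> p)" for h p
  proof (rule bilin_eqI[OF bact bilin_comp2[OF bilin_bext plin_id assms(1)]])
    fix e and w :: "'x list"
    have "\<pi> (act ?F (single e 1) (single w 1)) = pm_scale (bsg e (length w)) (\<pi> (single w 1))"
      unfolding act_free_modalg by (simp flip: plin_scale[OF assms(1)])
    then show "\<pi> (act ?F (single e 1) (single w 1)) =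
      bext (\<lambda>e i. single i (bsg e (deg i))) (single e 1) (\<pi> (single w 1))"
      using lin_homogeneous[OF deg[of w]] by (simp add: bext_def)
  qed
  have act_coset: "act ?Q h (J +>\<^bsub>?F\<^esub> p) = J +>\<^bsub>?F\<^esub> act ?F h p" for h p
  proof -
    have "J +>\<^bsub>?F\<^esub> act ?F h q = J +>\<^bsub>?F\<^esub> act ?F h p" if "q \<in> J +>\<^bsub>?F\<^esub> p" for q
      using that by (intro Q.coset_eqI) (auto simp: Q.coset \<pi>_act)
    moreover have "p \<in> J +>\<^bsub>?F\<^esub> p" by (simp add: Q.coset)
    ultimately have "(\<Union>x\<in>J +>\<^bsub>?F\<^esub> p. J +>\<^bsub>?F\<^esub> act ?F h x) = J +>\<^bsub>?F\<^esub> act ?F h p" by blast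
    then show ?thesis by (simp add: simps)
  qed
  \<comment> \<open>Projections to a degree commute with \<open>\<pi>\<close>; hence a homogeneous
    class has a homogeneous representative, the projection of any of its representatives.\<close>
  have gp: "gpart deg n (\<pi> p) = \<pi> (gpart length n p)" for n p
    by (rule plin_eqI[OF plin_comp[OF plin_gpart assms(1)] plin_comp[OF assms(1) plin_gpart]])
      (auto simp: gpart_homogeneous[OF deg] gpart_def[of length] plin_0[OF assms(1)])
  have hc: "(\<lambda>x. J +>\<^bsub>?F\<^esub> x) ` hcomp ?F n = {X \<in> carrier (quot_alg ?F J). keys (Q.rq X) \<subseteq> {i. deg i = n}}" for n
  proof (intro equalityI subsetI)
    fix X assume "X \<in> (\<lambda>x. J +>\<^bsub>?F\<^esub> x) ` hcomp ?F n"
    then obtain p where p: "X = J +>\<^bsub>?F\<^esub> p" "gpart length n p = p"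
      by (auto simp: gpart_eq_iff subset_iff)
    then have "gpart deg n (\<pi> p) = \<pi> p" by (simp add: gp)
    with p show "X \<in> {X \<in> carrier (quot_alg ?F J). keys (Q.rq X) \<subseteq> {i. deg i = n}}"
      by (simp add: gpart_eq_iff)
  next
    fix X assume "X \<in> {X \<in> carrier (quot_alg ?F J). keys (Q.rq X) \<subseteq> {i. deg i = n}}"
    then obtain p where p: "X = J +>\<^bsub>?F\<^esub> p" "gpart deg n (\<pi> p) = \<pi> p"
      by (auto simp: Q.carrier_quot gpart_eq_iff)
    then have "X = J +>\<^bsub>?F\<^esub> gpart length n p"
      using Q.coset_eqI[of p "gpart length n p"] by (simp add: gp)
    then show "X \<in> (\<lambda>x. J +>\<^bsub>?F\<^esub> x) ` hcomp ?F n"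
      using keys_gpart[of length n p] by auto
  qed
  have mult': "X \<otimes>\<^bsub>quot_alg ?F J\<^esub> Y \<in> carrier (quot_alg ?F J) \<and> Q.rq (X \<otimes>\<^bsub>quot_alg ?F J\<^esub> Y) = m (Q.rq X) (Q.rq Y)"
    if XY: "X \<in> carrier (quot_alg ?F J)" "Y \<in> carrier (quot_alg ?F J)" for X Y
  proof -
    obtain x y where "X = J +>\<^bsub>?F\<^esub> x" "Y = J +>\<^bsub>?F\<^esub> y"
      using XY by (auto simp: Q.carrier_quot)
    then show ?thesis
      using Q.coset_mult[of x y m] by (simp add: mult)
  qed
  have one': "Q.rq (one (quot_alg ?F J)) = \<pi> 1" "one (quot_alg ?F J) \<in> carrier (quot_alg ?F J)"
    by (simp_all flip: Q.coset_one)
  have "malg ?Q Q.rq m (\<pi> 1) deg"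
  proof unfold_locales
    fix X h assume "X \<in> carrier ?Q"
    then obtain p where "X = J +>\<^bsub>?F\<^esub> p" by (auto simp: simps(1) Q.carrier_quot)
    then show "act ?Q h X \<in> carrier ?Q" "Q.rq (act ?Q h X) = bext (\<lambda>e i. single i (bsg e (deg i))) h (Q.rq X)"
      by (simp_all add: act_coset simps(1) \<pi>_act)
  qed (simp_all add: simps(1-6) Q.q.bij mult' one' assms(4) simps(7) hc[simplified])
  then show ?thesis by (auto simp: simps(1))
qed

text \<open>The algebra stays the same and only its coordinates change: the diagonal map with
  entries \<open>s (deg i)\<close> is its own inverse because \<open>s n\<close> squares to 1, and
  it carries \<open>m\<close> to \<open>m'\<close>.\<close>

lemma malg_rescale:
  assumes "malg A r m e deg" and s: "\<And>n. s n * s n = 1" and m': "bilin m'"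
    and mult: "\<And>i j. lin (\<lambda>i. single i (s (deg i))) (m (single i 1) (single j 1)) = pm_scale (s (deg i) * s (deg j)) (m' (single i 1) (single j 1))"
    and one: "lin (\<lambda>i. single i (s (deg i))) e = e'"
  shows "malg A (\<lambda>x. lin (\<lambda>i. single i (s (deg i))) (r x)) m' e' deg"
proof -
  interpret A: malg A r m e deg by fact
  let ?D = "lin (\<lambda>i. single i (s (deg i)))"
  have look: "lookup (?D x) i = s (deg i) * lookup x i" for x i
  proof (induction x rule: pm_induct)
    case (step j c x)
    then show ?case by (auto simp: lin_add lookup_add lookup_single when_def algebra_simps)
  qed simp
  have DD: "?D (?D x) = x" for x
    by (rule poly_mapping_eqI) (simp add: look s flip: mult.assoc)
  have D: "bij ?D" by (rule bij_betw_byWitness[of _ ?D]) (auto simp: DD)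
  have s0: "s n \<noteq> 0" for n using s[of n] by auto
  have keysD: "keys (?D x) = keys x" for x
    by (auto simp: in_keys_iff look s0)
  have mult': "?D (m x y) = m' (?D x) (?D y)" for x y
  proof (rule bilin_eqI[where B = "\<lambda>x y. ?D (m x y)" and C = "\<lambda>x y. m' (?D x) (?D y)"])
    show "?D (m (single i 1) (single j 1)) = m' (?D (single i 1)) (?D (single j 1))" for i j
      unfolding mult using plin_scale[OF bilin_left[OF m'], of "s (deg i)" "single i 1"]
        plin_scale[OF bilin_right[OF m'], of _ "s (deg j)" "single j 1"] by (simp add: mult.commute)
  qed (rule bilin_lin[OF A.bilin_m] bilin_comp2[OF m'] plin_lin)+
  have act': "?D (bext (\<lambda>e i. single i (bsg e (deg i))) h x) = bext (\<lambda>e i. single i (bsg e (deg i))) h (?D x)" for h x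
    by (rule bilin_eqI[OF bilin_lin[OF bilin_bext] bilin_comp2[OF bilin_bext plin_id plin_lin]])
      (simp add: mult.commute)
  have "bij_betw (\<lambda>x. ?D (r x)) (carrier A) UNIV"
    using bij_betw_trans[OF A.bij D] by (simp add: comp_def)
  then show ?thesis
    by unfold_locales (simp_all add: lin_add lin_scale m' mult' one act' A.hcomp_eq keysD)
qed

section \<open>The Jordan plane\<close>

text \<open>Modulo \<open>J\<close> the commutator of \<open>U\<close> and \<open>V\<close> is c V^2
  - l, which commutes with \<open>V\<close>; commutation with \<open>U\<close> is a derivation, so
  its value on V^j is j V^(j - 1) (c V^2 - l).\<close>

lemma commute_power_past:
  fixes U V :: "'m::monoid_add \<Rightarrow>\<^sub>0 'k::field"
  assumes J: "two_sided J" and UV: "U * V - V * U - pm_scale c (V * V) + pm_scale l 1 \<in> J"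
  shows "U * V ^ j - (V ^ j * U + pm_scale (c * of_nat j) (V ^ Suc j) - pm_scale (l * of_nat j) (V ^ (j - 1))) \<in> J"
proof (induction j)
  case (Suc j)
  let ?E = "\<lambda>j. V ^ j * U + pm_scale (c * of_nat j) (V ^ Suc j) - pm_scale (l * of_nat j) (V ^ (j - 1))"
  \<comment> \<open>For \<open>j = 0\<close> the truncated exponent is wrong, but the coefficient
    vanishes.\<close>
  have 1: "pm_scale (l * of_nat j) (V * V ^ (j - Suc 0)) = pm_scale (l * of_nat j) (V ^ j)"
    by (cases j) simp_all
  have 2: "V ^ j * (V * X) = V * (V ^ j * X)" for X
    by (simp add: power_commutes flip: mult.assoc)
  have "(U * V ^ j - ?E j) * V + V ^ j * (U * V - V * U - pm_scale c (V * V) + pm_scale l 1) \<in> J"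
    by (intro two_sided_add[OF J] two_sided_left[OF J] two_sided_right[OF J] Suc UV)
  also have "(U * V ^ j - ?E j) * V + V ^ j * (U * V - V * U - pm_scale c (V * V) + pm_scale l 1) = U * V ^ Suc j - ?E (Suc j)"
    by (simp add: algebra_simps pm_scale_mult_left pm_scale_mult_right pm_scale_add_left power_commutes)
      (simp add: 1 2 mult.assoc power_commutes)
  finally show ?case .
qed (simp add: two_sided_0[OF J])

text \<open>
  Left multiplication in the algebra with relation \<open>v u - u v + c v\<^sup>2 = 0\<close>; the basis vector \<open>(j, i)\<close>
  stands for \<open>v\<^sup>j u\<^sup>i\<close>. The Jordan plane has \<open>c = 1\<close>, its braided opposite \<open>c = -1\<close>.
\<close>

fun jb :: "'k::field \<Rightarrow> jordan_gen \<Rightarrow> nat \<times> nat \<Rightarrow> (nat \<times> nat \<Rightarrow>\<^sub>0 'k)" where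
  "jb c Ju (j, i) = single (j, Suc i) 1 + single (Suc j, i) (c * of_nat j)"
| "jb c Jv (j, i) = single (Suc j, i) 1"

definition jwd :: "nat \<times> nat \<Rightarrow> jordan_gen list" where
  "jwd = (\<lambda>(j, i). replicate j Jv @ replicate i Ju)"

definition jdeg :: "nat \<times> nat \<Rightarrow> nat" where "jdeg = (\<lambda>(j, i). j + i)"

lemma jdeg_pair [simp]: "jdeg (j, i) = j + i"
  by (simp add: jdeg_def)

definition jid :: "'k::field \<Rightarrow> (jordan_gen list \<Rightarrow>\<^sub>0 'k) set" where
  "jid c = Idl\<^bsub>free_modalg\<^esub> {gen Jv * gen Ju - gen Ju * gen Jv + pm_scale c (gen Jv ^ 2)}"

lemma jordan_ideal_eq: "jordan_ideal = jid 1"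
  by (simp add: jordan_ideal_def jid_def)

text \<open>Rewriting \<open>u\<close> in front of v^j u^i is \<open>commute_power_past\<close> with
  \<open>l = 0\<close>, multiplied by u^i from the right; a \<open>v\<close> in front already gives
  a normal word.\<close>

lemma jordan_normal_form: "normal_form (\<lambda>x. lin (jb c x)) jwd (0, 0) (jid c)"
proof
  fix p :: "jordan_gen list \<Rightarrow>\<^sub>0 'a" and a
  have *: "rho (\<lambda>x. lin (jb c x)) (gen Jv * gen Ju - gen Ju * gen Jv + pm_scale c (gen Jv ^ 2)) a = 0" for a
  proof (rule plin_eqI[OF bilin_right[OF bilin_rho] plin_zero])
    show "rho (\<lambda>x. lin (jb c x)) (gen Jv * gen Ju - gen Ju * gen Jv + pm_scale c (gen Jv ^ 2)) (single i 1) = 0" for i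
      by (cases i) (simp add: rho_add rho_diff rho_scale rho_mult rho_gen lin_add power2_eq_square
          algebra_simps flip: single_add)
  qed simp
  show "p \<in> jid c \<Longrightarrow> rho (\<lambda>x. lin (jb c x)) p a = 0"
    using Idl_minimal[OF two_sided_kernel[of "\<lambda>x. lin (jb c x)"], of "{gen Jv * gen Ju - gen Ju * gen Jv + pm_scale c (gen Jv ^ 2)}"] *
    by (auto simp: jid_def)
next
  fix i :: "nat \<times> nat"
  have "foldr (\<lambda>x. lin (jb c x)) (replicate n Ju) (single (0, 0) 1) = single (0, n) 1" for n
    by (induction n) auto
  moreover have "foldr (\<lambda>x. lin (jb c x)) (replicate n Jv) (single (0, k) 1) = single (n, k) 1" for n k
    by (induction n) auto
  ultimately show "foldr (\<lambda>x. lin (jb c x)) (jwd i) (single (0, 0) 1) = single i 1"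
    by (cases i) (simp add: jwd_def)
next
  fix x and ji :: "nat \<times> nat"
  let ?nf = "lin (\<lambda>i. single (jwd i) (1 :: 'a))"
  obtain j i where ji: "ji = (j, i)" by force
  have J: "two_sided (jid c)" by (simp add: jid_def two_sided_Idl)
  have wd: "single (jwd (j, i)) (1 :: 'a) = gen Jv ^ j * gen Ju ^ i" for j i
    by (simp add: jwd_def single_append single_replicate)
  have "gen Jv * gen Ju - gen Ju * gen Jv + pm_scale c (gen Jv ^ 2) \<in> jid c"
    using Idl_self by (force simp: jid_def)
  from two_sided_uminus[OF J this]
  have "gen Ju * gen Jv - gen Jv * gen Ju - pm_scale c (gen Jv * gen Jv) + pm_scale 0 1 \<in> jid c"
    by (simp add: power2_eq_square algebra_simps)
  from two_sided_right[OF J commute_power_past[OF J this, of j], of "gen Ju ^ i"]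
  have "gen Ju * single (jwd (j, i)) 1 - ?nf (jb c Ju (j, i)) \<in> jid c"
    by (simp add: lin_add wd pm_scale_mult_left pm_scale_mult_right algebra_simps)
  moreover have "gen Jv * single (jwd (j, i)) 1 - ?nf (jb c Jv (j, i)) \<in> jid c"
    using two_sided_0[OF J] by (simp add: wd mult.assoc)
  ultimately show "gen x * single (jwd ji) 1 - ?nf (lin (jb c x) (single ji 1)) \<in> jid c"
    by (cases x) (simp_all add: ji)
qed (auto simp: jwd_def jid_def two_sided_Idl)

abbreviation jeps :: "'k::field \<Rightarrow> (jordan_gen list \<Rightarrow>\<^sub>0 'k) \<Rightarrow> (nat \<times> nat \<Rightarrow>\<^sub>0 'k)" where
  "jeps c \<equiv> normal_form.eps (\<lambda>x. lin (jb c x)) (0, 0)"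

abbreviation jml :: "'k::field \<Rightarrow> (nat \<times> nat \<Rightarrow>\<^sub>0 'k) \<Rightarrow> (nat \<times> nat \<Rightarrow>\<^sub>0 'k) \<Rightarrow> (nat \<times> nat \<Rightarrow>\<^sub>0 'k)" where
  "jml c \<equiv> normal_form.ml (\<lambda>x. lin (jb c x)) jwd"

lemma keys_foldr_jb:
  "keys a \<subseteq> {i. jdeg i = n} \<Longrightarrow> keys (foldr (\<lambda>x. lin (jb c x)) w a) \<subseteq> {i. jdeg i = length w + n}"
proof (induction w)
  case (Cons x w)
  have "keys (jb c x i) \<subseteq> {k. jdeg k = Suc (jdeg i)}" for i
    by (cases i; cases x) (auto simp: in_keys_iff lookup_add lookup_single when_def split: if_splits)
  then have "keys (lin (jb c x) a) \<subseteq> {k. jdeg k = Suc m}" if "keys a \<subseteq> {k. jdeg k = m}" for a m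
    by (intro keys_lin_subset) (use that in fastforce)
  with Cons show ?case by simp
qed simp

lemma keys_jml: "keys (jml c (single i 1) (single j 1)) \<subseteq> {k. jdeg k = jdeg i + jdeg j}"
proof -
  have "length (jwd i) = jdeg i" by (cases i) (simp add: jwd_def)
  then show ?thesis
    using keys_foldr_jb[of "single j 1" "jdeg j" c "jwd i"]
    by (simp add: normal_form.ml_single_left[OF jordan_normal_form])
qed

lemma keys_jeps: "keys (jeps c (single w 1)) \<subseteq> {i. jdeg i = length w}"
  using keys_foldr_jb[of "single (0, 0) 1" 0 c w]
  by (simp add: normal_form.eps_def[OF jordan_normal_form] rho_single)

lemma malg_jordan:
  "\<exists>r. malg (jordan :: ('k::field, _, _) graded_modalg) r (jml 1) (single (0, 0) 1) jdeg \<and>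
     r (jordan_el Ju) = single (0, 1) 1 \<and> r (jordan_el Jv) = single (1, 0) 1 \<and>
     (\<forall>x. jordan_el x \<in> carrier (jordan :: ('k, _, _) graded_modalg))"
proof -
  interpret normal_form "\<lambda>x. lin (jb (1 :: 'k) x)" jwd "(0, 0)" "jid 1"
    by (rule jordan_normal_form)
  show ?thesis
    using malg_quot_free[OF plin_eps surj_eps J_eq bilin_ml eps_mult keys_jeps] eps_gen[of Ju] eps_gen[of Jv]
    by (fastforce simp: jordan_def jordan_ideal_eq jordan_el_def)
qed

section \<open>The braided opposite of the Jordan plane, by reversal of words\<close>

definition reverse :: "('x list \<Rightarrow>\<^sub>0 'k::field) \<Rightarrow> ('x list \<Rightarrow>\<^sub>0 'k)" where
  "reverse = lin (\<lambda>w. single (rev w) 1)"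

lemma plin_reverse: "plin reverse"
  by (simp add: reverse_def)

lemma reverse_reverse [simp]: "reverse (reverse p) = p"
  by (rule plin_eqI[OF plin_comp[OF plin_reverse plin_reverse] plin_id]) (simp add: reverse_def)

lemma reverse_mult: "reverse (p * q) = reverse q * reverse p"
proof (rule bilin_eqI[where B = "\<lambda>p q. reverse (p * q)" and C = "\<lambda>p q. reverse q * reverse p"])
  show "bilin (\<lambda>p q. reverse (p * q))"
    unfolding reverse_def by (rule bilin_lin[OF bilin_times])
  show "bilin (\<lambda>p q. reverse q * reverse p)"
    by (rule bilin_swap[OF bilin_comp2[OF bilin_times plin_reverse plin_reverse]])
qed (simp add: reverse_def mult_single plus_list_def)

lemma reverse_gen [simp]: "reverse (gen x) = gen x"
  by (simp add: reverse_def gen_def)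

text \<open>Reversal is an anti-automorphism; it exchanges v u and u v and fixes v^2, so it maps the
  relation with parameter \<open>c\<close> to minus the one with parameter
  \<open>- c\<close>.\<close>

lemma reverse_jid: "p \<in> jid c \<Longrightarrow> reverse p \<in> jid (- c)"
proof -
  note J = two_sided_Idl[of "{gen Jv * gen Ju - gen Ju * gen Jv + pm_scale (- c) (gen Jv ^ 2)}", folded jid_def]
  have "reverse (gen Jv * gen Ju - gen Ju * gen Jv + pm_scale c (gen Jv ^ 2)) =
    - (gen Jv * gen Ju - gen Ju * gen Jv + pm_scale (- c) (gen Jv ^ 2))"
    by (simp add: plin_add[OF plin_reverse] plin_diff[OF plin_reverse] plin_scale[OF plin_reverse]
        reverse_mult power2_eq_square)
  moreover have "\<dots> \<in> jid (- c)"
    using two_sided_uminus[OF J] Idl_self unfolding jid_def by blast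
  moreover have "two_sided {p. reverse p \<in> jid (- c)}"
    by (rule two_sidedI) (auto simp: plin_0[OF plin_reverse] plin_add[OF plin_reverse] reverse_mult
        intro: two_sided_0[OF J] two_sided_add[OF J] two_sided_left[OF J] two_sided_right[OF J])
  ultimately have "jid c \<subseteq> {p. reverse p \<in> jid (- c)}"
    unfolding jid_def[of c] by (intro Idl_minimal) auto
  then show "p \<in> jid c \<Longrightarrow> reverse p \<in> jid (- c)" by blast
qed

lemma reverse_jid_iff: "reverse p \<in> jid (- 1) \<longleftrightarrow> p \<in> jid 1"
  using reverse_jid[of p 1] reverse_jid[of "reverse p" "- 1"] by auto

text \<open>The sign (-1)^(n (n - 1) / 2) of the permutation that reverses n letters.\<close>

fun tsg :: "nat \<Rightarrow> 'k::field" where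
  "tsg 0 = 1"
| "tsg (Suc n) = tsg n * (- 1) ^ n"

lemma tsg_square: "tsg n * tsg n = 1"
proof (induction n)
  case (Suc n)
  have "tsg (Suc n) * tsg (Suc n) = ((tsg n :: 'a) * tsg n) * ((- 1) ^ n * (- 1) ^ n)"
    by (simp only: tsg.simps mult_ac)
  moreover have "(- 1) ^ n * (- 1) ^ n = (1 :: 'a)" by (cases "even n") simp_all
  ultimately show ?case by (simp only: Suc mult_1)
qed simp

text \<open>Reversing m + n letters means reversing both blocks and swapping them, which takes m n
  further transpositions. So the braiding sign is the coboundary of \<open>tsg\<close> and can be
  removed by rescaling.\<close>

lemma tsg_add: "tsg (m + n) * (- 1) ^ (m * n) = tsg m * tsg n"
proof (induction n)
  case (Suc n)
  have 1: "(- 1) ^ (m + n) * (- 1) ^ m = (- 1 :: 'a) ^ n"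
    by (cases "even m"; cases "even n") simp_all
  have "tsg (m + Suc n) * (- 1) ^ (m * Suc n) =
      (tsg (m + n) * (- 1) ^ (m * n)) * ((- 1) ^ (m + n) * (- 1 :: 'a) ^ m)"
    by (simp only: add_Suc_right tsg.simps mult_Suc_right power_add mult_ac)
  also have "\<dots> = tsg m * tsg n * (- 1) ^ n"
    by (simp only: 1 Suc)
  also have "\<dots> = tsg m * tsg (Suc n)"
    by (simp only: tsg.simps mult.assoc)
  finally show ?case .
qed simp

text \<open>
  In the braided opposite a product of \<open>n\<close> generators is the reversed product in the Jordan plane up
  to the sign \<open>tsg n\<close>; so words are reversed, which turns the relation with parameter 1 into the one
  with parameter \<open>-1\<close>, and then corrected by \<open>tsg\<close>.
\<close>

lemma malg_jordan_op:
  assumes "(2 :: 'k::field) \<noteq> 0"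
  shows "\<exists>r. malg (jordan_op :: ('k, _, _) graded_modalg) r (jml (- 1)) (single (0, 0) 1) jdeg \<and>
     r (jordan_el Ju) = single (0, 1) 1 \<and> r (jordan_el Jv) = single (1, 0) 1 \<and>
     (\<forall>x. jordan_el x \<in> carrier (jordan_op :: ('k, _, _) graded_modalg))"
proof -
  interpret normal_form "\<lambda>x. lin (jb (- 1 :: 'k) x)" jwd "(0, 0)" "jid (- 1)"
    by (rule jordan_normal_form)
  let ?\<pi> = "\<lambda>p. jeps (- 1 :: 'k) (reverse p)"
  have 1: "plin ?\<pi>" by (rule plin_comp[OF plin_eps plin_reverse])
  have 2: "range ?\<pi> = UNIV" by (rule surjI[of _ "\<lambda>a. reverse (nf a)"]) simp
  have 3: "jid 1 = {p. ?\<pi> p = 0}" using reverse_jid_iff J_eq by blast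
  have 4: "bilin (\<lambda>a b. jml (- 1 :: 'k) b a)" by (rule bilin_swap[OF bilin_ml])
  have 5: "?\<pi> (p * q) = jml (- 1) (?\<pi> q) (?\<pi> p)" for p q by (simp add: reverse_mult eps_mult)
  have 6: "keys (?\<pi> (single w 1)) \<subseteq> {i. jdeg i = length w}" for w
    using keys_jeps[of "- 1" "rev w"] by (simp add: reverse_def)
  \<comment> \<open>Coordinates of the Jordan plane itself in which its product is opposite to
    \<open>jml (- 1)\<close>. The braided opposite turns the order round again and leaves only the
    braiding sign to be removed.\<close>
  obtain r where r: "malg (jordan :: ('k, _, _) graded_modalg) r (\<lambda>a b. jml (- 1) b a) (?\<pi> 1) jdeg"
      "\<And>p. r (jid 1 +>\<^bsub>free_modalg\<^esub> p) = ?\<pi> p" "\<And>p. jid 1 +>\<^bsub>free_modalg\<^esub> p \<in> carrier (jordan :: ('k, _, _) graded_modalg)"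
    using malg_quot_free[OF 1 2 3 4 5 6] by (auto simp: jordan_def jordan_ideal_eq)
  let ?s = "lin (\<lambda>i. single i (tsg (jdeg i) :: 'k))"
  have one: "?\<pi> 1 = single (0, 0) 1"
    using single_Nil[where 'b = 'k and 'a = jordan_gen] by (metis eps_1 lin_single pm_scale_1 rev.simps(1) reverse_def)
  have "malg (jordan_op :: ('k, _, _) graded_modalg) (\<lambda>x. ?s (r x)) (jml (- 1)) (single (0, 0) 1) jdeg"
    unfolding jordan_op_def
  proof (rule malg_rescale[OF braided_op_malg[OF r(1) assms] tsg_square bilin_ml])
    show "?s (?\<pi> 1) = single (0, 0) 1" by (simp add: one)
    fix i j
    have "?s (pm_scale ((- 1) ^ (jdeg i * jdeg j)) (jml (- 1) (single i 1) (single j 1))) =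
      pm_scale (tsg (jdeg i + jdeg j) * (- 1) ^ (jdeg i * jdeg j)) (jml (- 1) (single i 1) (single j 1))"
      using lin_homogeneous[OF keys_jml, of "tsg :: nat \<Rightarrow> 'k" "- 1" i j] by (simp add: lin_scale mult.commute)
    then show "?s (bext (\<lambda>i j. pm_scale ((- 1) ^ (jdeg i * jdeg j)) (jml (- 1) (single i 1) (single j 1))) (single i 1) (single j 1)) =
      pm_scale (tsg (jdeg i) * tsg (jdeg j)) (jml (- 1) (single i 1) (single j 1))"
      by (simp add: tsg_add)
  qed
  then show ?thesis
    by (intro exI[of _ "\<lambda>x. ?s (r x)"])
      (use r(3) in \<open>simp add: jordan_el_def jordan_ideal_eq r(2) jordan_op_def braided_op_def\<close>)
qed

section \<open>Normal forms for the double and its deformations\<close>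

text \<open>An opaque name for \<open>single i 1\<close>: it keeps scalars visible as
  \<open>pm_scale\<close>, whereas a \<open>single\<close> would absorb them on
  simplification.\<close>

definition bas :: "'i \<Rightarrow> ('i \<Rightarrow>\<^sub>0 'k::field)" where "bas i = single i 1"

lemma lin_bas [simp]: "lin b (bas i) = b i"
  by (simp add: bas_def)

lemma tens_bas [simp]: "tens (bas i) (bas j) = bas (i, j)"
  by (simp add: bas_def)

lemmas tens_linear [simp] = plin_add[OF bilin_left[OF bilin_tens]] plin_add[OF bilin_right[OF bilin_tens]]
  plin_diff[OF bilin_left[OF bilin_tens]] plin_diff[OF bilin_right[OF bilin_tens]]
  plin_scale[OF bilin_left[OF bilin_tens]] plin_scale[OF bilin_right[OF bilin_tens]]
  plin_0[OF bilin_left[OF bilin_tens]] plin_0[OF bilin_right[OF bilin_tens]]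
  plin_uminus[OF bilin_left[OF bilin_tens]] plin_uminus[OF bilin_right[OF bilin_tens]]

lemma minus_one_square [simp]: "(- 1 :: 'k::field) ^ n * (- 1) ^ n = 1" "(- 1 :: 'k) ^ n * ((- 1) ^ n * x) = x"
proof -
  show 1: "(- 1 :: 'k::field) ^ n * (- 1) ^ n = 1" by (cases "even n") simp_all
  show "(- 1 :: 'k) ^ n * ((- 1) ^ n * x) = x" by (simp add: 1 flip: mult.assoc)
qed

section \<open>Rewriting normal words modulo the relations\<close>

definition cong :: "'r::ring_1 set \<Rightarrow> 'r \<Rightarrow> 'r \<Rightarrow> bool" where "cong J x y \<longleftrightarrow> x - y \<in> J"

definition normal_word :: "'r \<Rightarrow> 'r \<Rightarrow> 'r \<Rightarrow> 'r \<Rightarrow> nat \<Rightarrow> nat \<Rightarrow> nat \<Rightarrow> nat \<Rightarrow> 'r::ring_1" where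
  "normal_word u v u' v' j i l k = v ^ j * u ^ i * v' ^ l * u' ^ k"

context
  fixes J :: "('m::monoid_add \<Rightarrow>\<^sub>0 'k::field) set"
  assumes J: "two_sided J"
begin

lemma cong_refl: "cong J x x"
  by (simp add: cong_def two_sided_0[OF J])

lemma cong_trans: "cong J x y \<Longrightarrow> cong J y z \<Longrightarrow> cong J x z"
  using two_sided_add[OF J, of "x - y" "y - z"] by (simp add: cong_def)

lemma cong_add: "cong J x y \<Longrightarrow> cong J x' y' \<Longrightarrow> cong J (x + x') (y + y')"
  using two_sided_add[OF J, of "x - y" "x' - y'"] by (simp add: cong_def algebra_simps)

lemma cong_left: "cong J x y \<Longrightarrow> cong J (a * x) (a * y)"
  using two_sided_left[OF J, of "x - y" a] by (simp add: cong_def algebra_simps)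

lemma cong_right: "cong J x y \<Longrightarrow> cong J (x * a) (y * a)"
  using two_sided_right[OF J, of "x - y" a] by (simp add: cong_def algebra_simps)

lemma cong_scale: "cong J x y \<Longrightarrow> cong J (pm_scale c x) (pm_scale c y)"
  using two_sided_scale[OF J, of "x - y" c] by (simp add: cong_def pm_scale_diff)

lemma anticommute_power_past:
  assumes "X * Y + Y * X \<in> J"
  shows "cong J (X * Y ^ n) (pm_scale ((- 1) ^ n) (Y ^ n * X))"
proof (induction n)
  case (Suc n)
  have "cong J (X * Y) (- (Y * X))" using assms by (simp add: cong_def)
  from cong_scale[OF cong_left[OF this, of "Y ^ n"], of "(- 1) ^ n"]
  have "cong J (pm_scale ((- 1) ^ n) (Y ^ n * (X * Y))) (pm_scale ((- 1) ^ Suc n) (Y ^ Suc n * X))"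
    by (simp add: power_commutes mult.assoc)
      (simp add: power_commutes flip: mult.assoc)
  moreover have "cong J (X * Y ^ Suc n) (pm_scale ((- 1) ^ n) (Y ^ n * (X * Y)))"
    using cong_right[OF Suc, of Y] by (simp add: power_commutes mult.assoc pm_scale_mult_left)
  ultimately show ?case by (blast intro: cong_trans)
qed (simp add: cong_refl)

text \<open>
  In the deformed algebra \<open>z\<close> is \<open>\<lambda>\<^sub>3 g\<close>; in the double it is 0.
\<close>

context
  fixes u v u' v' z :: "'m \<Rightarrow>\<^sub>0 'k" and l1 l2 :: 'k
  assumes r1: "v * u - u * v + v ^ 2 - pm_scale l1 1 \<in> J"
    and r2: "v' * u' - u' * v' - v' ^ 2 - pm_scale l2 1 \<in> J"
    and r3: "u * u' + u' * u - z \<in> J"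
    and r4: "v * u' + u' * v \<in> J" and r5: "u * v' + v' * u \<in> J" and r6: "v * v' + v' * v \<in> J"
    and zu: "z * u + u * z \<in> J" and zu': "z * u' + u' * z \<in> J" and zv': "z * v' + v' * z \<in> J"
begin

lemma reduce_v: "v * normal_word u v u' v' j i l k = normal_word u v u' v' (Suc j) i l k"
  by (simp add: normal_word_def mult.assoc)

lemma reduce_u: "cong J (u * normal_word u v u' v' j i l k) (normal_word u v u' v' j (Suc i) l k + pm_scale (of_nat j) (normal_word u v u' v' (Suc j) i l k)
  - pm_scale (l1 * of_nat j) (normal_word u v u' v' (j - 1) i l k))"
proof -
  have "u * v - v * u - pm_scale 1 (v * v) + pm_scale l1 1 \<in> J"
    using two_sided_uminus[OF J r1] by (simp add: power2_eq_square algebra_simps)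
  from two_sided_right[OF J commute_power_past[OF J this, of j], of "u ^ i * v' ^ l * u' ^ k"]
  show ?thesis
    by (simp add: cong_def normal_word_def algebra_simps pm_scale_mult_left pm_scale_mult_right)
qed

lemma reduce_v': "cong J (v' * normal_word u v u' v' j i l k) (pm_scale ((- 1) ^ (i + j)) (normal_word u v u' v' j i (Suc l) k))"
proof -
  have 1: "cong J (v' * v ^ j) (pm_scale ((- 1) ^ j) (v ^ j * v'))"
    using r6 by (intro anticommute_power_past) (simp add: add.commute)
  have 2: "cong J (v' * u ^ i) (pm_scale ((- 1) ^ i) (u ^ i * v'))"
    using r5 by (intro anticommute_power_past) (simp add: add.commute)
  have "cong J (v' * normal_word u v u' v' j i l k) (pm_scale ((- 1) ^ j) (v ^ j * (v' * u ^ i) * (v' ^ l * u' ^ k)))"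
    using cong_right[OF 1, of "u ^ i * (v' ^ l * u' ^ k)"]
    by (simp add: normal_word_def mult.assoc pm_scale_mult_left)
  moreover have "cong J (pm_scale ((- 1) ^ j) (v ^ j * (v' * u ^ i) * (v' ^ l * u' ^ k)))
      (pm_scale ((- 1) ^ (i + j)) (normal_word u v u' v' j i (Suc l) k))"
    using cong_scale[OF cong_right[OF cong_left[OF 2, of "v ^ j"], of "v' ^ l * u' ^ k"], of "(- 1) ^ j"]
    by (simp add: normal_word_def mult.assoc pm_scale_mult_left pm_scale_mult_right power_add mult.commute[of "(- 1) ^ i"])
  ultimately show ?thesis by (rule cong_trans)
qed

text \<open>Passing the k-th factor leaves \<open>z\<close> with the sign (-1)^(k - 1), and moving
  this \<open>z\<close> across the remaining i - k factors gives (-1)^(i - k). Thus all i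
  contributions have the same sign (-1)^(i - 1) and add up.\<close>

lemma u'_past_u:
  "cong J (u' * u ^ i) (pm_scale ((- 1) ^ i) (u ^ i * u') + pm_scale ((- 1) ^ Suc i * of_nat i) (u ^ (i - 1) * z))"
proof (induction i)
  case (Suc i)
  have "cong J (u' * u) (z - u * u')"
    using r3 by (simp add: cong_def algebra_simps)
  from cong_scale[OF cong_left[OF this, of "u ^ i"], of "(- 1) ^ i"]
  have 1: "cong J (pm_scale ((- 1) ^ i) (u ^ i * u' * u)) (pm_scale ((- 1) ^ i) (u ^ i * z - u ^ Suc i * u'))"
    by (simp add: algebra_simps) (simp add: power_commutes flip: mult.assoc)
  have 2: "pm_scale (c * of_nat i) (u ^ (i - 1) * u) = pm_scale (c * of_nat i) (u ^ i)" for c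
    by (cases i) (simp_all add: power_commutes)
  have "cong J (z * u) (- (u * z))" using zu by (simp add: cong_def)
  from cong_scale[OF cong_left[OF this, of "u ^ (i - 1)"], of "(- 1) ^ Suc i * of_nat i"]
  have 3: "cong J (pm_scale ((- 1) ^ Suc i * of_nat i) (u ^ (i - 1) * z * u)) (pm_scale ((- 1) ^ i * of_nat i) (u ^ i * z))"
    using 2[of "(- 1) ^ i"] by (simp add: mult.assoc[symmetric] pm_scale_mult_left[symmetric])
  have 4: "cong J (u' * u ^ Suc i) (pm_scale ((- 1) ^ i) (u ^ i * u' * u) + pm_scale ((- 1) ^ Suc i * of_nat i) (u ^ (i - 1) * z * u))"
    using cong_right[OF Suc, of u]
    by (simp add: distrib_right left_diff_distrib pm_scale_mult_left mult.assoc power_commutes)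
  from cong_trans[OF 4 cong_add[OF 1 3]] show ?case
    by (simp add: pm_scale_diff pm_scale_add_left algebra_simps)
qed (simp add: cong_refl)

text \<open>\<open>u'\<close> crosses the power of \<open>v\<close> with a sign, that of
  \<open>u\<close> by \<open>u'_past_u\<close>, and that of \<open>v'\<close> by
  \<open>commute_power_past\<close> with c = -1. The \<open>z\<close> left behind is moved to the
  right end, where normal words keep the power of g.\<close>

lemma reduce_u': "cong J (u' * normal_word u v u' v' j i l k)
  (pm_scale ((- 1) ^ (i + j)) (normal_word u v u' v' j i l (Suc k) - pm_scale (of_nat l) (normal_word u v u' v' j i (Suc l) k) - pm_scale (l2 * of_nat l) (normal_word u v u' v' j i (l - 1) k))
   + pm_scale ((- 1) ^ (i + j + 1 + l + k) * of_nat i) (normal_word u v u' v' j (i - 1) l k * z))"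
proof -
  have "u' * v' - v' * u' - pm_scale (- 1) (v' * v') + pm_scale l2 1 \<in> J"
    using two_sided_uminus[OF J r2] by (simp add: power2_eq_square algebra_simps)
  from commute_power_past[OF J this, of l]
  have A: "cong J (u' * v' ^ l) (v' ^ l * u' - pm_scale (of_nat l) (v' ^ Suc l) - pm_scale (l2 * of_nat l) (v' ^ (l - 1)))"
    by (simp add: cong_def)
  have B: "cong J (u' * v ^ j) (pm_scale ((- 1) ^ j) (v ^ j * u'))"
    using r4 by (intro anticommute_power_past) (simp add: add.commute)
  have C: "cong J (z * (v' ^ l * u' ^ k)) (pm_scale ((- 1) ^ (l + k)) (v' ^ l * u' ^ k * z))"
  proof (rule cong_trans)
    show "cong J (z * (v' ^ l * u' ^ k)) (pm_scale ((- 1) ^ l) (v' ^ l * (z * u' ^ k)))"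
      using cong_right[OF anticommute_power_past[OF zv', of l], of "u' ^ k"]
      by (simp add: mult.assoc pm_scale_mult_left)
    show "cong J (pm_scale ((- 1) ^ l) (v' ^ l * (z * u' ^ k))) (pm_scale ((- 1) ^ (l + k)) (v' ^ l * u' ^ k * z))"
      using cong_scale[OF cong_left[OF anticommute_power_past[OF zu', of k], of "v' ^ l"], of "(- 1) ^ l"]
      by (simp add: mult.assoc pm_scale_mult_right power_add)
  qed
  let ?w = "v' ^ l * u' ^ k"
  have 1: "cong J (u' * normal_word u v u' v' j i l k) (pm_scale ((- 1) ^ j) (v ^ j * (u' * u ^ i) * ?w))"
    using cong_right[OF B, of "u ^ i * ?w"] by (simp add: normal_word_def mult.assoc pm_scale_mult_left)
  have 2: "cong J (pm_scale ((- 1) ^ j) (v ^ j * (u' * u ^ i) * ?w))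
    (pm_scale ((- 1) ^ (i + j)) (v ^ j * u ^ i * (u' * ?w))
      + pm_scale ((- 1) ^ (i + j + 1) * of_nat i) (v ^ j * u ^ (i - 1) * (z * ?w)))"
    using cong_scale[OF cong_right[OF cong_left[OF u'_past_u[of i], of "v ^ j"], of ?w], of "(- 1) ^ j"]
    by (simp add: distrib_left distrib_right left_diff_distrib right_diff_distrib pm_scale_diff mult.assoc pm_scale_mult_left pm_scale_mult_right pm_scale_add power_add mult.left_commute[of "(- 1) ^ j"] mult.commute[of "(- 1) ^ j"])
  have 3: "cong J (pm_scale ((- 1) ^ (i + j)) (v ^ j * u ^ i * (u' * ?w)))
    (pm_scale ((- 1) ^ (i + j)) (normal_word u v u' v' j i l (Suc k) - pm_scale (of_nat l) (normal_word u v u' v' j i (Suc l) k) - pm_scale (l2 * of_nat l) (normal_word u v u' v' j i (l - 1) k)))"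
    using cong_scale[OF cong_left[OF cong_right[OF A, of "u' ^ k"], of "v ^ j * u ^ i"], of "(- 1) ^ (i + j)"]
    by (simp add: normal_word_def left_diff_distrib right_diff_distrib mult.assoc pm_scale_mult_left pm_scale_mult_right)
  have 4: "cong J (pm_scale ((- 1) ^ (i + j + 1) * of_nat i) (v ^ j * u ^ (i - 1) * (z * ?w)))
    (pm_scale ((- 1) ^ (i + j + 1 + l + k) * of_nat i) (normal_word u v u' v' j (i - 1) l k * z))"
    using cong_scale[OF cong_left[OF C, of "v ^ j * u ^ (i - 1)"], of "(- 1) ^ (i + j + 1) * of_nat i"]
    by (simp add: normal_word_def mult.assoc pm_scale_mult_left pm_scale_mult_right power_add mult_ac(2,3))
  from cong_trans[OF 1 cong_trans[OF 2 cong_add[OF 3 4]]] show ?thesis .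
qed

end

end

section \<open>Monomial bases of the double and of its deformations\<close>

type_synonym idx = "(nat \<times> nat) \<times> (nat \<times> nat)"

definition ddeg :: "idx \<Rightarrow> nat" where "ddeg = (\<lambda>(p, q). jdeg p + jdeg q)"

lemma ddeg_pair [simp]: "ddeg (p, q) = jdeg p + jdeg q"
  by (simp add: ddeg_def)

text \<open>
  The basis vector \<open>((j, i), (l, k))\<close> stands for \<open>v\<^sup>j u\<^sup>i v'\<^sup>l u'\<^sup>k\<close>, and \<open>(((j, i), (l, k)), e)\<close> for
  this monomial times \<open>g\<^sup>e\<close>; \<open>Bb\<close> and \<open>Db\<close> are the left multiplications by the generators, where
  \<^const>\<open>None\<close> stands for \<open>g\<close>. The truncated subtractions are harmless, as they come with the
  coefficients \<open>j\<close>, \<open>l\<close> and \<open>i\<close>.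
\<close>

fun Bb :: "'k::field \<Rightarrow> 'k \<Rightarrow> double_gen \<Rightarrow> idx \<Rightarrow> (idx \<Rightarrow>\<^sub>0 'k)" where
  "Bb l1 l2 Gu ((j, i), q) = bas ((j, Suc i), q) + pm_scale (of_nat j) (bas ((Suc j, i), q))
     - pm_scale (l1 * of_nat j) (bas ((j - 1, i), q))"
| "Bb l1 l2 Gv ((j, i), q) = bas ((Suc j, i), q)"
| "Bb l1 l2 Gu' (p, (l, k)) = pm_scale ((- 1) ^ jdeg p) (bas (p, (l, Suc k)) - pm_scale (of_nat l) (bas (p, (Suc l, k)))
     - pm_scale (l2 * of_nat l) (bas (p, (l - 1, k))))"
| "Bb l1 l2 Gv' (p, (l, k)) = pm_scale ((- 1) ^ jdeg p) (bas (p, (Suc l, k)))"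

fun Db :: "'k::field \<Rightarrow> 'k \<Rightarrow> 'k \<Rightarrow> double_gen option \<Rightarrow> idx \<times> bit \<Rightarrow> (idx \<times> bit \<Rightarrow>\<^sub>0 'k)" where
  "Db l1 l2 l3 (Some x) (((j, i), q), e) = tens (Bb l1 l2 x ((j, i), q)) (bas e) +
     (if x = Gu' then pm_scale (l3 * ((- 1) ^ (i + j + 1 + jdeg q) * of_nat i)) (bas (((j, i - 1), q), e + 1)) else 0)"
| "Db l1 l2 l3 None (z, e) = pm_scale ((- 1) ^ ddeg z) (bas (z, e + 1))"

definition Bwd :: "idx \<Rightarrow> double_gen list" where
  "Bwd = (\<lambda>((j, i), (l, k)). replicate j Gv @ replicate i Gu @ replicate l Gv' @ replicate k Gu')"

definition Dwd :: "idx \<times> bit \<Rightarrow> double_gen option list" where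
  "Dwd = (\<lambda>(z, e). map Some (Bwd z) @ (if e = 0 then [] else [None]))"

lemma rel_set: "rel ` {1..6} =
  {gen Gv * gen Gu - gen Gu * gen Gv + gen Gv ^ 2,
      gen Gv' * gen Gu' - gen Gu' * gen Gv' - gen Gv' ^ 2,
      gen Gu * gen Gu' + gen Gu' * gen Gu,
      gen Gv * gen Gu' + gen Gu' * gen Gv,
      gen Gu * gen Gv' + gen Gv' * gen Gu,
      gen Gv * gen Gv' + gen Gv' * gen Gv}"
proof -
  have "{1..6 :: nat} = {1, 2, 3, 4, 5, 6}" by auto
  then show ?thesis by (simp add: rel_def)
qed

text \<open>A presentation with \<open>g\<close> as a fifth letter: the six deformed relations, and
  five that present the smash product, namely that g squares to 1 and anticommutes with the
  generators.\<close>

definition drels :: "'k::field \<Rightarrow> 'k \<Rightarrow> 'k \<Rightarrow> (double_gen option list \<Rightarrow>\<^sub>0 'k) set" where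
  "drels l1 l2 l3 = (let u = gen (Some Gu); v = gen (Some Gv); u' = gen (Some Gu'); v' = gen (Some Gv'); g = gen None in
     {v * u - u * v + v ^ 2 - pm_scale l1 1, v' * u' - u' * v' - v' ^ 2 - pm_scale l2 1,
      u * u' + u' * u - pm_scale l3 g, v * u' + u' * v, u * v' + v' * u, v * v' + v' * v,
      g * g - 1, g * u + u * g, g * v + v * g, g * u' + u' * g, g * v' + v' * g})"

lemmas rho_expand = rho_add rho_diff rho_scale rho_mult rho_gen rho_1 lin_add lin_diff lin_scale lin_uminus
  pm_scale_add pm_scale_diff power2_eq_square

lemmas lookup_expand = lookup_add lookup_minus algebra_simps power_add

lemma rel_kernel:
  assumes "r \<in> rel ` {1..6}"
  shows "rho (\<lambda>x. lin (Bb 0 0 x)) r a = 0"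
proof (rule plin_eqI[OF bilin_right[OF bilin_rho] plin_zero])
  fix z :: idx
  obtain j i l k where z: "z = ((j, i), (l, k))" by (metis surj_pair)
  have "rho (\<lambda>x. lin (Bb 0 0 x)) r (bas z) = 0"
    using assms unfolding rel_set z
    by (elim insertE emptyE; hypsubst; intro poly_mapping_eqI)
      (simp_all add: rho_expand lookup_expand)
  then show "rho (\<lambda>x. lin (Bb 0 0 x)) r (single z 1) = 0"
    by (simp add: bas_def)
qed simp

text \<open>This is where the deformation proves consistent for all values of the parameters: on a
  basis vector each relation is an identity of finitely supported functions. Splitting the exponents
  into zero and successor removes truncated subtractions.\<close>

lemma drels_kernel:
  assumes "r \<in> drels l1 l2 l3"
  shows "rho (\<lambda>x. lin (Db l1 l2 l3 x)) r a = 0"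
proof (rule plin_eqI[OF bilin_right[OF bilin_rho] plin_zero])
  fix z :: "idx \<times> bit"
  obtain j i l k e where z: "z = (((j, i), (l, k)), e)" by (metis surj_pair)
  have e: "e + 1 + 1 = e" by (cases e) simp_all
  have "rho (\<lambda>x. lin (Db l1 l2 l3 x)) r (bas z) = 0"
    using assms unfolding drels_def Let_def z
    by (elim insertE emptyE; hypsubst; intro poly_mapping_eqI; cases j; cases i; cases l)
      (simp_all add: rho_expand lookup_expand e[unfolded add.assoc])
  then show "rho (\<lambda>x. lin (Db l1 l2 l3 x)) r (single z 1) = 0"
    by (simp add: bas_def)
qed simp

lemma foldr_bas_power:
  assumes "\<And>n. f x (c n) = c (Suc n)"
  shows "foldr f (replicate n x) (c 0) = c n"
  by (induction n) (simp_all add: assms)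

lemma single_Bwd:
  "single (Bwd ((j, i), (l, k))) (1 :: 'k::field) = normal_word (gen Gu) (gen Gv) (gen Gu') (gen Gv') j i l k"
  by (simp add: Bwd_def normal_word_def single_append single_replicate mult.assoc)

lemma double_normal_form:
  "normal_form (\<lambda>x. lin (Bb 0 0 x)) Bwd ((0, 0), (0, 0)) (rel_ideal :: 'k::field free4 set)"
proof
  fix p :: "'k free4" and a
  have "rel_ideal \<subseteq> {p. \<forall>a. rho (\<lambda>x. lin (Bb (0 :: 'k) 0 x)) p a = 0}"
    unfolding rel_ideal_def by (rule Idl_minimal[OF two_sided_kernel]) (auto simp: rel_kernel)
  then show "p \<in> rel_ideal \<Longrightarrow> rho (\<lambda>x. lin (Bb 0 0 x)) p a = 0" by blast
next
  fix z :: idx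
  obtain j i l k where z: "z = ((j, i), (l, k))" by (metis surj_pair)
  let ?f = "\<lambda>x. lin (Bb (0 :: 'k) 0 x)"
  have 1: "foldr ?f (replicate n Gu') (bas ((0, 0), (0, 0))) = bas ((0, 0), (0, n))" for n
    by (rule foldr_bas_power[where c = "\<lambda>n. bas ((0, 0), (0, n))"]) simp
  have 2: "foldr ?f (replicate n Gv') (bas ((0, 0), (0, k))) = bas ((0, 0), (n, k))" for n
    by (rule foldr_bas_power[where c = "\<lambda>n. bas ((0, 0), (n, k))"]) simp
  have 3: "foldr ?f (replicate n Gu) (bas ((0, 0), q)) = bas ((0, n), q)" for n q
    by (rule foldr_bas_power[where c = "\<lambda>n. bas ((0, n), q)"]) simp
  have 4: "foldr ?f (replicate n Gv) (bas ((0, i), q)) = bas ((n, i), q)" for n q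
    by (rule foldr_bas_power[where c = "\<lambda>n. bas ((n, i), q)"]) simp
  show "foldr ?f (Bwd z) (single ((0, 0), (0, 0)) 1) = single z 1"
    unfolding bas_def[symmetric]
    by (simp only: Bwd_def z prod.case foldr_append o_apply 1 2 3 4)
next
  fix x and z :: idx
  obtain j i l k where z: "z = ((j, i), (l, k))" by (metis surj_pair)
  let ?u = "gen Gu :: 'k free4" and ?v = "gen Gv :: 'k free4" and ?u' = "gen Gu' :: 'k free4" and ?v' = "gen Gv' :: 'k free4"
  let ?nf = "lin (\<lambda>i. single (Bwd i) (1 :: 'k))"
  have J: "two_sided (rel_ideal :: 'k free4 set)" by (simp add: rel_ideal_def two_sided_Idl)
  have I: "rel ` {1..6} \<subseteq> (rel_ideal :: 'k free4 set)"
    unfolding rel_ideal_def by (rule Idl_self)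
  have R: "?v * ?u - ?u * ?v + ?v ^ 2 - pm_scale 0 1 \<in> rel_ideal" "?v' * ?u' - ?u' * ?v' - ?v' ^ 2 - pm_scale 0 1 \<in> rel_ideal"
    "?u * ?u' + ?u' * ?u - 0 \<in> rel_ideal" "?v * ?u' + ?u' * ?v \<in> rel_ideal" "?u * ?v' + ?v' * ?u \<in> rel_ideal"
    "?v * ?v' + ?v' * ?v \<in> rel_ideal"
    using I unfolding rel_set by simp_all
  \<comment> \<open>The reduction lemmas are used with z = 0 and both scalar parameters 0, so the
    conditions on \<open>z\<close> are trivial.\<close>
  have 0: "0 * y + y * 0 \<in> (rel_ideal :: 'k free4 set)" for y using two_sided_0[OF J] by simp
  note red = reduce_u[OF J R 0 0 0, of j i l k] reduce_v'[OF J R 0 0 0, of j i l k]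
    reduce_u'[OF J R 0 0 0, of j i l k] reduce_v[OF J R 0 0 0, of j i l k]
  show "gen x * single (Bwd z) 1 - ?nf (lin (Bb 0 0 x) (single z 1)) \<in> rel_ideal"
    using red two_sided_0[OF J]
    by (cases x) (simp_all add: z single_Bwd lin_add lin_diff lin_scale cong_def pm_scale_diff algebra_simps)
qed (auto simp: Bwd_def rel_ideal_def two_sided_Idl)

definition QI :: "'k::field \<Rightarrow> 'k \<Rightarrow> 'k \<Rightarrow> (double_gen option list \<Rightarrow>\<^sub>0 'k) set" where
  "QI l1 l2 l3 = Idl\<^bsub>free_modalg\<^esub> (drels l1 l2 l3)"

definition ge :: "bit \<Rightarrow> (double_gen option list \<Rightarrow>\<^sub>0 'k::field)" where
  "ge e = (if e = 0 then 1 else gen None)"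

lemma single_map_Some_Bwd:
  "single (map Some (Bwd ((j, i), (l, k)))) (1 :: 'k::field) =
    normal_word (gen (Some Gu)) (gen (Some Gv)) (gen (Some Gu')) (gen (Some Gv')) j i l k"
  by (simp add: Bwd_def normal_word_def single_append single_replicate mult.assoc)

lemma single_Dwd:
  "single (Dwd (((j, i), (l, k)), e)) (1 :: 'k::field) =
    normal_word (gen (Some Gu)) (gen (Some Gv)) (gen (Some Gu')) (gen (Some Gv')) j i l k * ge e"
proof -
  have "Dwd (((j, i), (l, k)), e) = map Some (Bwd ((j, i), (l, k))) @ (if e = 0 then [] else [None])"
    by (simp add: Dwd_def)
  then show ?thesis
    by (simp add: single_append single_map_Some_Bwd ge_def gen_def)
qed

text \<open>For the four generators the reduction lemmas are multiplied by \<open>ge e\<close> from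
  the right; the letter \<open>g\<close> has to cross the whole monomial before it meets
  \<open>ge e\<close>.\<close>

lemma deform_normal_form:
  "normal_form (\<lambda>x. lin (Db l1 l2 l3 x)) Dwd (((0, 0), (0, 0)), 0) (QI l1 l2 (l3 :: 'k::field))"
proof
  fix p :: "double_gen option list \<Rightarrow>\<^sub>0 'k" and a
  have "QI l1 l2 l3 \<subseteq> {p. \<forall>a. rho (\<lambda>x. lin (Db l1 l2 l3 x)) p a = 0}"
    unfolding QI_def by (rule Idl_minimal[OF two_sided_kernel]) (auto simp: drels_kernel)
  then show "p \<in> QI l1 l2 l3 \<Longrightarrow> rho (\<lambda>x. lin (Db l1 l2 l3 x)) p a = 0" by blast
next
  fix z :: "idx \<times> bit"
  obtain j i l k e where z: "z = (((j, i), (l, k)), e)" by (metis surj_pair)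
  let ?f = "\<lambda>x. lin (Db l1 l2 l3 x)"
  have 1: "foldr ?f (replicate n (Some Gu')) (bas (((0, 0), (0, 0)), e)) = bas (((0, 0), (0, n)), e)" for n
    by (rule foldr_bas_power[where c = "\<lambda>n. bas (((0, 0), (0, n)), e)"]) simp
  have 2: "foldr ?f (replicate n (Some Gv')) (bas (((0, 0), (0, k)), e)) = bas (((0, 0), (n, k)), e)" for n
    by (rule foldr_bas_power[where c = "\<lambda>n. bas (((0, 0), (n, k)), e)"]) simp
  have 3: "foldr ?f (replicate n (Some Gu)) (bas (((0, 0), q), e)) = bas (((0, n), q), e)" for n q
    by (rule foldr_bas_power[where c = "\<lambda>n. bas (((0, n), q), e)"]) simp
  have 4: "foldr ?f (replicate n (Some Gv)) (bas (((0, i), q), e)) = bas (((n, i), q), e)" for n q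
    by (rule foldr_bas_power[where c = "\<lambda>n. bas (((n, i), q), e)"]) simp
  have 5: "foldr ?f (if e = 0 then [] else [None]) (bas (((0, 0), (0, 0)), 0)) = bas (((0, 0), (0, 0)), e)"
    by (cases e) simp_all
  show "foldr ?f (Dwd z) (single (((0, 0), (0, 0)), 0) 1) = single z 1"
    unfolding bas_def[symmetric]
    by (simp only: Dwd_def Bwd_def z prod.case foldr_append map_append map_replicate o_apply 1 2 3 4 5)
next
  fix x and z :: "idx \<times> bit"
  obtain j i l k e where z: "z = (((j, i), (l, k)), e)" by (metis surj_pair)
  let ?u = "gen (Some Gu) :: double_gen option list \<Rightarrow>\<^sub>0 'k" and ?v = "gen (Some Gv) :: double_gen option list \<Rightarrow>\<^sub>0 'k"
    and ?u' = "gen (Some Gu') :: double_gen option list \<Rightarrow>\<^sub>0 'k" and ?v' = "gen (Some Gv') :: double_gen option list \<Rightarrow>\<^sub>0 'k"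
    and ?g = "gen None :: double_gen option list \<Rightarrow>\<^sub>0 'k"
  let ?nf = "lin (\<lambda>i. single (Dwd i) (1 :: 'k))" and ?W = "normal_word (gen (Some Gu)) (gen (Some Gv)) (gen (Some Gu')) (gen (Some Gv'))"
  let ?J = "QI l1 l2 l3"
  have J: "two_sided ?J" by (simp add: QI_def two_sided_Idl)
  have I: "drels l1 l2 l3 \<subseteq> ?J"
    unfolding QI_def by (rule Idl_self)
  have R: "?v * ?u - ?u * ?v + ?v ^ 2 - pm_scale l1 1 \<in> ?J" "?v' * ?u' - ?u' * ?v' - ?v' ^ 2 - pm_scale l2 1 \<in> ?J"
    "?u * ?u' + ?u' * ?u - pm_scale l3 ?g \<in> ?J" "?v * ?u' + ?u' * ?v \<in> ?J" "?u * ?v' + ?v' * ?u \<in> ?J"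
    "?v * ?v' + ?v' * ?v \<in> ?J"
    and g: "?g * ?g - 1 \<in> ?J"
    and G: "?g * ?u + ?u * ?g \<in> ?J" "?g * ?v + ?v * ?g \<in> ?J" "?g * ?u' + ?u' * ?g \<in> ?J" "?g * ?v' + ?v' * ?g \<in> ?J"
    using I unfolding drels_def Let_def by simp_all
  \<comment> \<open>Here \<open>z\<close> is \<open>\<lambda>\<^sub>3 g\<close>, which inherits the
    anticommutation of g.\<close>
  have Z: "pm_scale l3 ?g * y + y * pm_scale l3 ?g \<in> ?J" if "?g * y + y * ?g \<in> ?J" for y
    using two_sided_scale[OF J that, of l3] by (simp add: pm_scale_add pm_scale_mult_left pm_scale_mult_right)
  note hyps = J R Z[OF G(1)] Z[OF G(3)] Z[OF G(4)]
  have ge: "cong ?J (?g * ge e) (ge (e + 1))"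
    using g by (cases e) (simp_all add: ge_def cong_def two_sided_0[OF J])
  note red = cong_right[OF J reduce_u[OF hyps, of j i l k], of "ge e"]
    cong_right[OF J reduce_v'[OF hyps, of j i l k], of "ge e"]
  have v: "gen (Some Gv) * single (Dwd z) 1 - ?nf (lin (Db l1 l2 l3 (Some Gv)) (single z 1)) \<in> ?J"
    using reduce_v[OF hyps, of j i l k] two_sided_0[OF J]
    by (simp add: z single_Dwd flip: mult.assoc)
  have u: "gen (Some Gu) * single (Dwd z) 1 - ?nf (lin (Db l1 l2 l3 (Some Gu)) (single z 1)) \<in> ?J"
    using red(1) by (simp add: z single_Dwd cong_def lin_add lin_diff lin_scale algebra_simps pm_scale_mult_left)
  have v': "gen (Some Gv') * single (Dwd z) 1 - ?nf (lin (Db l1 l2 l3 (Some Gv')) (single z 1)) \<in> ?J"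
    using red(2) by (simp add: z single_Dwd cong_def lin_add lin_diff lin_scale algebra_simps pm_scale_mult_left)
  \<comment> \<open>The \<open>z\<close> at the right end of a reduced monomial merges with
    \<open>g\<^sup>e\<close> and becomes
    \<open>\<lambda>\<^sub>3 g\<^sup>e\<^sup>+\<^sup>1\<close>.\<close>
  have "cong ?J (?W j (i - 1) l k * pm_scale l3 ?g * ge e) (pm_scale l3 (?W j (i - 1) l k * ge (e + 1)))"
    using cong_scale[OF J cong_left[OF J ge, of "?W j (i - 1) l k"], of l3]
    by (simp add: pm_scale_mult_left pm_scale_mult_right mult.assoc)
  note z_ge = cong_scale[OF J this, of "(- 1) ^ (i + j + 1 + l + k) * of_nat i"]
  let ?A = "pm_scale ((- 1) ^ (i + j)) (?W j i l (Suc k) - pm_scale (of_nat l) (?W j i (Suc l) k) - pm_scale (l2 * of_nat l) (?W j i (l - 1) k)) * ge e"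
  have "cong ?J (?u' * ?W j i l k * ge e)
    (?A + pm_scale ((- 1) ^ (i + j + 1 + l + k) * of_nat i) (?W j (i - 1) l k * pm_scale l3 ?g * ge e))"
    using cong_right[OF J reduce_u'[OF hyps, of j i l k], of "ge e"]
    by (simp only: distrib_right pm_scale_mult_left)
  from cong_trans[OF J this cong_add[OF J cong_refl[OF J] z_ge]]
  have "cong ?J (?u' * ?W j i l k * ge e)
    (?A + pm_scale ((- 1) ^ (i + j + 1 + l + k) * of_nat i) (pm_scale l3 (?W j (i - 1) l k * ge (e + 1))))" .
  then have u': "gen (Some Gu') * single (Dwd z) 1 - ?nf (lin (Db l1 l2 l3 (Some Gu')) (single z 1)) \<in> ?J"
    by (simp add: z single_Dwd cong_def lin_add lin_diff lin_scale algebra_simps pm_scale_mult_left pm_scale_diff power_add)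
  \<comment> \<open>\<open>g\<close> crosses the four blocks of the monomial one after another; the
    signs multiply to (-1) to the power of the degree.\<close>
  note past = anticommute_power_past[OF J G(1)] anticommute_power_past[OF J G(2)]
    anticommute_power_past[OF J G(3)] anticommute_power_past[OF J G(4)]
  have 1: "cong ?J (?g * ?v ^ j * (?u ^ i * ?v' ^ l * ?u' ^ k * ge e)) (pm_scale ((- 1) ^ j) (?v ^ j * (?g * ?u ^ i) * (?v' ^ l * ?u' ^ k * ge e)))"
    using cong_right[OF J past(2)[of j], of "?u ^ i * ?v' ^ l * ?u' ^ k * ge e"] by (simp add: pm_scale_mult_left mult.assoc)
  have 2: "cong ?J (pm_scale ((- 1) ^ j) (?v ^ j * (?g * ?u ^ i) * (?v' ^ l * ?u' ^ k * ge e)))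
    (pm_scale ((- 1) ^ (j + i)) (?v ^ j * ?u ^ i * (?g * ?v' ^ l) * (?u' ^ k * ge e)))"
    using cong_scale[OF J cong_right[OF J cong_left[OF J past(1)[of i], of "?v ^ j"], of "?v' ^ l * ?u' ^ k * ge e"], of "(- 1) ^ j"]
    by (simp add: pm_scale_mult_left pm_scale_mult_right mult.assoc power_add)
  have 3: "cong ?J (pm_scale ((- 1) ^ (j + i)) (?v ^ j * ?u ^ i * (?g * ?v' ^ l) * (?u' ^ k * ge e)))
    (pm_scale ((- 1) ^ (j + i + l)) (?v ^ j * ?u ^ i * ?v' ^ l * (?g * ?u' ^ k) * ge e))"
    using cong_scale[OF J cong_right[OF J cong_left[OF J past(4)[of l], of "?v ^ j * ?u ^ i"], of "?u' ^ k * ge e"], of "(- 1) ^ (j + i)"]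
    by (simp add: pm_scale_mult_left pm_scale_mult_right mult.assoc power_add)
  have 4: "cong ?J (pm_scale ((- 1) ^ (j + i + l)) (?v ^ j * ?u ^ i * ?v' ^ l * (?g * ?u' ^ k) * ge e))
    (pm_scale ((- 1) ^ (j + i + (l + k))) (?W j i l k * (?g * ge e)))"
    using cong_scale[OF J cong_right[OF J cong_left[OF J past(3)[of k], of "?v ^ j * ?u ^ i * ?v' ^ l"], of "ge e"], of "(- 1) ^ (j + i + l)"]
    by (simp add: normal_word_def pm_scale_mult_left pm_scale_mult_right mult.assoc power_add)
  have "cong ?J (?g * (?W j i l k * ge e)) (pm_scale ((- 1) ^ (j + i + (l + k))) (?W j i l k * ge (e + 1)))"
    using cong_trans[OF J 1 cong_trans[OF J 2 cong_trans[OF J 3 cong_trans[OF J 4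
        cong_scale[OF J cong_left[OF J ge, of "?W j i l k"], of "(- 1) ^ (j + i + (l + k))"]]]]]
    by (simp add: normal_word_def mult.assoc)
  then have g: "?g * single (Dwd z) 1 - ?nf (lin (Db l1 l2 l3 None) (single z 1)) \<in> ?J"
    by (simp add: z single_Dwd cong_def lin_scale)
  show "gen x * single (Dwd z) 1 - ?nf (lin (Db l1 l2 l3 x) (single z 1)) \<in> ?J"
  proof (cases x)
    case None
    with g show ?thesis by (simp only:)
  next
    case (Some y)
    show ?thesis unfolding Some by (cases y) (simp_all only: u v u' v')
  qed
qed (auto simp: Dwd_def Bwd_def QI_def two_sided_Idl)

section \<open>The products on normal forms compared with braided and smash products\<close>

abbreviation bml :: "(idx \<Rightarrow>\<^sub>0 'k::field) \<Rightarrow> (idx \<Rightarrow>\<^sub>0 'k) \<Rightarrow> (idx \<Rightarrow>\<^sub>0 'k)" where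
  "bml \<equiv> normal_form.ml (\<lambda>x. lin (Bb 0 0 x)) Bwd"

abbreviation dml :: "'k::field \<Rightarrow> 'k \<Rightarrow> 'k \<Rightarrow> (idx \<times> bit \<Rightarrow>\<^sub>0 'k) \<Rightarrow> (idx \<times> bit \<Rightarrow>\<^sub>0 'k) \<Rightarrow> (idx \<times> bit \<Rightarrow>\<^sub>0 'k)" where
  "dml l1 l2 l3 \<equiv> normal_form.ml (\<lambda>x. lin (Db l1 l2 l3 x)) Dwd"

lemma plin_foldr_lin: "plin (foldr (\<lambda>x. lin (b x)) w)"
  by (rule plin_foldr) simp

text \<open>Unprimed letters act on the first tensor factor. Primed letters act on the second after
  passing the first, so the sign requires a homogeneous first factor, here a basis vector.\<close>

lemma lin_Bb_tens:
  fixes a b :: "nat \<times> nat \<Rightarrow>\<^sub>0 'k::field"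
  shows "lin (Bb 0 0 Gu) (tens a b) = tens (lin (jb 1 Ju) a) b"
    and "lin (Bb 0 0 Gv) (tens a b) = tens (lin (jb 1 Jv) a) b"
    and "lin (Bb 0 0 Gu') (tens (bas p) b) = pm_scale ((- 1) ^ jdeg p) (tens (bas p) (lin (jb (- 1) Ju) b))"
    and "lin (Bb 0 0 Gv') (tens (bas p) b) = pm_scale ((- 1) ^ jdeg p) (tens (bas p) (lin (jb (- 1) Jv) b))"
proof -
  have s: "single i c = pm_scale c (bas i)" for i :: "nat \<times> nat" and c :: 'k
    by (simp add: bas_def)
  show "lin (Bb 0 0 Gu) (tens a b) = tens (lin (jb 1 Ju) a) b"
  proof (rule bilin_eqI[OF bilin_lin[OF bilin_tens] bilin_comp2[OF bilin_tens plin_lin plin_id]])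
    show "lin (Bb 0 0 Gu) (tens (single p 1) (single q 1)) = tens (lin (jb 1 Ju) (single p 1)) (single q (1 :: 'k))" for p q
      by (cases p; cases q) (simp add: s)
  qed
  show "lin (Bb 0 0 Gv) (tens a b) = tens (lin (jb 1 Jv) a) b"
  proof (rule bilin_eqI[OF bilin_lin[OF bilin_tens] bilin_comp2[OF bilin_tens plin_lin plin_id]])
    show "lin (Bb 0 0 Gv) (tens (single p 1) (single q 1)) = tens (lin (jb 1 Jv) (single p 1)) (single q (1 :: 'k))" for p q
      by (cases p; cases q) (simp add: s)
  qed
  note rules = plin_lin_comp[OF bilin_right[OF bilin_tens]]
    plin_pm_scale[OF plin_comp[OF bilin_right[OF bilin_tens] plin_lin]]
  show "lin (Bb 0 0 Gu') (tens (bas p) b) = pm_scale ((- 1) ^ jdeg p) (tens (bas p) (lin (jb (- 1) Ju) b))"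
  proof (rule plin_eqI[OF rules])
    show "lin (Bb 0 0 Gu') (tens (bas p) (single q 1)) = pm_scale ((- 1) ^ jdeg p) (tens (bas p) (lin (jb (- 1) Ju) (single q (1 :: 'k))))" for q
      by (cases q) (simp add: s)
  qed
  show "lin (Bb 0 0 Gv') (tens (bas p) b) = pm_scale ((- 1) ^ jdeg p) (tens (bas p) (lin (jb (- 1) Jv) b))"
  proof (rule plin_eqI[OF rules])
    show "lin (Bb 0 0 Gv') (tens (bas p) (single q 1)) = pm_scale ((- 1) ^ jdeg p) (tens (bas p) (lin (jb (- 1) Jv) (single q (1 :: 'k))))" for q
      by (cases q) (simp add: s)
  qed
qed

text \<open>The core of the presentation of the double: the product obtained by rewriting modulo the
  six relations is that of the braided tensor product. A normal word splits into an unprimed block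
  acting on the first factor and a primed block acting on the second.\<close>

lemma bml_eq:
  "bml = bext (\<lambda>(i, j) (i', j'). pm_scale ((- 1) ^ (jdeg j * jdeg i'))
       (tens (jml 1 (single i 1) (single i' 1)) (jml (- 1) (single j 1) (single j' (1 :: 'k::field)))))"
proof (intro ext)
  fix a b :: "idx \<Rightarrow>\<^sub>0 'k"
  let ?f = "\<lambda>x. lin (Bb (0 :: 'k) 0 x)" and ?m = "\<lambda>(i, j) (i', j'). pm_scale ((- 1) ^ (jdeg j * jdeg i'))
       (tens (jml 1 (single i 1) (single i' 1)) (jml (- 1) (single j 1) (single j' (1 :: 'k))))"
  interpret B: normal_form ?f Bwd "((0, 0), (0, 0))" rel_ideal by (rule double_normal_form)
  have first: "foldr ?f (replicate j Gv @ replicate i Gu) (tens a b) = tens (foldr (\<lambda>x. lin (jb 1 x)) (jwd (j, i)) a) b" for i j a b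
  proof -
    have "foldr ?f (replicate i Gu) (tens a b) = tens (foldr (\<lambda>x. lin (jb 1 x)) (replicate i Ju) a) b" for i a b
      by (induction i) (simp_all add: lin_Bb_tens)
    moreover have "foldr ?f (replicate j Gv) (tens a b) = tens (foldr (\<lambda>x. lin (jb 1 x)) (replicate j Jv) a) b" for j a b
      by (induction j) (simp_all add: lin_Bb_tens)
    ultimately show ?thesis by (simp add: jwd_def del: foldr_replicate)
  qed
  \<comment> \<open>Each of the \<open>l + k\<close> primed letters contributes the sign of
    \<open>p\<close>, and none of them changes \<open>p\<close>.\<close>
  have second: "foldr ?f (replicate l Gv' @ replicate k Gu') (tens (bas p) b) =
    pm_scale ((- 1) ^ ((l + k) * jdeg p)) (tens (bas p) (foldr (\<lambda>x. lin (jb (- 1) x)) (jwd (l, k)) b))" for l k p b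
  proof -
    have "foldr ?f (replicate k Gu') (tens (bas p) b) =
      pm_scale ((- 1) ^ (k * jdeg p)) (tens (bas p) (foldr (\<lambda>x. lin (jb (- 1) x)) (replicate k Ju) b))" for k b
      by (induction k) (simp_all add: lin_Bb_tens lin_scale power_add mult.commute)
    moreover have "foldr ?f (replicate l Gv') (tens (bas p) b) =
      pm_scale ((- 1) ^ (l * jdeg p)) (tens (bas p) (foldr (\<lambda>x. lin (jb (- 1) x)) (replicate l Jv) b))" for l b
      by (induction l) (simp_all add: lin_Bb_tens lin_scale power_add mult.commute)
    ultimately show ?thesis
      using plin_scale[OF plin_foldr_lin, of "Bb 0 0" "replicate l Gv'" "(- 1 :: 'k) ^ (k * jdeg p)"]
      by (simp add: jwd_def distrib_right distrib_left power_add mult.commute del: foldr_replicate)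
  qed
  show "bml a b = bext ?m a b"
  proof (rule bilin_eqI[OF B.bilin_ml bilin_bext])
    fix z z' :: idx
    obtain j i l k p q where z: "z = ((j, i), (l, k))" "z' = (p, q)" by (metis surj_pair)
    have wd: "Bwd ((j, i), (l, k)) = (replicate j Gv @ replicate i Gu) @ (replicate l Gv' @ replicate k Gu')"
      by (simp add: Bwd_def)
    have "bml (single z 1) (single z' 1) = foldr ?f (replicate j Gv @ replicate i Gu)
        (foldr ?f (replicate l Gv' @ replicate k Gu') (tens (bas p) (bas q)))"
      by (simp only: B.ml_single_left z wd tens_bas foldr_append o_apply) (simp only: bas_def)
    also have "\<dots> = pm_scale ((- 1) ^ ((l + k) * jdeg p)) (tens (foldr (\<lambda>x. lin (jb 1 x)) (jwd (j, i)) (bas p))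
        (foldr (\<lambda>x. lin (jb (- 1) x)) (jwd (l, k)) (bas q)))"
      unfolding second by (simp only: plin_scale[OF plin_foldr_lin] first)
    finally show "bml (single z 1) (single z' 1) = bext ?m (single z 1) (single z' 1)"
      by (simp add: z normal_form.ml_single_left[OF jordan_normal_form] bas_def)
  qed
qed

text \<open>With all parameters 0 the five-letter presentation yields the smash product of the
  double: the final \<open>g\<close> of a normal word acts first and produces the sign, and the
  remaining letters act on the first factor only.\<close>

lemma dml_eq:
  "dml 0 0 0 = bext (\<lambda>(i, h) (i', h'). pm_scale (bsg h (ddeg i'))
    (tens (bml (single i 1) (single i' 1)) (single (h + h') (1 :: 'k::field))))"
proof (intro ext)
  fix a b :: "idx \<times> bit \<Rightarrow>\<^sub>0 'k"
  let ?F = "\<lambda>x. lin (Db (0 :: 'k) 0 0 x)" and ?f = "\<lambda>x. lin (Bb (0 :: 'k) 0 x)"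
    and ?m = "\<lambda>(i, h) (i', h'). pm_scale (bsg h (ddeg i'))
    (tens (bml (single i 1) (single i' 1)) (single (h + h') (1 :: 'k)))"
  interpret D: normal_form ?F Dwd "(((0, 0), (0, 0)), 0)" "QI 0 0 0" by (rule deform_normal_form)
  interpret B: normal_form ?f Bwd "((0, 0), (0, 0))" rel_ideal by (rule double_normal_form)
  have 1: "?F (Some x) (tens s (bas e)) = tens (?f x s) (bas e)" for x s e
  proof (rule plin_eqI[OF plin_lin_comp[OF bilin_left[OF bilin_tens]] plin_comp[OF bilin_left[OF bilin_tens] plin_lin]])
    show "?F (Some x) (tens (single z 1) (bas e)) = tens (?f x (single z 1)) (bas e)" for z
    proof -
      obtain j i q where z: "z = ((j, i), q)" by (metis surj_pair)
      have "?F (Some x) (tens (bas z) (bas e)) = tens (?f x (bas z)) (bas e)" by (simp add: z)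
      then show ?thesis by (simp only: bas_def)
    qed
  qed
  have 2: "foldr ?F (map Some w) (tens s (bas e)) = tens (foldr ?f w s) (bas e)" for w s e
    by (induction w) (simp_all add: 1)
  have 3: "foldr ?F (if e = 0 then [] else [None]) (tens (bas z) (bas e')) = pm_scale (bsg e (ddeg z)) (tens (bas z) (bas (e + e')))" for e z e'
    by (cases e) (simp_all add: add.commute)
  show "dml 0 0 0 a b = bext ?m a b"
  proof (rule bilin_eqI[OF D.bilin_ml bilin_bext])
    fix y y' :: "idx \<times> bit"
    obtain z e z' e' where y: "y = (z, e)" "y' = (z', e')" by (metis surj_pair)
    have wd: "Dwd (z, e) = map Some (Bwd z) @ (if e = 0 then [] else [None])"
      by (simp add: Dwd_def)
    have "dml 0 0 0 (single y 1) (single y' 1) = foldr ?F (map Some (Bwd z))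
        (foldr ?F (if e = 0 then [] else [None]) (tens (bas z') (bas e')))"
      by (simp only: D.ml_single_left y wd tens_bas foldr_append o_apply) (simp only: bas_def)
    also have "\<dots> = pm_scale (bsg e (ddeg z')) (tens (foldr ?f (Bwd z) (bas z')) (bas (e + e')))"
      unfolding 3 by (simp only: plin_scale[OF plin_foldr_lin] 2)
    finally show "dml 0 0 0 (single y 1) (single y' 1) = bext ?m (single y 1) (single y' 1)"
      by (simp add: y B.ml_single_left bas_def)
  qed
qed

section \<open>The filtration by degree\<close>

definition mdeg :: "idx \<times> bit \<Rightarrow> nat" where "mdeg z = ddeg (fst z)"

lemma mdeg_pair [simp]: "mdeg (z, e) = ddeg z"
  by (simp add: mdeg_def)

definition fil :: "('i \<Rightarrow> nat) \<Rightarrow> nat \<Rightarrow> ('i \<Rightarrow>\<^sub>0 'k::field) \<Rightarrow> bool" where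
  "fil deg n a \<longleftrightarrow> keys a \<subseteq> {i. deg i \<le> n}"

lemma fil_bas [simp]: "fil deg n (bas i) \<longleftrightarrow> deg i \<le> n"
  by (simp add: fil_def bas_def)

lemma fil_0 [simp]: "fil deg n 0"
  by (simp add: fil_def)

lemma fil_iff: "fil deg n a \<longleftrightarrow> (\<forall>i. n < deg i \<longrightarrow> lookup a i = 0)"
  by (auto simp: fil_def in_keys_iff subset_iff) (meson linorder_not_le)

lemma fil_uminus [simp]: "fil deg n (- a) \<longleftrightarrow> fil deg n a"
  by (simp add: fil_iff)

lemma fil_add: "fil deg n a \<Longrightarrow> fil deg n b \<Longrightarrow> fil deg n (a + b)"
  and fil_diff: "fil deg n a \<Longrightarrow> fil deg n b \<Longrightarrow> fil deg n (a - b)"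
  and fil_scale: "fil deg n a \<Longrightarrow> fil deg n (pm_scale c a)"
  and fil_mono: "fil deg n a \<Longrightarrow> n \<le> m \<Longrightarrow> fil deg m a"
  by (auto simp: fil_iff lookup_add lookup_minus)

lemma fil_sum: "(\<And>x. x \<in> A \<Longrightarrow> fil deg n (f x)) \<Longrightarrow> fil deg n (sum f A)"
  by (induction A rule: infinite_finite_induct) (auto intro: fil_add)

lemma fil_lin: "(\<And>i. i \<in> keys a \<Longrightarrow> fil deg n (b i)) \<Longrightarrow> fil deg n (lin b a)"
  unfolding lin_def by (intro fil_sum fil_scale)

lemma gpart_fil: "fil deg n a \<Longrightarrow> n < m \<Longrightarrow> gpart deg m a = 0"
  by (rule poly_mapping_eqI) (auto simp: fil_iff)

lemma gpart_bas: "gpart deg n (bas i) = (if deg i = n then bas i else 0)"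
  by (simp add: gpart_def bas_def)

lemma lin_cong: "(\<And>i. i \<in> keys a \<Longrightarrow> b i = b' i) \<Longrightarrow> lin b a = lin b' a"
  by (simp add: lin_def)

lemma plin_lin_push: "plin f \<Longrightarrow> f (lin b a) = lin (\<lambda>i. f (b i)) a"
  by (simp add: lin_def plin_sum plin_scale)

definition wt :: "double_gen option \<Rightarrow> nat" where
  "wt x = (case x of None \<Rightarrow> 0 | Some _ \<Rightarrow> 1)"

text \<open>A nonzero term that carries a parameter has degree \<open>mdeg z - 1\<close>, two below
  the top degree for a generator, while the terms of top degree are free of parameters.\<close>

lemma Db_top:
  "fil mdeg (wt x + mdeg z) (Db l1 l2 l3 x z) \<and> gpart mdeg (wt x + mdeg z) (Db l1 l2 l3 x z) = Db 0 0 0 x z"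
proof -
  obtain j i l k e where z: "z = (((j, i), (l, k)), e)" by (metis surj_pair)
  note [simp] = plin_add[OF plin_gpart] plin_diff[OF plin_gpart] plin_scale[OF plin_gpart] plin_0[OF plin_gpart]
    plin_uminus[OF plin_gpart]
  show ?thesis
  proof (cases x)
    case None
    then show ?thesis by (simp add: z wt_def gpart_bas fil_scale)
  next
    case (Some y)
    show ?thesis unfolding Some z
      by (cases y; cases j; cases i; cases l)
        (simp_all add: wt_def gpart_bas pm_scale_diff, (auto intro!: fil_add fil_diff fil_scale)+)
  qed
qed

lemma lin_Db_top:
  assumes "fil mdeg n a"
  shows "fil mdeg (wt x + n) (lin (Db l1 l2 l3 x) a) \<and>
    gpart mdeg (wt x + n) (lin (Db l1 l2 l3 x) a) = lin (Db 0 0 0 x) (gpart mdeg n a)"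
proof
  have le: "mdeg z \<le> n" if "z \<in> keys a" for z using assms that by (auto simp: fil_def)
  show "fil mdeg (wt x + n) (lin (Db l1 l2 l3 x) a)"
    by (rule fil_lin) (use Db_top le in \<open>blast intro: fil_mono add_left_mono\<close>)
  have "gpart mdeg (wt x + n) (Db l1 l2 l3 x z) = (if mdeg z = n then Db 0 0 0 x z else 0)" if "z \<in> keys a" for z
    using Db_top[of x z l1 l2 l3] le[OF that] gpart_fil[of mdeg "wt x + mdeg z" "Db l1 l2 l3 x z" "wt x + n"]
    by auto
  then have "gpart mdeg (wt x + n) (lin (Db l1 l2 l3 x) a) = lin (\<lambda>z. if mdeg z = n then Db 0 0 0 x z else 0) a"
    unfolding plin_lin_push[OF plin_gpart] by (rule lin_cong)
  also have "\<dots> = lin (Db 0 0 0 x) (gpart mdeg n a)"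
    unfolding gpart_def plin_lin_push[OF plin_lin] by (rule lin_cong) simp
  finally show "gpart mdeg (wt x + n) (lin (Db l1 l2 l3 x) a) = lin (Db 0 0 0 x) (gpart mdeg n a)" .
qed

lemma foldr_Db_top:
  assumes "fil mdeg n a"
  shows "fil mdeg (sum_list (map wt w) + n) (foldr (\<lambda>x. lin (Db l1 l2 l3 x)) w a) \<and>
    gpart mdeg (sum_list (map wt w) + n) (foldr (\<lambda>x. lin (Db l1 l2 l3 x)) w a) =
    foldr (\<lambda>x. lin (Db 0 0 0 x)) w (gpart mdeg n a)"
proof (induction w)
  case (Cons x w)
  then show ?case
    using lin_Db_top[of "sum_list (map wt w) + n" "foldr (\<lambda>x. lin (Db l1 l2 l3 x)) w a" x l1 l2 l3]
    by (simp add: add.assoc)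
qed (use assms in simp)

lemma sum_list_wt_Dwd: "sum_list (map wt (Dwd z)) = mdeg z"
proof -
  have "sum_list (map wt (map Some w)) = length w" for w by (induction w) (simp_all add: wt_def)
  moreover have "length (Bwd z) = ddeg z" for z by (cases z) (auto simp: Bwd_def)
  ultimately show ?thesis by (cases z) (simp add: Dwd_def wt_def)
qed

text \<open>The first factor is expanded into normal words. A word of weight m raises degrees by at
  most m, with leading part as for zero parameters by \<open>foldr_Db_top\<close>, and words of
  smaller weight do not reach degree m + n.\<close>

lemma dml_top:
  fixes l1 l2 l3 :: "'k::field"
  assumes "fil mdeg m a" "fil mdeg n b"
  shows "gpart mdeg (m + n) (dml l1 l2 l3 a b) = dml 0 0 0 (gpart mdeg m a) (gpart mdeg n b)"
    and "fil mdeg (m + n) (dml l1 l2 l3 a b)"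
proof -
  interpret D: normal_form "\<lambda>x. lin (Db l1 l2 l3 x)" Dwd "(((0, 0), (0, 0)), 0)" "QI l1 l2 l3"
    by (rule deform_normal_form)
  interpret D0: normal_form "\<lambda>x. lin (Db (0 :: 'k) 0 0 x)" Dwd "(((0, 0), (0, 0)), 0)" "QI 0 0 0"
    by (rule deform_normal_form)
  have le: "mdeg z \<le> m" if "z \<in> keys a" for z using assms that by (auto simp: fil_def)
  have eq: "dml l1 l2 l3 a b = lin (\<lambda>z. foldr (\<lambda>x. lin (Db l1 l2 l3 x)) (Dwd z) b) a"
    using plin_conv_lin[OF bilin_left[OF D.bilin_ml], of a b] by (simp add: D.ml_single_left)
  have fz: "fil mdeg (mdeg z + n) (foldr (\<lambda>x. lin (Db l1 l2 l3 x)) (Dwd z) b)"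
    "gpart mdeg (mdeg z + n) (foldr (\<lambda>x. lin (Db l1 l2 l3 x)) (Dwd z) b) =
      dml 0 0 0 (single z 1) (gpart mdeg n b)" for z
    using foldr_Db_top[OF assms(2), of "Dwd z" l1 l2 l3] by (simp_all add: sum_list_wt_Dwd D0.ml_single_left)
  show "fil mdeg (m + n) (dml l1 l2 l3 a b)"
    unfolding eq by (rule fil_lin) (use fz(1) le in \<open>blast intro: fil_mono add_right_mono\<close>)
  have "gpart mdeg (m + n) (foldr (\<lambda>x. lin (Db l1 l2 l3 x)) (Dwd z) b) =
    dml 0 0 0 (if mdeg z = m then single z 1 else 0) (gpart mdeg n b)" if "z \<in> keys a" for z
    using fz[of z] le[OF that] gpart_fil[OF fz(1), of z "m + n"] plin_0[OF bilin_left[OF D0.bilin_ml]]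
    by (cases "mdeg z = m") auto
  then have "gpart mdeg (m + n) (dml l1 l2 l3 a b) =
    lin (\<lambda>z. dml 0 0 0 (if mdeg z = m then single z 1 else 0) (gpart mdeg n b)) a"
    unfolding eq plin_lin_push[OF plin_gpart] by (rule lin_cong)
  then show "gpart mdeg (m + n) (dml l1 l2 l3 a b) = dml 0 0 0 (gpart mdeg m a) (gpart mdeg n b)"
    unfolding gpart_def[of mdeg m] plin_lin_push[OF bilin_left[OF D0.bilin_ml]] .
qed

section \<open>The associated graded algebra in coordinates\<close>

lemma gpart_ext: "(\<And>n. gpart deg n h = gpart deg n h') \<Longrightarrow> h = h'"
proof (rule poly_mapping_eqI)
  fix i assume "\<And>n. gpart deg n h = gpart deg n h'"
  then have "lookup (gpart deg (deg i) h) i = lookup (gpart deg (deg i) h') i" by simp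
  then show "lookup h i = lookup h' i" by simp
qed

lemma gpart_gpart: "gpart deg m (gpart deg n h) = (if m = n then gpart deg n h else 0)"
  by (rule gpart_homogeneous[OF keys_gpart])

lemma fil_gpart: "fil deg n (gpart deg n h)"
  by (auto simp: fil_iff)

lemma gpart_mult:
  assumes "bilin m" and hom: "\<And>i j. keys (m (single i 1) (single j 1)) \<subseteq> {k. deg k = deg i + deg j}"
  shows "gpart deg n (m a b) = (\<Sum>i\<le>n. m (gpart deg i a) (gpart deg (n - i) b))"
proof (rule bilin_eqI[where B = "\<lambda>a b. gpart deg n (m a b)" and C = "\<lambda>a b. \<Sum>i\<le>n. m (gpart deg i a) (gpart deg (n - i) b)"])
  show "bilin (\<lambda>a b. gpart deg n (m a b))"
    by (rule bilinI[OF plin_comp[OF plin_gpart bilin_left] plin_comp[OF plin_gpart bilin_right]]) (rule assms)+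
  show "bilin (\<lambda>a b. \<Sum>i\<le>n. m (gpart deg i a) (gpart deg (n - i) b))"
    by (rule bilinI; rule plin_sumI)
      (rule plin_comp[OF bilin_left[OF assms(1)] plin_gpart] plin_comp[OF bilin_right[OF assms(1)] plin_gpart])+
  fix i j
  have 0: "m 0 b = 0" "m a 0 = 0" for a b
    using plin_0[OF bilin_left[OF assms(1)]] plin_0[OF bilin_right[OF assms(1)]] by auto
  have g: "gpart deg k (single i 1) = (if deg i = k then single i 1 else 0)" for i k
    by (simp add: gpart_def)
  have "(\<Sum>k\<le>n. m (gpart deg k (single i 1)) (gpart deg (n - k) (single j 1))) =
    (\<Sum>k\<le>n. if k = deg i then m (single i 1) (if deg j = n - k then single j 1 else 0) else 0)"
    by (rule sum.cong) (auto simp: g 0)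
  also have "\<dots> = (if deg i \<le> n \<and> deg j = n - deg i then m (single i 1) (single j 1) else 0)"
    by (simp add: 0)
  also have "\<dots> = gpart deg n (m (single i 1) (single j 1))"
    by (auto simp: gpart_homogeneous[OF hom])
  finally show "gpart deg n (m (single i 1) (single j 1)) = (\<Sum>k\<le>n. m (gpart deg k (single i 1)) (gpart deg (n - k) (single j 1)))" ..
qed

locale filtered_coords = coords D r
  for D :: "('k::field, 'a, 'm) module_scheme" (structure) and r :: "'a \<Rightarrow> ('i \<Rightarrow>\<^sub>0 'k)" +
  fixes deg :: "'i \<Rightarrow> nat" and f :: "nat \<Rightarrow> 'a set"
  assumes f: "f n = {x \<in> carrier D. fil deg n (r x)}"
begin

text \<open>The element of the associated graded algebra whose components have the homogeneous parts
  of \<open>h\<close> as leading parts. By \<open>carrier_gr\<close>, \<open>inj_G\<close>,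
  \<open>add_gr\<close> and \<open>smult_gr\<close> this is a linear isomorphism from the space of
  coordinates.\<close>

definition G :: "('i \<Rightarrow>\<^sub>0 'k) \<Rightarrow> nat \<Rightarrow> 'a set" where
  "G h n = {x \<in> f n. gpart deg n (r x) = gpart deg n h}"

abbreviation "N \<equiv> filt_pred D f"

lemma el_f [simp]: "el a \<in> f n \<longleftrightarrow> fil deg n a"
  by (simp add: f)

text \<open>The convention that step -1 of the filtration is zero fits in as well: a vector of
  degree at most 0 with vanishing part in degree 0 is zero.\<close>

lemma N_eq: "N n = {x \<in> f n. gpart deg n (r x) = 0}"
proof (cases n)
  case 0
  have "x = \<zero>" if x: "x \<in> carrier D" "fil deg 0 (r x)" "gpart deg 0 (r x) = 0" for x
  proof (rule r_eqI)
    show "r x = r \<zero>"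
    proof (rule poly_mapping_eqI)
      fix i
      show "lookup (r x) i = lookup (r \<zero>) i"
        using x(1,2) lookup_gpart[of deg 0 "r x" i] unfolding x(3) by (cases "deg i = 0") (simp_all add: fil_iff)
    qed
  qed (use x in auto)
  then show ?thesis by (auto simp: filt_pred_def 0 f plin_0)
next
  case (Suc m)
  have "fil deg m a \<longleftrightarrow> fil deg n a \<and> gpart deg n a = 0" for a :: "'i \<Rightarrow>\<^sub>0 'k"
  proof
    assume "fil deg m a"
    then show "fil deg n a \<and> gpart deg n a = 0"
      using gpart_fil[of deg m a n] fil_mono[of deg m a n] by (simp add: Suc)
  next
    assume a: "fil deg n a \<and> gpart deg n a = 0"
    show "fil deg m a"
      unfolding fil_iff
    proof (intro allI impI)
      fix i assume "m < deg i"
      then show "lookup a i = 0"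
        using a lookup_gpart[of deg n a i]
        by (cases "deg i = n") (auto simp: fil_iff Suc)
    qed
  qed
  then show ?thesis by (auto simp: filt_pred_def Suc f)
qed

lemma coset_eq:
  assumes x: "x \<in> f n"
  shows "N n +> x = {y \<in> f n. gpart deg n (r y) = gpart deg n (r x)}"
proof (intro equalityI subsetI)
  fix y assume "y \<in> N n +> x"
  then show "y \<in> {y \<in> f n. gpart deg n (r y) = gpart deg n (r x)}"
    using x by (auto simp: a_r_coset_def' N_eq f fil_add plin_add[OF plin_gpart])
next
  fix y assume y: "y \<in> {y \<in> f n. gpart deg n (r y) = gpart deg n (r x)}"
  then have "y \<ominus> x \<in> N n"
    using x by (simp add: N_eq f fil_diff plin_diff[OF plin_gpart])
  moreover have "y = (y \<ominus> x) \<oplus> x"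
    using x y by (intro r_eqI) (auto simp: f)
  ultimately show "y \<in> N n +> x" by (auto simp: a_r_coset_def')
qed

lemma coset_eq_G: "x \<in> f n \<Longrightarrow> N n +> x = G (r x) n"
  by (simp add: coset_eq G_def)

lemma el_gpart_G: "el (gpart deg n h) \<in> G h n"
  by (simp add: G_def fil_gpart gpart_gpart)

lemma G_eq_iff: "G h n = G h' n \<longleftrightarrow> gpart deg n h = gpart deg n h'"
proof
  assume "G h n = G h' n"
  with el_gpart_G[of n h] have "el (gpart deg n h) \<in> G h' n" by simp
  then show "gpart deg n h = gpart deg n h'" by (simp add: G_def gpart_gpart)
qed (simp add: G_def)

lemma G_eq_coset: "x \<in> G h n \<Longrightarrow> N n +> x = G h n"
  by (subst coset_eq_G) (auto simp: G_def)

lemma N_eq_G: "N n = G 0 n"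
  by (simp add: N_eq G_def plin_0)

lemma inj_G: "G h = G h' \<Longrightarrow> h = h'"
  by (rule gpart_ext[of deg]) (metis G_eq_iff)

lemma carrier_gr: "carrier (assoc_graded D f) = range G"
proof (intro equalityI subsetI)
  fix X assume "X \<in> range G"
  then obtain h where h: "X = G h" by auto
  have "\<exists>x\<in>f n. X n = N n +> x" for n
    using el_gpart_G[of n h] G_eq_coset[OF el_gpart_G[of n h]] by (auto simp: h G_def)
  moreover have "finite {n. X n \<noteq> N n}"
  proof (rule finite_subset)
    show "{n. X n \<noteq> N n} \<subseteq> deg ` keys h"
    proof
      fix n assume "n \<in> {n. X n \<noteq> N n}"
      then have "gpart deg n h \<noteq> 0" by (auto simp: h N_eq_G G_eq_iff plin_0)
      then obtain i where "lookup (gpart deg n h) i \<noteq> 0" by (metis lookup_zero poly_mapping_eqI)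
      then show "n \<in> deg ` keys h" by (auto simp: in_keys_iff split: if_splits)
    qed
  qed simp
  ultimately show "X \<in> carrier (assoc_graded D f)" by (simp add: assoc_graded_def Let_def)
next
  fix X assume X: "X \<in> carrier (assoc_graded D f)"
  then have "\<forall>n. \<exists>x. x \<in> f n \<and> X n = N n +> x" and fin: "finite {n. X n \<noteq> N n}"
    by (auto simp: assoc_graded_def Let_def)
  then obtain x where x: "\<And>n. x n \<in> f n" "\<And>n. X n = N n +> x n" by metis
  \<comment> \<open>The family has finite support, so the leading parts of its components can be
    collected in one vector.\<close>
  define h where "h = (\<Sum>n\<in>{n. X n \<noteq> N n}. gpart deg n (r (x n)))"
  have "gpart deg n h = gpart deg n (r (x n))" for n
  proof -
    have "gpart deg n h = (\<Sum>k\<in>{n. X n \<noteq> N n}. if k = n then gpart deg n (r (x n)) else 0)"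
      unfolding h_def plin_sum[OF plin_gpart] by (rule sum.cong) (auto simp: gpart_gpart)
    also have "\<dots> = (if X n \<noteq> N n then gpart deg n (r (x n)) else 0)"
      using fin by (simp add: sum.delta)
    also have "\<dots> = gpart deg n (r (x n))"
      using x(2)[of n] coset_eq_G[OF x(1)[of n]] by (auto simp: N_eq_G G_eq_iff plin_0)
    finally show ?thesis .
  qed
  then have "X n = G h n" for n
    using x(2)[of n] coset_eq_G[OF x(1)[of n]] by (simp add: G_eq_iff)
  then show "X \<in> range G" by auto
qed

lemma add_gr: "G h \<oplus>\<^bsub>assoc_graded D f\<^esub> G h' = G (h + h')"
proof
  fix n
  have "set_add D (G h n) (G h' n) = G (h + h') n"
  proof (intro equalityI subsetI)
    fix x assume "x \<in> set_add D (G h n) (G h' n)"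
    then show "x \<in> G (h + h') n"
      by (auto simp: set_add_def' G_def f fil_add plin_add[OF plin_gpart])
  next
    fix x assume x: "x \<in> G (h + h') n"
    let ?y = "el (gpart deg n h)"
    have "x \<ominus> ?y \<in> G h' n"
      using x by (simp add: G_def f fil_diff fil_gpart plin_diff[OF plin_gpart] plin_add[OF plin_gpart] gpart_gpart)
    moreover have "x = ?y \<oplus> (x \<ominus> ?y)"
      using x by (intro r_eqI) (auto simp: G_def f)
    ultimately show "x \<in> set_add D (G h n) (G h' n)"
      using el_gpart_G[of n h] by (auto simp: set_add_def')
  qed
  then show "(G h \<oplus>\<^bsub>assoc_graded D f\<^esub> G h') n = G (h + h') n"
    by (simp add: assoc_graded_def Let_def)
qed

lemma smult_gr: "c \<odot>\<^bsub>assoc_graded D f\<^esub> G h = G (pm_scale c h)"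
proof
  fix n
  have "N n +> (c \<odot> x) = G (pm_scale c h) n" if "x \<in> G h n" for x
    using that by (intro G_eq_coset) (simp add: G_def f fil_scale plin_scale[OF plin_gpart])
  then have "(\<Union>x\<in>G h n. N n +> (c \<odot> x)) = G (pm_scale c h) n"
    using el_gpart_G[of n h] by blast
  then show "(c \<odot>\<^bsub>assoc_graded D f\<^esub> G h) n = G (pm_scale c h) n"
    by (simp add: assoc_graded_def Let_def)
qed

lemma hcomp_gr: "hcomp (assoc_graded D f) n = G ` {h. keys h \<subseteq> {i. deg i = n}}"
proof -
  have hc: "hcomp (assoc_graded D f) n = {X \<in> range G. \<forall>m. m \<noteq> n \<longrightarrow> X m = N m}"
    unfolding carrier_gr[symmetric] by (simp add: assoc_graded_def Let_def)
  have "(\<forall>m. m \<noteq> n \<longrightarrow> G h m = N m) \<longleftrightarrow> keys h \<subseteq> {i. deg i = n}" for h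
  proof
    assume a: "\<forall>m. m \<noteq> n \<longrightarrow> G h m = N m"
    show "keys h \<subseteq> {i. deg i = n}"
    proof
      fix i assume i: "i \<in> keys h"
      then have "gpart deg (deg i) h \<noteq> 0"
        by (metis in_keys_iff lookup_gpart lookup_zero)
      then show "i \<in> {i. deg i = n}" using a by (auto simp: N_eq_G G_eq_iff plin_0)
    qed
  qed (simp add: N_eq_G G_eq_iff plin_0 gpart_homogeneous)
  then show ?thesis unfolding hc by auto
qed

end

text \<open>The product \<open>m'\<close> of the filtered algebra enters only through its leading
  part, and \<open>top\<close> says that this is the graded product \<open>m\<close>. The
  isomorphism sends \<open>G h\<close> to the element of \<open>T\<close> with coordinates
  \<open>h\<close>.\<close>

lemma assoc_graded_isomorphic:
  assumes D: "filtered_coords D rD deg f" and T: "galg T rT m e deg"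
    and mult: "\<And>x y. x \<in> carrier D \<Longrightarrow> y \<in> carrier D \<Longrightarrow> x \<otimes>\<^bsub>D\<^esub> y \<in> carrier D \<and> rD (x \<otimes>\<^bsub>D\<^esub> y) = m' (rD x) (rD y)"
    and one: "\<one>\<^bsub>D\<^esub> \<in> carrier D" "rD \<one>\<^bsub>D\<^esub> = e" "fil deg 0 e"
    and top: "\<And>k n a b. fil deg k a \<Longrightarrow> fil deg n b \<Longrightarrow>
      fil deg (k + n) (m' a b) \<and> gpart deg (k + n) (m' a b) = m (gpart deg k a) (gpart deg n b)"
    and hom: "\<And>i j. keys (m (single i 1) (single j 1)) \<subseteq> {k. deg k = deg i + deg j}"
  shows "graded_isomorphic (assoc_graded D f) T"
proof -
  interpret D: filtered_coords D rD deg f by fact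
  interpret T: galg T rT m e deg by fact
  let ?A = "assoc_graded D f"
  have mult_gr: "D.G h \<otimes>\<^bsub>?A\<^esub> D.G h' = D.G (m h h')" for h h'
  proof
    fix n
    \<comment> \<open>Every choice of representatives gives the same coset, so the union in the
      definition of the product ranges over a single set.\<close>
    have *: "D.N n +>\<^bsub>D\<^esub> (\<Oplus>\<^bsub>D\<^esub>i\<in>{..n}. x i \<otimes>\<^bsub>D\<^esub> y (n - i)) = D.G (m h h') n"
      if xy: "\<forall>i\<le>n. x i \<in> D.G h i \<and> y i \<in> D.G h' i" for x y
    proof (rule D.G_eq_coset)
      have cl: "(\<lambda>i. x i \<otimes>\<^bsub>D\<^esub> y (n - i)) \<in> {..n} \<rightarrow> carrier D"
        using xy mult by (auto simp: D.G_def D.f)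
      have r: "rD (\<Oplus>\<^bsub>D\<^esub>i\<in>{..n}. x i \<otimes>\<^bsub>D\<^esub> y (n - i)) = (\<Sum>i\<le>n. m' (rD (x i)) (rD (y (n - i))))"
        using xy mult by (subst D.r_finsum[OF _ cl]) (auto simp: D.G_def D.f)
      have t: "fil deg n (m' (rD (x i)) (rD (y (n - i)))) \<and>
        gpart deg n (m' (rD (x i)) (rD (y (n - i)))) = m (gpart deg i h) (gpart deg (n - i) h')" if "i \<le> n" for i
        using top[of i "rD (x i)" "n - i" "rD (y (n - i))"] xy that by (auto simp: D.G_def D.f)
      show "(\<Oplus>\<^bsub>D\<^esub>i\<in>{..n}. x i \<otimes>\<^bsub>D\<^esub> y (n - i)) \<in> D.G (m h h') n"
        using t D.finsum_closed[OF cl]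
        by (auto simp: D.G_def D.f r plin_sum[OF plin_gpart] gpart_mult[OF T.bilin_m hom] intro!: fil_sum sum.cong)
    qed
    have "(\<Union>{D.N n +>\<^bsub>D\<^esub> (\<Oplus>\<^bsub>D\<^esub>i\<in>{..n}. x i \<otimes>\<^bsub>D\<^esub> y (n - i)) | x y. \<forall>i\<le>n. x i \<in> D.G h i \<and> y i \<in> D.G h' i}) = D.G (m h h') n"
      (is "\<Union>?S = _")
    proof -
      have "?S \<subseteq> {D.G (m h h') n}" using * by blast
      moreover have "D.G (m h h') n \<in> ?S"
      proof -
        \<comment> \<open>Representatives exist in every degree, so that union is not empty.\<close>
        have w: "\<forall>i\<le>n. D.el (gpart deg i h) \<in> D.G h i \<and> D.el (gpart deg i h') \<in> D.G h' i"
          by (simp add: D.el_gpart_G)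
        show ?thesis
          by (rule CollectI, intro exI conjI, rule *[OF w, symmetric], rule w)
      qed
      ultimately have "?S = {D.G (m h h') n}" by blast
      then show ?thesis by simp
    qed
    then show "(D.G h \<otimes>\<^bsub>?A\<^esub> D.G h') n = D.G (m h h') n"
      by (simp add: assoc_graded_def Let_def)
  qed
  have one_gr: "\<one>\<^bsub>?A\<^esub> = D.G e"
  proof
    fix n
    have "D.N 0 +>\<^bsub>D\<^esub> \<one>\<^bsub>D\<^esub> = D.G e 0" using one by (subst D.coset_eq_G) (auto simp: D.f)
    moreover have "D.N n = D.G e n" if "n \<noteq> 0"
      using gpart_fil[OF one(3), of n] that by (simp add: D.N_eq_G D.G_eq_iff plin_0)
    ultimately show "\<one>\<^bsub>?A\<^esub> n = D.G e n" by (simp add: assoc_graded_def Let_def)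
  qed
  define \<phi> where "\<phi> X = T.el (inv_into UNIV D.G X)" for X
  have \<phi>: "\<phi> (D.G h) = T.el h" for h
    unfolding \<phi>_def using D.inj_G by (simp add: inv_f_f inj_def)
  have "\<phi> \<in> alg_iso ?A T"
    unfolding alg_iso_def ring_iso_def ring_hom_def
  proof (intro CollectI conjI ballI allI)
    show "bij_betw \<phi> (carrier ?A) (carrier T)"
      unfolding D.carrier_gr
    proof (rule bij_betwI')
      show "\<exists>X\<in>range D.G. y = \<phi> X" if "y \<in> carrier T" for y
        using that by (intro bexI[of _ "D.G (rT y)"]) (simp_all add: \<phi>)
    next
      fix X Y assume "X \<in> range D.G" "Y \<in> range D.G"
      then show "\<phi> X = \<phi> Y \<longleftrightarrow> X = Y" by (auto simp: \<phi>) (metis T.r_el)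
    qed (auto simp: \<phi>)
  qed (auto simp: D.carrier_gr \<phi> mult_gr one_gr D.add_gr D.smult_gr intro!: T.r_eqI)
  moreover have "\<phi> ` hcomp ?A n = hcomp T n" for n
  proof (intro equalityI subsetI)
    fix x assume "x \<in> hcomp T n"
    then have "x = \<phi> (D.G (rT x))" "keys (rT x) \<subseteq> {i. deg i = n}"
      by (simp_all add: \<phi> T.hcomp_eq)
    then show "x \<in> \<phi> ` hcomp ?A n" unfolding D.hcomp_gr by blast
  qed (auto simp: D.hcomp_gr T.hcomp_eq \<phi>)
  ultimately show ?thesis unfolding graded_isomorphic_def by blast
qed

lemma two_nonzero: "odd CHAR('k::field) \<Longrightarrow> (2 :: 'k) \<noteq> 0"
proof
  assume "odd CHAR('k)" "(2 :: 'k) = 0"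
  then have "CHAR('k) dvd 2" using of_nat_eq_0_iff_char_dvd[of 2, where 'a = 'k] by simp
  then have "CHAR('k) \<le> 2" "CHAR('k) \<noteq> 0"
    by (auto dest: dvd_imp_le intro!: Nat.gr0I)
  then have "CHAR('k) = 1 \<or> CHAR('k) = 2" by linarith
  with \<open>odd CHAR('k)\<close> show False using CHAR_not_1 by auto
qed

section \<open>The braided double\<close>

lemma keys_bml: "keys (bml (single i 1) (single j (1 :: 'a::field))) \<subseteq> {k. ddeg k = ddeg i + ddeg j}"
proof -
  obtain p q p' q' where ij: "i = (p, q)" "j = (p', q')" by (metis surj_pair)
  have "keys (tens (jml 1 (single p 1) (single p' 1)) (jml (- 1) (single q 1) (single q' (1 :: 'a)))) \<subseteq> {k. ddeg k = ddeg i + ddeg j}"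
    using keys_tens keys_jml[of 1 p p'] keys_jml[of "- 1" q q'] by (fastforce simp: ij)
  moreover have "bml (single i 1) (single j 1) = pm_scale ((- 1) ^ (jdeg q * jdeg p'))
      (tens (jml 1 (single p 1) (single p' 1)) (jml (- 1) (single q 1) (single q' (1 :: 'a))))"
    by (simp add: bml_eq ij)
  ultimately show ?thesis
    by (simp only: order_trans[OF keys_pm_scale])
qed

lemma keys_dml: "keys (dml 0 0 0 (single i 1) (single j (1 :: 'a::field))) \<subseteq> {k. mdeg k = mdeg i + mdeg j}"
proof -
  obtain z e z' e' where ij: "i = (z, e)" "j = (z', e')" by (metis surj_pair)
  have "keys (tens (bml (single z 1) (single z' 1)) (single (e + e') (1 :: 'a))) \<subseteq> {k. mdeg k = mdeg i + mdeg j}"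
    using keys_tens keys_bml[of z z'] by (fastforce simp: ij)
  moreover have "dml 0 0 0 (single i 1) (single j 1) = pm_scale (bsg e (ddeg z'))
      (tens (bml (single z 1) (single z' 1)) (single (e + e') (1 :: 'a)))"
    by (simp add: dml_eq ij)
  ultimately show ?thesis
    by (simp only: order_trans[OF keys_pm_scale])
qed

text \<open>The coordinate map comes out of existential statements, so the coordinates of the four
  generators have to be recorded along with it.\<close>

lemma malg_double:
  assumes two: "(2 :: 'k::field) \<noteq> 0"
  shows "\<exists>r. malg (jordan_double :: ('k, _, _) graded_modalg) r bml (single ((0, 0), (0, 0)) 1) ddeg \<and>
    pure jordan jordan_op (jordan_el Ju) \<one>\<^bsub>jordan_op\<^esub> \<in> carrier (jordan_double :: ('k, _, _) graded_modalg) \<and>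
    r (pure jordan jordan_op (jordan_el Ju) \<one>\<^bsub>jordan_op\<^esub>) = bas ((0, 1), (0, 0)) \<and>
    pure jordan jordan_op (jordan_el Jv) \<one>\<^bsub>jordan_op\<^esub> \<in> carrier (jordan_double :: ('k, _, _) graded_modalg) \<and>
    r (pure jordan jordan_op (jordan_el Jv) \<one>\<^bsub>jordan_op\<^esub>) = bas ((1, 0), (0, 0)) \<and>
    pure jordan jordan_op \<one>\<^bsub>jordan\<^esub> (jordan_el Ju) \<in> carrier (jordan_double :: ('k, _, _) graded_modalg) \<and>
    r (pure jordan jordan_op \<one>\<^bsub>jordan\<^esub> (jordan_el Ju)) = bas ((0, 0), (0, 1)) \<and>
    pure jordan jordan_op \<one>\<^bsub>jordan\<^esub> (jordan_el Jv) \<in> carrier (jordan_double :: ('k, _, _) graded_modalg) \<and>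
    r (pure jordan jordan_op \<one>\<^bsub>jordan\<^esub> (jordan_el Jv)) = bas ((0, 0), (1, 0))"
proof -
  obtain r where r: "malg (jordan :: ('k, _, _) graded_modalg) r (jml 1) (single (0, 0) 1) jdeg"
     "r (jordan_el Ju) = single (0, 1) 1" "r (jordan_el Jv) = single (1, 0) 1"
     "\<And>x. jordan_el x \<in> carrier (jordan :: ('k, _, _) graded_modalg)"
    using malg_jordan by blast
  obtain s where s: "malg (jordan_op :: ('k, _, _) graded_modalg) s (jml (- 1)) (single (0, 0) 1) jdeg"
     "s (jordan_el Ju) = single (0, 1) 1" "s (jordan_el Jv) = single (1, 0) 1"
     "\<And>x. jordan_el x \<in> carrier (jordan_op :: ('k, _, _) graded_modalg)"
    using malg_jordan_op[OF two] by blast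
  interpret A: malg "jordan :: ('k, _, _) graded_modalg" r "jml 1" "single (0, 0) 1" jdeg by fact
  interpret B: malg "jordan_op :: ('k, _, _) graded_modalg" s "jml (- 1)" "single (0, 0) 1" jdeg by fact
  interpret T: tensor_coords "jordan :: ('k, _, _) graded_modalg" r jordan_op s ..
  have "malg (jordan_double :: ('k, _, _) graded_modalg) (tco r s) bml (single ((0, 0), (0, 0)) 1) ddeg"
    using braided_tensor_malg[OF r(1) s(1) two]
    unfolding jordan_double_def bml_eq[symmetric] ddeg_def[symmetric] by simp
  moreover have "carrier (jordan_double :: ('k, _, _) graded_modalg) = carrier (tensor jordan jordan_op)"
    by (simp add: jordan_double_def braided_tensor_def Let_def)
  ultimately show ?thesis
    by (intro exI[of _ "tco r s"]) (simp add: r s bas_def)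
qed

lemma alg_iso_coords:
  assumes "coords M r" "coords T rT"
    and M: "\<And>x y. x \<in> carrier M \<Longrightarrow> y \<in> carrier M \<Longrightarrow> x \<otimes>\<^bsub>M\<^esub> y \<in> carrier M \<and> r (x \<otimes>\<^bsub>M\<^esub> y) = m (r x) (r y)"
      "\<one>\<^bsub>M\<^esub> \<in> carrier M" "r \<one>\<^bsub>M\<^esub> = e"
    and T: "\<And>x y. x \<in> carrier T \<Longrightarrow> y \<in> carrier T \<Longrightarrow> x \<otimes>\<^bsub>T\<^esub> y \<in> carrier T \<and> rT (x \<otimes>\<^bsub>T\<^esub> y) = m (rT x) (rT y)"
      "\<one>\<^bsub>T\<^esub> \<in> carrier T" "rT \<one>\<^bsub>T\<^esub> = e"
  shows "(\<lambda>x. coords.el T rT (r x)) \<in> alg_iso M T"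
proof -
  interpret M: coords M r by fact
  interpret T: coords T rT by fact
  show ?thesis
    unfolding alg_iso_def ring_iso_def ring_hom_def
  proof (intro CollectI conjI ballI allI)
    show "bij_betw (\<lambda>x. T.el (r x)) (carrier M) (carrier T)"
    proof (rule bij_betwI')
      fix y assume "y \<in> carrier T"
      then show "\<exists>x\<in>carrier M. y = T.el (r x)"
        by (intro bexI[of _ "M.el (rT y)"]) simp_all
    next
      fix x y assume "x \<in> carrier M" "y \<in> carrier M"
      then show "T.el (r x) = T.el (r y) \<longleftrightarrow> x = y" by (metis M.r_eqI T.r_el)
    qed auto
  qed (use M T in \<open>auto intro!: T.r_eqI\<close>)
qed

text \<open>Both algebras have the product \<open>bml\<close> in coordinates, the quotient by its
  normal form and the double by \<open>bml_eq\<close>; the coordinates of the generators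
  agree.\<close>

lemma double_presentation:
  assumes two: "(2 :: 'k::field) \<noteq> 0"
  shows "\<exists>\<phi> \<in> alg_iso (quot_alg free_modalg rel_ideal) (jordan_double :: ('k, _, _) graded_modalg).
        \<phi> (rel_ideal +>\<^bsub>free_modalg\<^esub> gen Gu) = pure jordan jordan_op (jordan_el Ju) \<one>\<^bsub>jordan_op\<^esub> \<and>
        \<phi> (rel_ideal +>\<^bsub>free_modalg\<^esub> gen Gv) = pure jordan jordan_op (jordan_el Jv) \<one>\<^bsub>jordan_op\<^esub> \<and>
        \<phi> (rel_ideal +>\<^bsub>free_modalg\<^esub> gen Gu') = pure jordan jordan_op \<one>\<^bsub>jordan\<^esub> (jordan_el Ju) \<and>
        \<phi> (rel_ideal +>\<^bsub>free_modalg\<^esub> gen Gv') = pure jordan jordan_op \<one>\<^bsub>jordan\<^esub> (jordan_el Jv)"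
proof -
  obtain r where r: "malg (jordan_double :: ('k, _, _) graded_modalg) r bml (single ((0, 0), (0, 0)) 1) ddeg"
    "pure jordan jordan_op (jordan_el Ju) \<one>\<^bsub>jordan_op\<^esub> \<in> carrier (jordan_double :: ('k, _, _) graded_modalg)"
    "r (pure jordan jordan_op (jordan_el Ju) \<one>\<^bsub>jordan_op\<^esub>) = bas ((0, 1), (0, 0))"
    "pure jordan jordan_op (jordan_el Jv) \<one>\<^bsub>jordan_op\<^esub> \<in> carrier (jordan_double :: ('k, _, _) graded_modalg)"
    "r (pure jordan jordan_op (jordan_el Jv) \<one>\<^bsub>jordan_op\<^esub>) = bas ((1, 0), (0, 0))"
    "pure jordan jordan_op \<one>\<^bsub>jordan\<^esub> (jordan_el Ju) \<in> carrier (jordan_double :: ('k, _, _) graded_modalg)"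
    "r (pure jordan jordan_op \<one>\<^bsub>jordan\<^esub> (jordan_el Ju)) = bas ((0, 0), (0, 1))"
    "pure jordan jordan_op \<one>\<^bsub>jordan\<^esub> (jordan_el Jv) \<in> carrier (jordan_double :: ('k, _, _) graded_modalg)"
    "r (pure jordan jordan_op \<one>\<^bsub>jordan\<^esub> (jordan_el Jv)) = bas ((0, 0), (1, 0))"
    using malg_double[OF two] by blast
  interpret T: malg "jordan_double :: ('k, _, _) graded_modalg" r bml "single ((0, 0), (0, 0)) 1" ddeg by (rule r(1))
  interpret B: normal_form "\<lambda>x. lin (Bb (0 :: 'k) 0 x)" Bwd "((0, 0), (0, 0))" rel_ideal
    by (rule double_normal_form)
  let ?F = "free_modalg :: ('k, 'k free4, bit \<Rightarrow>\<^sub>0 'k) graded_modalg"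
  interpret F: ring ?F by (rule ring_free_modalg)
  interpret Q: lin_quot ?F B.eps rel_ideal
    by unfold_locales (auto simp: B.surj_eps plin_add[OF B.plin_eps] plin_scale[OF B.plin_eps] B.J_eq)
  have mult: "X \<otimes>\<^bsub>quot_alg ?F rel_ideal\<^esub> Y \<in> carrier (quot_alg ?F rel_ideal) \<and>
      Q.rq (X \<otimes>\<^bsub>quot_alg ?F rel_ideal\<^esub> Y) = bml (Q.rq X) (Q.rq Y)"
    if XY: "X \<in> carrier (quot_alg ?F rel_ideal)" "Y \<in> carrier (quot_alg ?F rel_ideal)" for X Y
  proof -
    obtain x y where "X = rel_ideal +>\<^bsub>?F\<^esub> x" "Y = rel_ideal +>\<^bsub>?F\<^esub> y"
      using XY by (auto simp: Q.carrier_quot)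
    then show ?thesis
      using Q.coset_mult[of x y bml] by (simp add: B.eps_mult)
  qed
  have one: "\<one>\<^bsub>quot_alg ?F rel_ideal\<^esub> \<in> carrier (quot_alg ?F rel_ideal)"
    "Q.rq \<one>\<^bsub>quot_alg ?F rel_ideal\<^esub> = single ((0, 0), (0, 0)) 1"
    by (simp_all flip: Q.coset_one)
  have iso: "(\<lambda>x. T.el (Q.rq x)) \<in> alg_iso (quot_alg ?F rel_ideal) (jordan_double :: ('k, _, _) graded_modalg)"
    by (rule alg_iso_coords[OF Q.q.coords_axioms T.coords_axioms mult one]) auto
  have g: "T.el (Q.rq (rel_ideal +>\<^bsub>?F\<^esub> gen x)) = y"
    if "y \<in> carrier (jordan_double :: ('k, _, _) graded_modalg)" "r y = Bb 0 0 x ((0, 0), (0, 0))" for x y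
    using that by (intro T.el_eqI) simp_all
  show ?thesis
    by (rule bexI[OF _ iso]) (intro conjI; rule g; simp add: r[simplified])
qed

section \<open>The smash product with the free algebra\<close>

definition fm :: "(double_gen list \<times> bit \<Rightarrow>\<^sub>0 'k::field) \<Rightarrow> (double_gen list \<times> bit \<Rightarrow>\<^sub>0 'k) \<Rightarrow> (double_gen list \<times> bit \<Rightarrow>\<^sub>0 'k)" where
  "fm = bext (\<lambda>(w, h) (w', h'). single (w @ w', h + h') (bsg h (length w')))"

abbreviation rF :: "('k::field, 'k free4, bit \<Rightarrow>\<^sub>0 'k) tens \<Rightarrow> (double_gen list \<times> bit \<Rightarrow>\<^sub>0 'k)" where
  "rF \<equiv> tco (\<lambda>p. p) (\<lambda>h. h)"

lemma bilin_fm [simp, intro]: "bilin fm"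
  by (simp add: fm_def)

lemma fm_single [simp]: "fm (single (w, h) c) (single (w', h') d) = single (w @ w', h + h') (c * d * bsg h (length w'))"
  by (simp add: fm_def)

lemma galg_free4: "galg (free4_smash :: ('k::field, _) graded_alg) rF fm (single ([], 0) 1) (\<lambda>z. length (fst z))"
proof -
  have "single [] 1 = (1 :: 'k free4)" "single 0 1 = (1 :: bit \<Rightarrow>\<^sub>0 'k)" by simp_all
  then have "tens 1 1 = single ([] :: double_gen list, 0 :: bit) (1 :: 'k)"
    by (metis tens_single mult_1)
  then show ?thesis
    using smash_galg[OF malg_free[where 'k = 'k and 'x = double_gen]]
    by (simp add: free4_smash_def fm_def mult_single plus_list_def case_prod_beta')
qed

lemma fm_assoc: "fm (fm x y) z = fm x (fm y z)"
proof (rule bilin_eqI[where B = "\<lambda>x y. fm (fm x y) z" and C = "\<lambda>x y. fm x (fm y z)"])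
  note l = bilin_left[OF bilin_fm] and r = bilin_right[OF bilin_fm]
  show "bilin (\<lambda>x y. fm (fm x y) z)"
    by (rule bilinI[OF plin_comp[OF l l] plin_comp[OF l r]])
  show "bilin (\<lambda>x y. fm x (fm y z))"
    by (rule bilinI[OF l plin_comp[OF r l]])
  fix i j :: "double_gen list \<times> bit"
  show "fm (fm (single i 1) (single j 1)) z = fm (single i 1) (fm (single j 1) z)"
  proof (rule plin_eqI[OF r plin_comp[OF r r]])
    fix k :: "double_gen list \<times> bit"
    obtain w h w' h' w'' h'' where "i = (w, h)" "j = (w', h')" "k = (w'', h'')" by (metis surj_pair)
    then show "fm (fm (single i 1) (single j 1)) (single k 1) = fm (single i 1) (fm (single j 1) (single k 1))"
      by (cases h; cases h') (simp_all add: bsg_add power_add add.assoc mult.left_commute mult.commute)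
  qed
qed

lemma fm_one: "fm (single ([], 0) 1) x = x" "fm x (single ([], 0) 1) = x"
proof -
  show "fm (single ([], 0) 1) x = x"
    by (rule plin_eqI[OF bilin_right[OF bilin_fm] plin_id]) auto
  show "fm x (single ([], 0) 1) = x"
    by (rule plin_eqI[OF bilin_left[OF bilin_fm] plin_id]) auto
qed

definition mideal :: "(('i \<Rightarrow>\<^sub>0 'k::field) \<Rightarrow> ('i \<Rightarrow>\<^sub>0 'k) \<Rightarrow> ('i \<Rightarrow>\<^sub>0 'k)) \<Rightarrow> ('i \<Rightarrow>\<^sub>0 'k) set \<Rightarrow> bool" where
  "mideal m K \<longleftrightarrow> 0 \<in> K \<and> (\<forall>x\<in>K. \<forall>y\<in>K. x + y \<in> K) \<and> (\<forall>x\<in>K. \<forall>y. m y x \<in> K \<and> m x y \<in> K)"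

lemma (in galg) ring_galg:
  assumes "\<And>x y z. m (m x y) z = m x (m y z)" "\<And>x. m e x = x" "\<And>x. m x e = x"
  shows "ring A"
proof (rule ringI[OF abelian_group])
  show "monoid A"
    by (rule monoidI) (auto intro!: r_eqI simp: assms)
qed (auto intro!: r_eqI simp: plin_add[OF bilin_left[OF bilin_m]] plin_add[OF bilin_right[OF bilin_m]])

text \<open>Allows an ideal generated in the record to be treated as a set of coordinate vectors.
  The ring laws behind \<open>Idl\<close> are pulled back from \<open>m\<close>.\<close>

lemma (in galg) mideal_Idl:
  assumes assoc: "\<And>x y z. m (m x y) z = m x (m y z)" and unit: "\<And>x. m e x = x" "\<And>x. m x e = x"
    and S: "S \<subseteq> carrier A"
  shows "mideal m (r ` (Idl\<^bsub>A\<^esub> S))" and "r ` S \<subseteq> r ` (Idl\<^bsub>A\<^esub> S)" and "Idl\<^bsub>A\<^esub> S \<subseteq> carrier A"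
    and "\<And>K. mideal m K \<Longrightarrow> r ` S \<subseteq> K \<Longrightarrow> r ` (Idl\<^bsub>A\<^esub> S) \<subseteq> K"
proof -
  have R: "ring A" by (rule ring_galg) (simp_all add: assoc unit)
  interpret R: ring A by (rule R)
  interpret I: ideal "Idl\<^bsub>A\<^esub> S" A by (rule R.genideal_ideal[OF S])
  show sub: "Idl\<^bsub>A\<^esub> S \<subseteq> carrier A" by (rule I.a_subset)
  show "r ` S \<subseteq> r ` (Idl\<^bsub>A\<^esub> S)" using R.genideal_self[OF S] by blast
  show "mideal m (r ` (Idl\<^bsub>A\<^esub> S))"
    unfolding mideal_def
  proof (intro conjI ballI allI)
    show "0 \<in> r ` (Idl\<^bsub>A\<^esub> S)"
      using additive_subgroup.zero_closed[OF I.additive_subgroup_axioms] by (metis image_eqI r_zero)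
    fix x assume "x \<in> r ` (Idl\<^bsub>A\<^esub> S)"
    then obtain a where a: "x = r a" "a \<in> Idl\<^bsub>A\<^esub> S" by auto
    note ac = subsetD[OF sub a(2)]
    { fix y assume "y \<in> r ` (Idl\<^bsub>A\<^esub> S)"
      then obtain b where b: "y = r b" "b \<in> Idl\<^bsub>A\<^esub> S" by auto
      have "x + y = r (a \<oplus> b)" using ac subsetD[OF sub b(2)] by (simp add: a b)
      then show "x + y \<in> r ` (Idl\<^bsub>A\<^esub> S)"
        using additive_subgroup.a_closed[OF I.additive_subgroup_axioms a(2) b(2)] by blast }
    fix y
    have "m y x = r (el y \<otimes> a)" "m x y = r (a \<otimes> el y)" using ac by (simp_all add: a)
    then show "m y x \<in> r ` (Idl\<^bsub>A\<^esub> S)" "m x y \<in> r ` (Idl\<^bsub>A\<^esub> S)"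
      using I.I_l_closed[OF a(2), of "el y"] I.I_r_closed[OF a(2), of "el y"] by auto
  qed
  fix K assume K: "mideal m K" and SK: "r ` S \<subseteq> K"
  have neg: "- x \<in> K" if "x \<in> K" for x
  proof -
    have "m (- e) x = - x" using plin_uminus[OF bilin_left[OF bilin_m], of e x] by (simp add: unit)
    with K that show ?thesis unfolding mideal_def by metis
  qed
  have "ideal {x \<in> carrier A. r x \<in> K} A"
  proof (rule idealI[OF R], rule add.subgroupI)
    show "{x \<in> carrier A. r x \<in> K} \<noteq> {}"
      using K r_zero zero_closed unfolding mideal_def by (metis (mono_tags, lifting) empty_iff mem_Collect_eq)
  qed (use K neg in \<open>auto simp: mideal_def\<close>)
  from R.genideal_minimal[OF this] show "r ` (Idl\<^bsub>A\<^esub> S) \<subseteq> K"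
    using S SK by blast
qed

section \<open>The deformation ideal\<close>

definition gw :: "bit \<Rightarrow> double_gen option list" where
  "gw e = (if e = 0 then [] else [None])"

text \<open>Spells an element of the smash product as words in five letters with g at the end. The
  map is multiplicative only modulo the relations in \<open>gset\<close>.\<close>

definition lift :: "(double_gen list \<times> bit \<Rightarrow>\<^sub>0 'k::field) \<Rightarrow> (double_gen option list \<Rightarrow>\<^sub>0 'k)" where
  "lift = lin (\<lambda>(w, e). single (map Some w @ gw e) 1)"

definition emb :: "'k::field free4 \<Rightarrow> (double_gen option list \<Rightarrow>\<^sub>0 'k)" where
  "emb = lin (\<lambda>w. single (map Some w) 1)"

definition gset :: "(double_gen option list \<Rightarrow>\<^sub>0 'k::field) set" where
  "gset = insert (gen None * gen None - 1) ((\<lambda>x. gen None * gen (Some x) + gen (Some x) * gen None) ` {Gu, Gv, Gu', Gv'})"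

lemma plin_lift: "plin lift" and plin_emb: "plin emb"
  by (simp_all add: lift_def emb_def)

lemma single_gw: "single (gw e) 1 = ge e"
  by (simp add: gw_def ge_def gen_def)

lemma lift_single: "lift (single (w, e) c) = pm_scale c (single (map Some w) 1 * ge e)"
  by (simp add: lift_def single_append single_gw)

lemma emb_gen [simp]: "emb (gen x) = gen (Some x)"
  by (simp add: emb_def gen_def)

lemma emb_1 [simp]: "emb 1 = 1"
proof -
  have "emb (single [] 1) = 1" unfolding emb_def by (simp del: single_Nil)  simp
  then show ?thesis by simp
qed

lemma emb_mult: "emb (p * q) = emb p * emb q"
proof (rule bilin_eqI[where B = "\<lambda>p q. emb (p * q)" and C = "\<lambda>p q. emb p * emb q"])
  show "bilin (\<lambda>p q. emb (p * q))"
    unfolding emb_def by (rule bilin_lin[OF bilin_times])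
  show "bilin (\<lambda>p q. emb p * emb q)"
    by (rule bilin_comp2[OF bilin_times plin_emb plin_emb])
qed (simp add: emb_def mult_single plus_list_def)

lemma lift_tens: "lift (tens p h) = emb p * lin ge h"
proof (rule bilin_eqI[where B = "\<lambda>p h. lift (tens p h)" and C = "\<lambda>p h. emb p * lin ge h"])
  show "bilin (\<lambda>p h. lift (tens p h))"
    unfolding lift_def by (rule bilin_lin[OF bilin_tens])
  show "bilin (\<lambda>p h. emb p * lin ge h)"
    by (rule bilin_comp2[OF bilin_times plin_emb plin_lin])
qed (simp add: lift_single emb_def)

lemma lin_ge: "lin ge h = pm_scale (lookup h 0) 1 + pm_scale (lookup h 1) (gen None)"
proof (rule plin_eqI[where g = "\<lambda>h. pm_scale (lookup h 0) 1 + pm_scale (lookup h 1) (gen None)"])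
  show "plin (\<lambda>h. pm_scale (lookup h 0) 1 + pm_scale (lookup h 1) (gen None :: double_gen option list \<Rightarrow>\<^sub>0 'a))"
    by (rule plinI) (simp_all add: lookup_add pm_scale_add_left pm_scale_add)
  show "lin ge (single e 1) = pm_scale (lookup (single e 1) 0) 1 + pm_scale (lookup (single e 1) 1) (gen None)" for e
    by (cases e) (simp_all add: ge_def lookup_single del: single_one)
qed simp

lemma bilin_mem:
  assumes "bilin B" and J: "\<And>x y. x \<in> J \<Longrightarrow> y \<in> J \<Longrightarrow> x + y \<in> J" "\<And>c x. x \<in> J \<Longrightarrow> pm_scale c x \<in> J" "0 \<in> J"
    and b: "\<And>i j. B (single i 1) (single j 1) \<in> J"
  shows "B x y \<in> J"
proof -
  note l = bilin_left[OF assms(1)] and r = bilin_right[OF assms(1)]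
  have s: "single i c = pm_scale c (single i 1)" for i c by simp
  have 1: "B (single i 1) y \<in> J" for i
  proof (induction y rule: pm_induct)
    case (step j c y)
    have "B (single i 1) (single j c) \<in> J"
      using J(2)[OF b[of i j], of c] plin_scale[OF r, of "single i 1" c "single j 1"] by simp
    with step show ?case by (simp add: plin_add[OF r] J(1))
  qed (simp add: plin_0[OF r] J)
  show ?thesis
  proof (induction x rule: pm_induct)
    case (step i c x)
    have "B (single i c) y \<in> J"
      using J(2)[OF 1[of i], of c] plin_scale[OF l, of c "single i 1" y] by simp
    with step show ?case by (simp add: plin_add[OF l] J(1))
  qed (simp add: plin_0[OF l] J)
qed

lemma bilin_minus: "bilin B \<Longrightarrow> bilin C \<Longrightarrow> bilin (\<lambda>x y. B x y - C x y)"
  by (rule bilinI[OF plin_minus[OF bilin_left bilin_left] plin_minus[OF bilin_right bilin_right]])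

text \<open>On monomials the g after the first word is carried across the second word letter by
  letter, which produces the sign in \<open>fm\<close>; then the two powers of g merge.\<close>

lemma lift_mult:
  assumes J: "two_sided J" and g: "gset \<subseteq> J"
  shows "cong J (lift x * lift y) (lift (fm x y))"
  unfolding cong_def
proof (rule bilin_mem[where B = "\<lambda>x y. lift x * lift y - lift (fm x y)"])
  show "bilin (\<lambda>x y. lift x * lift y - lift (fm x y))"
    using bilin_comp2[OF bilin_times plin_lift plin_lift] bilin_lin[OF bilin_fm]
    unfolding lift_def by (rule bilin_minus)
  fix i j :: "double_gen list \<times> bit"
  obtain w e w' e' where ij: "i = (w, e)" "j = (w', e')" by (metis surj_pair)
  have gx: "cong J (gen None * gen (Some x)) (- (gen (Some x) * gen None))" for x
  proof -
    have "gen None * gen (Some x) + gen (Some x) * gen None \<in> gset"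
      by (cases x) (simp_all add: gset_def)
    with g show ?thesis by (auto simp: cong_def)
  qed
  have "cong J (gen None * single (map Some w) 1) (pm_scale ((- 1) ^ length w) (single (map Some w) 1 * gen None))" for w
  proof (induction w)
    case Nil
    then show ?case by (simp add: cong_refl[OF J])
  next
    case (Cons x w)
    have "cong J (gen None * single (map Some (x # w)) 1) (- (gen (Some x) * (gen None * single (map Some w) 1)))"
      using cong_right[OF J gx[of x], of "single (map Some w) 1"] by (simp add: single_Cons mult.assoc)
    moreover have "cong J (- (gen (Some x) * (gen None * single (map Some w) 1)))
      (pm_scale ((- 1) ^ length (x # w)) (single (map Some (x # w)) 1 * gen None))"
      using cong_scale[OF J cong_left[OF J Cons, of "gen (Some x)"], of "- 1"]
      by (simp add: single_Cons mult.assoc pm_scale_mult_right)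
    ultimately show ?case by (rule cong_trans[OF J])
  qed
  then have 1: "cong J (ge e * single (map Some w') 1) (pm_scale (bsg e (length w')) (single (map Some w') 1 * ge e))"
    by (cases e) (simp_all add: ge_def cong_refl[OF J])
  have "gen None * gen None - 1 \<in> gset" by (simp add: gset_def)
  then have 2: "cong J (ge e * ge e') (ge (e + e'))"
    using g by (cases e; cases e') (auto simp: ge_def cong_refl[OF J] cong_def[of J "gen None * gen None"])
  have "cong J (single (map Some w) 1 * ge e * (single (map Some w') 1 * ge e'))
    (pm_scale (bsg e (length w')) (single (map Some w) 1 * single (map Some w') 1 * (ge e * ge e')))"
    using cong_right[OF J cong_left[OF J 1, of "single (map Some w) 1"], of "ge e'"]
    by (simp add: mult.assoc pm_scale_mult_left pm_scale_mult_right)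
  from cong_trans[OF J this cong_scale[OF J cong_left[OF J 2]]]
  show "lift (single i 1) * lift (single j 1) - lift (fm (single i 1) (single j 1)) \<in> J"
    by (simp add: ij lift_single cong_def single_append)
qed (auto intro: two_sided_0[OF J] two_sided_add[OF J] two_sided_scale[OF J])

definition dgen :: "('k free4 \<Rightarrow> (bit \<Rightarrow>\<^sub>0 'k::field)) \<Rightarrow> nat \<Rightarrow> (double_gen list \<times> bit \<Rightarrow>\<^sub>0 'k)" where
  "dgen \<kappa> i = tens (rel i) 1 - tens 1 (\<kappa> (rel i))"

lemma lift_dgen: "lift (dgen \<kappa> i) = emb (rel i) - lin ge (\<kappa> (rel i))"
proof -
  have "lin ge 1 = (1 :: double_gen option list \<Rightarrow>\<^sub>0 'a)"
    by (simp add: lin_ge lookup_one)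
  then show ?thesis by (simp add: dgen_def plin_diff[OF plin_lift] lift_tens)
qed

context
  fixes \<kappa> :: "'k free4 \<Rightarrow> (bit \<Rightarrow>\<^sub>0 'k::field)"
begin

interpretation F: galg "free4_smash :: ('k::field, _) graded_alg" rF fm "single ([], 0) 1" "\<lambda>z. length (fst z)"
  by (rule galg_free4)

interpretation T: tensor_coords "free_modalg :: ('k, 'k free4, bit \<Rightarrow>\<^sub>0 'k) graded_modalg" "\<lambda>p. p" "kC2 :: ('k, _) hopf" "\<lambda>h. h"
proof -
  interpret M: malg "free_modalg :: ('k, 'k free4, bit \<Rightarrow>\<^sub>0 'k) graded_modalg" "\<lambda>p. p" "(*)" 1 length
    by (rule malg_free)
  show "tensor_coords (free_modalg :: ('k, 'k free4, bit \<Rightarrow>\<^sub>0 'k) graded_modalg) (\<lambda>p. p) (kC2 :: ('k, _) hopf) (\<lambda>h. h)"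
    by (rule tensor_coordsI[OF M.coords_axioms coords_kC2])
qed

lemma carrier_free4_smash: "carrier (free4_smash :: ('k, _) graded_alg) = carrier (tensor free_modalg kC2)"
  by (simp add: free4_smash_def smash_def Let_def)

definition dgens :: "('k, 'k free4, bit \<Rightarrow>\<^sub>0 'k) tens set" where
  "dgens = (\<lambda>i. pure free_modalg kC2 (rel i) 1 \<ominus>\<^bsub>free4_smash\<^esub> pure free_modalg kC2 1 (\<kappa> (rel i))) ` {1..6}"

lemma dgens: "dgens \<subseteq> carrier free4_smash" "rF ` dgens = dgen \<kappa> ` {1..6}"
proof -
  have p: "pure free_modalg kC2 a b \<in> carrier (free4_smash :: ('k, _) graded_alg)" for a :: "'k free4" and b
    by (simp add: carrier_free4_smash)
  show "dgens \<subseteq> carrier free4_smash"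
    unfolding dgens_def using p by auto
  have "rF (pure free_modalg kC2 (rel i) 1 \<ominus>\<^bsub>free4_smash\<^esub> pure free_modalg kC2 1 (\<kappa> (rel i))) = dgen \<kappa> i" for i
    by (subst F.r_a_minus[OF p p]) (simp add: dgen_def)
  then show "rF ` dgens = dgen \<kappa> ` {1..6}"
    unfolding dgens_def by (simp add: image_image)
qed

lemma deform_ideal_facts:
  shows "mideal fm (rF ` deform_ideal \<kappa>)" and "dgen \<kappa> ` {1..6} \<subseteq> rF ` deform_ideal \<kappa>"
    and "deform_ideal \<kappa> \<subseteq> carrier free4_smash"
    and "mideal fm K \<Longrightarrow> dgen \<kappa> ` {1..6} \<subseteq> K \<Longrightarrow> rF ` deform_ideal \<kappa> \<subseteq> K"
proof -
  have eq: "deform_ideal \<kappa> = Idl\<^bsub>free4_smash\<^esub> dgens"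
    by (simp add: deform_ideal_def dgens_def)
  note I = F.mideal_Idl[OF fm_assoc fm_one dgens(1), folded eq, unfolded dgens(2)]
  show "mideal fm (rF ` deform_ideal \<kappa>)" "dgen \<kappa> ` {1..6} \<subseteq> rF ` deform_ideal \<kappa>"
    "deform_ideal \<kappa> \<subseteq> carrier free4_smash"
    by (rule I)+
  show "mideal fm K \<Longrightarrow> dgen \<kappa> ` {1..6} \<subseteq> K \<Longrightarrow> rF ` deform_ideal \<kappa> \<subseteq> K"
    by (rule I)
qed

lemma mem_deform_ideal: "x \<in> carrier free4_smash \<Longrightarrow> rF x \<in> rF ` deform_ideal \<kappa> \<Longrightarrow> x \<in> deform_ideal \<kappa>"
proof -
  assume x: "x \<in> carrier free4_smash" and "rF x \<in> rF ` deform_ideal \<kappa>"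
  then obtain y where y: "rF x = rF y" "y \<in> deform_ideal \<kappa>" by blast
  then show "x \<in> deform_ideal \<kappa>"
    using F.r_eqI[OF y(1) x subsetD[OF deform_ideal_facts(3) y(2)]] by simp
qed

section \<open>The deformation ideal pulled back to the free algebra on five letters\<close>

definition left_op :: "double_gen option \<Rightarrow> (double_gen list \<times> bit \<Rightarrow>\<^sub>0 'k) \<Rightarrow> (double_gen list \<times> bit \<Rightarrow>\<^sub>0 'k)" where
  "left_op x = fm (case x of None \<Rightarrow> single ([], 1) 1 | Some y \<Rightarrow> single ([y], 0) 1)"

lemma plin_left_op: "plin (left_op x)"
  unfolding left_op_def by (rule bilin_right[OF bilin_fm])

text \<open>The five letters act on the smash product by left multiplication, and
  \<open>lift x\<close> acts as multiplication by \<open>x\<close>. So membership in the ideal can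
  be tested on words by applying them to the unit.\<close>

lemma rho_left_op_lift: "rho left_op (lift x) a = fm x a"
proof (rule plin_eqI[OF plin_comp[OF bilin_left[OF bilin_rho[OF plin_left_op]] plin_lift] bilin_left[OF bilin_fm]])
  fix z :: "double_gen list \<times> bit"
  obtain w e where z: "z = (w, e)" by force
  have "foldr left_op (map Some w) b = fm (single (w, 0) 1) b" for b
    by (induction w) (simp_all add: fm_one left_op_def flip: fm_assoc)
  moreover have "foldr left_op (gw e) a = fm (single ([], e) 1) a"
    by (cases e) (simp_all add: gw_def fm_one left_op_def)
  ultimately show "rho left_op (lift (single z 1)) a = fm (single z 1) a"
    by (simp add: z lift_def rho_single[OF plin_left_op] flip: fm_assoc)
qed

text \<open>
  Rewriting takes place in the free algebra in which \<open>g\<close> (the letter \<^const>\<open>None\<close>) is one more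
  generator; hence this preimage of the deformation ideal.
\<close>

definition preideal :: "(double_gen option list \<Rightarrow>\<^sub>0 'k) set" where
  "preideal = {p. \<forall>a. rho left_op p a \<in> rF ` deform_ideal \<kappa>}"

text \<open>The quantifier over all \<open>a\<close> in \<open>preideal\<close> gives closure under
  right multiplication at once; closure on the left holds because the letters act by left
  multiplication, under which the deformation ideal is stable.\<close>

lemma two_sided_preideal: "two_sided preideal"
proof (rule two_sidedI)
  have K: "mideal fm (rF ` deform_ideal \<kappa>)" by (rule deform_ideal_facts)
  have add: "x + y \<in> rF ` deform_ideal \<kappa>" if "x \<in> rF ` deform_ideal \<kappa>" "y \<in> rF ` deform_ideal \<kappa>" for x y
    using K that unfolding mideal_def by blast
  show "0 \<in> preideal"
    using K by (auto simp: preideal_def mideal_def rho_0[OF plin_left_op])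
  show "p + q \<in> preideal" if "p \<in> preideal" "q \<in> preideal" for p q
    using that by (simp add: preideal_def rho_add[OF plin_left_op] add)
  show "p * q \<in> preideal" if "p \<in> preideal" for p q
    using that by (auto simp: preideal_def rho_mult[OF plin_left_op])
  have sc: "pm_scale c x \<in> rF ` deform_ideal \<kappa>" if "x \<in> rF ` deform_ideal \<kappa>" for c x
  proof -
    have "fm (single ([], 0) c) x = pm_scale c x"
      using plin_scale[OF bilin_left[OF bilin_fm], of c "single ([], 0) 1" x] by (simp add: fm_one)
    moreover have "fm (single ([], 0) c) x \<in> rF ` deform_ideal \<kappa>"
      using K that unfolding mideal_def by blast
    ultimately show ?thesis by simp
  qed
  have "foldr left_op w x \<in> rF ` deform_ideal \<kappa>" if "x \<in> rF ` deform_ideal \<kappa>" for w x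
    by (induction w) (use K that in \<open>auto simp: mideal_def left_op_def\<close>)
  then have "rho left_op q x \<in> rF ` deform_ideal \<kappa>" if "x \<in> rF ` deform_ideal \<kappa>" for q x
    using that
  proof (induction q rule: pm_induct)
    case zero
    then show ?case using K by (simp add: mideal_def rho_0[OF plin_left_op])
  next
    case (step w c q)
    then have "pm_scale c (foldr left_op w x) \<in> rF ` deform_ideal \<kappa>" "rho left_op q x \<in> rF ` deform_ideal \<kappa>"
      using sc by auto
    then show ?case by (simp add: add rho_add[OF plin_left_op] rho_single[OF plin_left_op])
  qed
  then show "q * p \<in> preideal" if "p \<in> preideal" for p q
    using that by (auto simp: preideal_def rho_mult[OF plin_left_op])
qed

lemma gset_preideal: "gset \<subseteq> preideal"
proof -
  have 0: "0 \<in> rF ` deform_ideal \<kappa>" using deform_ideal_facts(1) by (simp add: mideal_def)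
  have "fm (single ([], 1) 1) (fm (single ([y], 0) 1) a) = - fm (single ([y], 0) 1) (fm (single ([], 1) 1) a)" for y and a :: "double_gen list \<times> bit \<Rightarrow>\<^sub>0 'k"
    using plin_uminus[OF bilin_left[OF bilin_fm], of "single ([y], 1) 1" a]
    by (simp add: single_uminus flip: fm_assoc)
  moreover have "fm (single ([], 1) 1) (fm (single ([], 1) 1) a) = a" for a :: "double_gen list \<times> bit \<Rightarrow>\<^sub>0 'k"
    by (simp add: fm_one flip: fm_assoc)
  ultimately have H: "left_op None (left_op (Some y) a) = - left_op (Some y) (left_op None a)" "left_op None (left_op None a) = a" for y a
    by (simp_all add: left_op_def)
  have "rho left_op p a = 0" if "p \<in> gset" for p a
    using that unfolding gset_def
    by (auto simp: rho_add[OF plin_left_op] rho_diff[OF plin_left_op] rho_mult[OF plin_left_op] rho_gen[OF plin_left_op] rho_1[OF plin_left_op] H)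
  then show ?thesis using 0 by (auto simp: preideal_def)
qed

lemma lift_preideal: "lift x \<in> preideal \<longleftrightarrow> x \<in> rF ` deform_ideal \<kappa>"
proof
  assume "lift x \<in> preideal"
  then have "fm x (single ([], 0) 1) \<in> rF ` deform_ideal \<kappa>"
    unfolding preideal_def by (simp add: rho_left_op_lift)
  then show "x \<in> rF ` deform_ideal \<kappa>" by (simp add: fm_one)
next
  assume "x \<in> rF ` deform_ideal \<kappa>"
  then show "lift x \<in> preideal"
    using deform_ideal_facts(1) by (auto simp: preideal_def rho_left_op_lift mideal_def)
qed

lemma lift_dgen_preideal: "i \<in> {1..6} \<Longrightarrow> lift (dgen \<kappa> i) \<in> preideal"
  using deform_ideal_facts(2) by (auto simp: lift_preideal)

lemma drels_eq:
  assumes "kappa_form l1 l2 l3 \<kappa>"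
  shows "drels l1 l2 l3 = (\<lambda>i. lift (dgen \<kappa> i)) ` {1..6} \<union> gset"
proof -
  have k: "\<kappa> (rel 1) = pm_scale l1 1" "\<kappa> (rel 2) = pm_scale l2 1" "\<kappa> (rel 3) = pm_scale l3 grp_g"
    "\<kappa> (rel 4) = 0" "\<kappa> (rel 5) = 0" "\<kappa> (rel 6) = 0"
    using assms by (simp_all add: kappa_form_def)
  have l: "lin ge (pm_scale l 1) = pm_scale l 1" "lin ge (pm_scale l grp_g) = pm_scale l (gen None)" for l :: 'k
    by (simp_all add: lin_ge lookup_one grp_g_def lookup_single ge_def)
  have r: "lift (dgen \<kappa> 1) = emb (rel 1) - pm_scale l1 1" "lift (dgen \<kappa> 2) = emb (rel 2) - pm_scale l2 1"
    "lift (dgen \<kappa> 3) = emb (rel 3) - pm_scale l3 (gen None)" "lift (dgen \<kappa> 4) = emb (rel 4)"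
    "lift (dgen \<kappa> 5) = emb (rel 5)" "lift (dgen \<kappa> 6) = emb (rel 6)"
    by (simp_all only: lift_dgen k l lin_0 diff_zero)
  have "{1..6 :: nat} = {1, 2, 3, 4, 5, 6}" by auto
  then have "(\<lambda>i. lift (dgen \<kappa> i)) ` {1..6} = {emb (rel 1) - pm_scale l1 1, emb (rel 2) - pm_scale l2 1,
    emb (rel 3) - pm_scale l3 (gen None), emb (rel 4), emb (rel 5), emb (rel 6)}"
    by (simp only: image_insert image_empty r)
  then show ?thesis
    by (simp add: rel_def drels_def Let_def gset_def plin_add[OF plin_emb] plin_diff[OF plin_emb] emb_mult power2_eq_square insert_commute)
qed

text \<open>For the kernel, one inclusion holds because \<open>QI\<close> lies in
  \<open>preideal\<close>; for the other, the kernel of \<open>\<pi>\<close> is an ideal that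
  contains the generators \<open>dgen\<close>. The last claim holds since a word raises the degree
  of the cyclic vector at most by its number of letters other than g.\<close>

lemma deform_ideal_kernel:
  fixes l1 l2 l3 :: 'k
  assumes "kappa_form l1 l2 l3 \<kappa>"
  defines "\<pi> \<equiv> \<lambda>x. normal_form.eps (\<lambda>x. lin (Db l1 l2 l3 x)) (((0, 0), (0, 0)), 0) (lift x)"
  shows "plin \<pi>" and "\<pi> (fm x y) = dml l1 l2 l3 (\<pi> x) (\<pi> y)" and "\<pi> x = 0 \<longleftrightarrow> x \<in> rF ` deform_ideal \<kappa>"
    and "\<pi> (lin (\<lambda>(z, e). single (Bwd z, e) 1) a) = a" and "\<pi> (single ([], 0) 1) = single (((0, 0), (0, 0)), 0) 1"
    and "keys x \<subseteq> {z. length (fst z) \<le> n} \<Longrightarrow> fil mdeg n (\<pi> x)"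
proof -
  interpret D: normal_form "\<lambda>x. lin (Db l1 l2 l3 x)" Dwd "(((0, 0), (0, 0)), 0)" "QI l1 l2 l3"
    by (rule deform_normal_form)
  show pl: "plin \<pi>" unfolding \<pi>_def by (rule plin_comp[OF D.plin_eps plin_lift])
  have sub: "gset \<subseteq> QI l1 l2 l3" "(\<lambda>i. lift (dgen \<kappa> i)) ` {1..6} \<subseteq> QI l1 l2 l3"
    using Idl_self[of "drels l1 l2 l3"] unfolding QI_def drels_eq[OF assms(1)] by blast+
  have mult: "\<pi> (fm x y) = dml l1 l2 l3 (\<pi> x) (\<pi> y)" for x y
  proof -
    have "D.eps (lift x * lift y - lift (fm x y)) = 0"
      using lift_mult[OF D.J sub(1), of x y] unfolding cong_def D.J_eq by simp
    then show ?thesis by (simp add: \<pi>_def plin_diff[OF D.plin_eps] D.eps_mult)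
  qed
  then show "\<pi> (fm x y) = dml l1 l2 l3 (\<pi> x) (\<pi> y)" .
  show "\<pi> x = 0 \<longleftrightarrow> x \<in> rF ` deform_ideal \<kappa>"
  proof
    assume "\<pi> x = 0"
    then have "lift x \<in> QI l1 l2 l3" by (simp add: \<pi>_def D.J_eq)
    moreover have "QI l1 l2 l3 \<subseteq> preideal"
      unfolding QI_def drels_eq[OF assms(1)]
      using gset_preideal lift_dgen_preideal by (intro Idl_minimal two_sided_preideal) auto
    ultimately show "x \<in> rF ` deform_ideal \<kappa>" using lift_preideal by blast
  next
    have "mideal fm {x. \<pi> x = 0}"
      using plin_0[OF bilin_left[OF D.bilin_ml]] plin_0[OF bilin_right[OF D.bilin_ml]]
      by (auto simp: mideal_def mult plin_0[OF pl] plin_add[OF pl])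
    moreover have "dgen \<kappa> ` {1..6} \<subseteq> {x. \<pi> x = 0}"
      using sub(2) by (auto simp: \<pi>_def D.J_eq)
    ultimately show "x \<in> rF ` deform_ideal \<kappa> \<Longrightarrow> \<pi> x = 0"
      using deform_ideal_facts(4) by blast
  qed
  have "lift (lin (\<lambda>(z, e). single (Bwd z, e) 1) a) = D.nf a"
    unfolding D.nf_def plin_lin_push[OF plin_lift]
    by (rule lin_cong) (auto simp: lift_def Dwd_def gw_def)
  then show "\<pi> (lin (\<lambda>(z, e). single (Bwd z, e) 1) a) = a" by (simp add: \<pi>_def)
  have "lift (single ([], 0) 1) = (1 :: _ \<Rightarrow>\<^sub>0 'k)" by (simp add: lift_single ge_def)
  then show "\<pi> (single ([], 0) 1) = single (((0, 0), (0, 0)), 0) 1" by (simp add: \<pi>_def)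
  show "fil mdeg n (\<pi> x)" if x: "keys x \<subseteq> {z. length (fst z) \<le> n}"
    using x
  proof -
    have wt: "sum_list (map wt (map Some w @ gw e)) = length w" for w e
      by (induction w) (simp_all add: wt_def gw_def)
    have "fil mdeg n (\<pi> (single z 1))" if z: "z \<in> keys x" for z
    proof -
      obtain w e where we: "z = (w, e)" by force
      have eq: "\<pi> (single z 1) = foldr (\<lambda>x. lin (Db l1 l2 l3 x)) (map Some w @ gw e) (bas (((0, 0), (0, 0)), 0))"
        by (simp add: we \<pi>_def D.eps_def lift_def rho_single[OF D.plin_f] bas_def)
      have "fil mdeg (length w) (\<pi> (single z 1))"
        using foldr_Db_top[of 0 "bas (((0, 0), (0, 0)), 0)" "map Some w @ gw e" l1 l2 l3]
        unfolding eq wt by simp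
      moreover have "length w \<le> n" using subsetD[OF x z] by (simp add: we)
      ultimately show ?thesis by (rule fil_mono)
    qed
    then have "fil mdeg n (lin (\<lambda>z. \<pi> (single z 1)) x)" by (rule fil_lin)
    then show ?thesis by (simp flip: plin_conv_lin[OF pl])
  qed
qed

lemma quot_filtration_eq:
  "quot_filtration free4_smash (deform_ideal \<kappa>) n =
    (\<lambda>x. deform_ideal \<kappa> +>\<^bsub>free4_smash\<^esub> x) ` {x \<in> carrier free4_smash. keys (rF x) \<subseteq> {z. length (fst z) \<le> n}}"
proof -
  have "lspan free4_smash (\<Union>i\<le>n. hcomp (free4_smash :: ('k, _) graded_alg) i) =
    {x \<in> carrier free4_smash. keys (rF x) \<subseteq> {z. length (fst z) \<le> n}}"
  proof (rule F.lspan_eq)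
    show "(\<Union>i\<le>n. hcomp (free4_smash :: ('k, _) graded_alg) i) \<subseteq>
      {x \<in> carrier free4_smash. keys (rF x) \<subseteq> {z. length (fst z) \<le> n}}"
      by (auto simp: F.hcomp_eq)
    fix z :: "double_gen list \<times> bit" assume "z \<in> {z. length (fst z) \<le> n}"
    then show "F.el (single z 1) \<in> (\<Union>i\<le>n. hcomp (free4_smash :: ('k, _) graded_alg) i)"
      by (auto simp: F.hcomp_eq intro!: bexI[of _ "length (fst z)"])
  qed
  then show ?thesis by (simp add: quot_filtration_def)
qed

text \<open>In the coordinates of \<open>deform_ideal_kernel\<close> the induced filtration becomes
  the filtration by \<open>mdeg\<close>. Then \<open>assoc_graded_isomorphic\<close> applies, with
  \<open>dml l1 l2 l3\<close> as filtered product and \<open>dml 0 0 0\<close> as its leading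
  part.\<close>

lemma PBW_if_kappa_form:
  fixes l1 l2 l3 :: 'k
  assumes two: "(2 :: 'k) \<noteq> 0" and kf: "kappa_form l1 l2 l3 \<kappa>"
  shows "is_PBW_deformation \<kappa>"
proof -
  obtain r where r: "malg (jordan_double :: ('k, _, _) graded_modalg) r bml (single ((0, 0), (0, 0)) 1) ddeg"
    using malg_double[OF two] by blast
  have "tens (single ((0, 0), (0, 0)) 1) (single 0 1) = (single (((0, 0), (0, 0)), 0) 1 :: idx \<times> bit \<Rightarrow>\<^sub>0 'k)"
    by (simp del: single_one)
  then have T: "galg (smash (jordan_double :: ('k, _, _) graded_modalg) kC2) (tco r (\<lambda>x. x)) (dml 0 0 0)
      (single (((0, 0), (0, 0)), 0) 1) mdeg"
    using smash_galg[OF r] unfolding dml_eq[symmetric] by (simp add: mdeg_def[abs_def])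
  define \<pi> where "\<pi> x = normal_form.eps (\<lambda>x. lin (Db l1 l2 l3 x)) (((0, 0), (0, 0)), 0) (lift x)" for x
  note \<pi> = deform_ideal_kernel[OF kf, folded \<pi>_def]
  let ?F = "free4_smash :: ('k, _) graded_alg" and ?I = "deform_ideal \<kappa>" and ?D = "deform_alg \<kappa>"
  have s: "\<pi> (rF (F.el (lin (\<lambda>(z, e). single (Bwd z, e) 1) a))) = a" for a
    by (simp add: \<pi>)
  interpret Q: lin_quot ?F "\<lambda>x. \<pi> (rF x)" ?I
  proof
    show "(\<lambda>x. \<pi> (rF x)) ` carrier ?F = UNIV"
    proof (intro equalityI subset_UNIV subsetI)
      fix a show "a \<in> (\<lambda>x. \<pi> (rF x)) ` carrier ?F"
        by (rule image_eqI[of _ _ "F.el (lin (\<lambda>(z, e). single (Bwd z, e) 1) a)"]) (simp_all only: s F.el_closed)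
    qed
    show "?I = {x \<in> carrier ?F. \<pi> (rF x) = 0}"
      using \<pi>(3) subsetD[OF deform_ideal_facts(3)] mem_deform_ideal by auto
  qed (auto simp: plin_add[OF \<pi>(1)] plin_scale[OF \<pi>(1)])
  have D: "filtered_coords ?D Q.rq mdeg (quot_filtration ?F ?I)"
  proof -
    have "quot_filtration ?F ?I n = {X \<in> carrier ?D. fil mdeg n (Q.rq X)}" for n
    proof (intro equalityI subsetI)
      fix X assume "X \<in> quot_filtration ?F ?I n"
      then show "X \<in> {X \<in> carrier ?D. fil mdeg n (Q.rq X)}"
        using \<pi>(6) by (auto simp: quot_filtration_eq deform_alg_def)
    next
      fix X assume X: "X \<in> {X \<in> carrier ?D. fil mdeg n (Q.rq X)}"
      then obtain x where x: "x \<in> carrier ?F" "X = ?I +>\<^bsub>?F\<^esub> x"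
        by (auto simp: deform_alg_def Q.carrier_quot)
      \<comment> \<open>A representative made of normal words, whose lengths equal the degrees; so a
        class of degree at most n comes from words of length at most n.\<close>
      let ?y = "lin (\<lambda>(z, e). single (Bwd z, e) 1) (Q.rq X)"
      have "length (Bwd z) = ddeg z" for z by (cases z) (auto simp: Bwd_def)
      then have "keys ?y \<subseteq> {z. length (fst z) \<le> n}"
        using X by (intro keys_lin_subset) (auto simp: fil_def)
      moreover have "X = ?I +>\<^bsub>?F\<^esub> F.el ?y"
        unfolding x(2) by (rule Q.coset_eqI) (use x in \<open>simp_all add: \<pi>\<close>)
      ultimately show "X \<in> quot_filtration ?F ?I n"
        unfolding quot_filtration_eq by (intro image_eqI[of _ _ "F.el ?y"]) simp_all
    qed
    then show ?thesis
      by (intro filtered_coords.intro filtered_coords_axioms.intro)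
        (use Q.q.coords_axioms in \<open>simp_all add: deform_alg_def\<close>)
  qed
  show ?thesis
    unfolding is_PBW_deformation_def
  proof (rule assoc_graded_isomorphic[OF D T])
    fix X Y assume "X \<in> carrier ?D" "Y \<in> carrier ?D"
    then obtain x y where "x \<in> carrier ?F" "X = ?I +>\<^bsub>?F\<^esub> x" "y \<in> carrier ?F" "Y = ?I +>\<^bsub>?F\<^esub> y"
      by (auto simp: deform_alg_def Q.carrier_quot)
    then show "X \<otimes>\<^bsub>?D\<^esub> Y \<in> carrier ?D \<and> Q.rq (X \<otimes>\<^bsub>?D\<^esub> Y) = dml l1 l2 l3 (Q.rq X) (Q.rq Y)"
      using Q.coset_mult[of x y "dml l1 l2 l3"] by (simp add: deform_alg_def \<pi>(2))
  next
    show "\<one>\<^bsub>?D\<^esub> \<in> carrier ?D" "Q.rq \<one>\<^bsub>?D\<^esub> = single (((0, 0), (0, 0)), 0) 1"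
      by (simp_all add: deform_alg_def \<pi>(5) flip: Q.coset_one)
  next
    show "fil mdeg 0 (single (((0, 0), (0, 0)), 0) (1 :: 'k))" by (simp flip: bas_def)
  next
    fix k n and a b :: "idx \<times> bit \<Rightarrow>\<^sub>0 'k"
    assume "fil mdeg k a" "fil mdeg n b"
    then show "fil mdeg (k + n) (dml l1 l2 l3 a b) \<and>
      gpart mdeg (k + n) (dml l1 l2 l3 a b) = dml 0 0 0 (gpart mdeg k a) (gpart mdeg n b)"
      by (simp add: dml_top)
  qed (rule keys_dml)
qed

end

section \<open>Degree one part of a PBW deformation\<close>

lemma surj_imp_inj_finite:
  fixes f :: "('a \<Rightarrow>\<^sub>0 'k::field) \<Rightarrow> ('a \<Rightarrow>\<^sub>0 'k)"
  assumes fin: "finite (UNIV :: 'a set)" and f: "plin f" and "surj f"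
  shows "inj f"
proof -
  interpret V: vector_space "pm_scale :: 'k \<Rightarrow> ('a \<Rightarrow>\<^sub>0 'k) \<Rightarrow> _"
    by unfold_locales (simp_all add: pm_scale_add pm_scale_add_left)
  let ?B = "range (\<lambda>i :: 'a. single i (1 :: 'k))"
  interpret V: finite_dimensional_vector_space "pm_scale :: 'k \<Rightarrow> ('a \<Rightarrow>\<^sub>0 'k) \<Rightarrow> _" ?B
  proof
    show fB: "finite ?B" using fin by simp
    show "V.independent ?B"
    proof (rule V.independent_if_scalars_zero[OF fB])
      fix g and x :: "'a \<Rightarrow>\<^sub>0 'k" assume sum: "(\<Sum>x\<in>?B. pm_scale (g x) x) = 0" and "x \<in> ?B"
      then obtain j where j: "x = single j 1" by blast
      have "inj (\<lambda>i :: 'a. single i (1 :: 'k))"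
        by (rule injI) (metis keys_single one_neq_zero singleton_inject)
      then have "(\<Sum>x\<in>?B. pm_scale (g x) x) = (\<Sum>i\<in>UNIV. single i (g (single i 1)))"
        by (subst sum.reindex) simp_all
      then have "lookup (\<Sum>i\<in>UNIV. single i (g (single i 1))) j = 0" using sum by simp
      then show "g x = 0" using fin by (simp add: lookup_sum lookup_single when_def j)
    qed
    have "p \<in> V.span ?B" for p
    proof -
      have "(\<Sum>i\<in>keys p. pm_scale (lookup p i) (single i 1)) \<in> V.span ?B"
        by (intro V.span_sum V.span_scale V.span_base) simp
      then show ?thesis by (simp flip: poly_mapping_sum_single)
    qed
    then show "V.span ?B = UNIV" by blast
  qed
  have "Vector_Spaces.linear pm_scale pm_scale f"
    by unfold_locales (simp_all add: plin_add[OF f] plin_scale[OF f])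
  then show ?thesis using \<open>surj f\<close> by (rule V.linear_surj_imp_inj)
qed

definition letters :: "(double_gen \<times> bit \<Rightarrow>\<^sub>0 'k::field) \<Rightarrow> (double_gen list \<times> bit \<Rightarrow>\<^sub>0 'k)" where
  "letters = lin (\<lambda>(x, e). single ([x], e) 1)"

fun letter_index :: "double_gen \<times> bit \<Rightarrow> idx \<times> bit" where
  "letter_index (Gu, e) = (((0, 1), (0, 0)), e)"
| "letter_index (Gv, e) = (((1, 0), (0, 0)), e)"
| "letter_index (Gu', e) = (((0, 0), (0, 1)), e)"
| "letter_index (Gv', e) = (((0, 0), (1, 0)), e)"

lemma inj_letter_index: "inj letter_index"
proof (rule injI)
  fix y z assume "letter_index y = letter_index z"
  moreover obtain x e x' e' where "y = (x, e)" "z = (x', e')" by (metis surj_pair)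
  ultimately show "y = z" by (cases x; cases x') simp_all
qed

lemma mdeg_letter_index: "mdeg (letter_index z) = 1"
  by (cases z rule: letter_index.cases) simp_all

lemma finite_double_gen_bit: "finite (UNIV :: (double_gen \<times> bit) set)"
proof -
  have "(UNIV :: double_gen set) = {Gu, Gv, Gu', Gv'}" using double_gen.exhaust by blast
  moreover have "(UNIV :: bit set) = {0, 1}" using bit.exhaust by blast
  ultimately show ?thesis
    by (metis UNIV_Times_UNIV finite.emptyI finite.insertI finite_cartesian_product)
qed

text \<open>Keeps the coordinates at the eight basis monomials of degree one; the index type is
  finite, so the sum makes sense.\<close>

definition restr :: "(idx \<times> bit \<Rightarrow>\<^sub>0 'k::field) \<Rightarrow> (double_gen \<times> bit \<Rightarrow>\<^sub>0 'k)" where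
  "restr p = (\<Sum>z\<in>UNIV. single z (lookup p (letter_index z)))"

lemma lookup_restr: "lookup (restr p) z = lookup p (letter_index z)"
  using finite_double_gen_bit by (simp add: restr_def lookup_sum lookup_single when_def)

lemma plin_restr: "plin restr"
  by (rule plinI; rule poly_mapping_eqI) (simp_all add: lookup_restr lookup_add)

lemma restr_lin_letter_index: "restr (lin (\<lambda>z. single (letter_index z) 1) t) = t"
proof (rule plin_eqI[OF plin_comp[OF plin_restr plin_lin] plin_id])
  show "restr (lin (\<lambda>z. single (letter_index z) 1) (single z 1)) = single z 1" for z
    by (rule poly_mapping_eqI) (simp add: lookup_restr lookup_single when_def inj_eq[OF inj_letter_index])
qed

section \<open>Degree one of the associated graded algebra for arbitrary \<kappa>\<close>

context
  fixes \<kappa> :: "'k free4 \<Rightarrow> (bit \<Rightarrow>\<^sub>0 'k::field)"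
begin

interpretation F: galg "free4_smash :: ('k::field, _) graded_alg" rF fm "single ([], 0) 1" "\<lambda>z. length (fst z)"
  by (rule galg_free4)

interpretation R: ring "free4_smash :: ('k::field, _) graded_alg"
  by (rule F.ring_galg) (simp_all add: fm_assoc fm_one)

abbreviation "FF \<equiv> free4_smash :: ('k::field, _) graded_alg"
abbreviation "II \<equiv> deform_ideal \<kappa>"
abbreviation "DD \<equiv> deform_alg \<kappa>"

interpretation I: ideal II FF
  unfolding deform_ideal_def using dgens(1)[of \<kappa>] unfolding dgens_def by (rule R.genideal_ideal)

text \<open>For arbitrary \<kappa> no basis of the quotient is at hand, so \<open>lin_quot\<close>
  is out of reach and cosets are handled by the theory of ideals.\<close>

definition coset_of :: "('k, 'k free4, bit \<Rightarrow>\<^sub>0 'k) tens \<Rightarrow> ('k, 'k free4, bit \<Rightarrow>\<^sub>0 'k) tens set" where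
  "coset_of x = II +>\<^bsub>FF\<^esub> x"

lemma carrier_DD: "carrier DD = coset_of ` carrier FF"
  by (auto simp: deform_alg_def quot_alg_def FactRing_def A_RCOSETS_def' coset_of_def)

lemma abelian_group_DD: "abelian_group DD"
proof -
  interpret Q: ring "FF Quot II" by (rule I.quotient_is_ring)
  have eq: "carrier DD = carrier (FF Quot II)" "add DD = add (FF Quot II)" "zero DD = zero (FF Quot II)"
    by (simp_all add: deform_alg_def quot_alg_def)
  show ?thesis
  proof (rule abelian_groupI; unfold eq)
    fix x assume "x \<in> carrier (FF Quot II)"
    then show "\<exists>y\<in>carrier (FF Quot II). y \<oplus>\<^bsub>FF Quot II\<^esub> x = \<zero>\<^bsub>FF Quot II\<^esub>"
      using Q.l_neg Q.a_inv_closed by blast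
  qed (rule Q.a_assoc Q.a_comm Q.l_zero Q.zero_closed Q.add.m_closed; assumption)+
qed

interpretation D: abelian_group DD by (rule abelian_group_DD)

lemma coset_of_closed: "x \<in> carrier FF \<Longrightarrow> coset_of x \<in> carrier DD"
  by (simp add: carrier_DD)

lemma coset_of_add: "x \<in> carrier FF \<Longrightarrow> y \<in> carrier FF \<Longrightarrow> coset_of x \<oplus>\<^bsub>DD\<^esub> coset_of y = coset_of (x \<oplus>\<^bsub>FF\<^esub> y)"
  by (simp add: deform_alg_def quot_alg_def FactRing_def coset_of_def I.a_rcos_sum)

lemma coset_of_mem: "x \<in> II \<Longrightarrow> coset_of x = \<zero>\<^bsub>DD\<^esub>"
  by (simp add: deform_alg_def quot_alg_def FactRing_def coset_of_def I.a_rcos_const)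

lemma coset_of_zero: "coset_of \<zero>\<^bsub>FF\<^esub> = \<zero>\<^bsub>DD\<^esub>"
  by (rule coset_of_mem) (rule additive_subgroup.zero_closed[OF I.additive_subgroup_axioms])

text \<open>Ideals of the record are closed under products, so a scalar is realised as
  multiplication by a multiple of the unit.\<close>

lemma II_smult: "x \<in> II \<Longrightarrow> c \<odot>\<^bsub>FF\<^esub> x \<in> II"
proof -
  assume x: "x \<in> II"
  then have xF: "x \<in> carrier FF" using deform_ideal_facts(3) by blast
  have "fm (single ([], 0) c) (rF x) = pm_scale c (rF x)"
    using plin_scale[OF bilin_left[OF bilin_fm], of c "single ([], 0) 1" "rF x"] by (simp add: fm_one)
  moreover have "fm (single ([], 0) c) (rF x) \<in> rF ` II"
    using deform_ideal_facts(1)[of \<kappa>] x unfolding mideal_def by blast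
  ultimately show ?thesis using xF by (intro mem_deform_ideal) auto
qed

lemma coset_of_smult: "x \<in> carrier FF \<Longrightarrow> c \<odot>\<^bsub>DD\<^esub> coset_of x = coset_of (c \<odot>\<^bsub>FF\<^esub> x)"
proof -
  assume x: "x \<in> carrier FF"
  have "II +>\<^bsub>FF\<^esub> (c \<odot>\<^bsub>FF\<^esub> y) = coset_of (c \<odot>\<^bsub>FF\<^esub> x)" if "y \<in> coset_of x" for y
  proof -
    obtain h where h: "h \<in> II" "y = h \<oplus>\<^bsub>FF\<^esub> x" using \<open>y \<in> coset_of x\<close> by (auto simp: coset_of_def a_r_coset_def')
    have hF: "h \<in> carrier FF" using h(1) deform_ideal_facts(3) by blast
    have "c \<odot>\<^bsub>FF\<^esub> y = (c \<odot>\<^bsub>FF\<^esub> h) \<oplus>\<^bsub>FF\<^esub> (c \<odot>\<^bsub>FF\<^esub> x)"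
      using hF x by (intro F.r_eqI) (simp_all add: h pm_scale_add)
    then have "coset_of (c \<odot>\<^bsub>FF\<^esub> y) = coset_of (c \<odot>\<^bsub>FF\<^esub> h) \<oplus>\<^bsub>DD\<^esub> coset_of (c \<odot>\<^bsub>FF\<^esub> x)"
      using hF x by (simp add: coset_of_add)
    also have "\<dots> = coset_of (c \<odot>\<^bsub>FF\<^esub> x)"
      using x by (simp add: coset_of_mem II_smult h(1) coset_of_closed)
    finally show ?thesis by (simp add: coset_of_def)
  qed
  moreover have "x \<in> coset_of x" using x I.a_rcos_self by (simp add: coset_of_def)
  ultimately have "(\<Union>y\<in>coset_of x. II +>\<^bsub>FF\<^esub> (c \<odot>\<^bsub>FF\<^esub> y)) = coset_of (c \<odot>\<^bsub>FF\<^esub> x)" by blast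
  then show ?thesis by (simp add: deform_alg_def quot_alg_def)
qed

text \<open>The strict bound lets \<open>NN_eq\<close> hold uniformly: for n = 0 it leaves only
  zero, as the convention for the associated graded algebra demands.\<close>

definition below :: "nat \<Rightarrow> ('k, 'k free4, bit \<Rightarrow>\<^sub>0 'k) tens set" where
  "below n = {x \<in> carrier FF. keys (rF x) \<subseteq> {z. length (fst z) < n}}"

abbreviation "fl \<equiv> quot_filtration FF II"
abbreviation "NN \<equiv> filt_pred DD fl"

lemma fl_eq: "fl n = coset_of ` below (Suc n)"
  by (simp add: quot_filtration_eq below_def coset_of_def less_Suc_eq_le)

lemma below_carrier: "x \<in> below n \<Longrightarrow> x \<in> carrier FF"
  by (simp add: below_def)

lemma below_zero: "\<zero>\<^bsub>FF\<^esub> \<in> below n"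
  by (simp add: below_def)

lemma NN_eq: "NN n = coset_of ` below n"
proof (cases n)
  case 0
  have "x = \<zero>\<^bsub>FF\<^esub>" if "x \<in> below 0" for x
    using that by (intro F.r_eqI) (simp_all add: below_def)
  then have "below 0 = {\<zero>\<^bsub>FF\<^esub>}" using below_zero by blast
  then show ?thesis by (simp add: 0 filt_pred_def coset_of_zero)
next
  case (Suc m)
  then show ?thesis by (simp add: filt_pred_def fl_eq)
qed

lemma below_add: "x \<in> below n \<Longrightarrow> y \<in> below n \<Longrightarrow> x \<oplus>\<^bsub>FF\<^esub> y \<in> below n"
  using keys_add[of "rF x" "rF y"] by (auto simp: below_def)

lemma below_smult: "x \<in> below n \<Longrightarrow> c \<odot>\<^bsub>FF\<^esub> x \<in> below n"
  using keys_pm_scale[of c "rF x"] by (auto simp: below_def)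

lemma NN_subgroup: "abelian_subgroup (NN n) DD"
proof (rule abelian_subgroupI3[OF _ abelian_group_DD])
  have "subgroup (NN n) (add_monoid DD)"
  proof (rule D.add.subgroupI)
    show "NN n \<subseteq> carrier DD" using below_carrier by (auto simp: NN_eq carrier_DD)
    show "NN n \<noteq> {}" using below_zero by (auto simp: NN_eq)
    show "a \<oplus>\<^bsub>DD\<^esub> b \<in> NN n" if "a \<in> NN n" "b \<in> NN n" for a b
      using that below_carrier below_add by (auto simp: NN_eq coset_of_add)
    show "\<ominus>\<^bsub>DD\<^esub> a \<in> NN n" if a: "a \<in> NN n" for a
    proof -
      obtain x where x: "x \<in> below n" "a = coset_of x" using a by (auto simp: NN_eq)
      let ?y = "(- 1) \<odot>\<^bsub>FF\<^esub> x"
      have "?y \<oplus>\<^bsub>FF\<^esub> x = \<zero>\<^bsub>FF\<^esub>" using below_carrier[OF x(1)] by (intro F.r_eqI) simp_all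
      then have "coset_of ?y \<oplus>\<^bsub>DD\<^esub> coset_of x = \<zero>\<^bsub>DD\<^esub>"
        using below_carrier[OF x(1)] by (simp add: coset_of_add coset_of_zero)
      then have "\<ominus>\<^bsub>DD\<^esub> a = coset_of ?y"
        using below_carrier[OF x(1)] by (intro D.minus_equality) (simp_all add: x coset_of_closed)
      then show ?thesis using below_smult[OF x(1)] by (simp add: NN_eq)
    qed
  qed
  then show "additive_subgroup (NN n) DD" by (rule additive_subgroup.intro)
qed

definition degree_one_class :: "('k, 'k free4, bit \<Rightarrow>\<^sub>0 'k) tens \<Rightarrow> nat \<Rightarrow> ('k, 'k free4, bit \<Rightarrow>\<^sub>0 'k) tens set set" where
  "degree_one_class x n = NN n +>\<^bsub>DD\<^esub> (if n = 1 then coset_of x else \<zero>\<^bsub>DD\<^esub>)"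

abbreviation "GG \<equiv> assoc_graded DD fl"

lemma NN_zero: "NN n +>\<^bsub>DD\<^esub> \<zero>\<^bsub>DD\<^esub> = NN n"
  using NN_eq below_carrier by (intro D.a_coset_add_zero) (auto simp: carrier_DD)

lemma degree_one_class_hcomp: "x \<in> below 2 \<Longrightarrow> degree_one_class x \<in> hcomp GG 1"
proof -
  assume x: "x \<in> below 2"
  have "\<exists>y\<in>fl n. degree_one_class x n = NN n +>\<^bsub>DD\<^esub> y" for n
  proof (cases "n = 1")
    case True
    with x show ?thesis
      by (intro bexI[of _ "coset_of x"]) (simp_all add: degree_one_class_def fl_eq numeral_2_eq_2)
  next
    case False
    have "\<zero>\<^bsub>DD\<^esub> \<in> fl n" unfolding fl_eq coset_of_zero[symmetric] using below_zero by (rule imageI)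
    with False show ?thesis by (intro bexI[of _ "\<zero>\<^bsub>DD\<^esub>"]) (simp_all add: degree_one_class_def)
  qed
  moreover have "finite {n. degree_one_class x n \<noteq> NN n}"
    by (rule finite_subset[of _ "{1}"]) (auto simp: degree_one_class_def NN_zero)
  ultimately show ?thesis
    by (simp add: assoc_graded_def Let_def degree_one_class_def NN_zero)
qed

lemma hcomp_carrier: "X \<in> hcomp GG 1 \<Longrightarrow> X \<in> carrier GG"
  by (simp add: assoc_graded_def Let_def)

lemma degree_one_class_add: "x \<in> carrier FF \<Longrightarrow> y \<in> carrier FF \<Longrightarrow> degree_one_class x \<oplus>\<^bsub>GG\<^esub> degree_one_class y = degree_one_class (x \<oplus>\<^bsub>FF\<^esub> y)"
proof
  fix n assume "x \<in> carrier FF" "y \<in> carrier FF"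
  then show "(degree_one_class x \<oplus>\<^bsub>GG\<^esub> degree_one_class y) n = degree_one_class (x \<oplus>\<^bsub>FF\<^esub> y) n"
    using abelian_subgroup.a_rcos_sum[OF NN_subgroup[of n]]
    by (simp add: assoc_graded_def Let_def degree_one_class_def coset_of_closed coset_of_add)
qed

lemma degree_one_class_smult: "x \<in> carrier FF \<Longrightarrow> c \<odot>\<^bsub>GG\<^esub> degree_one_class x = degree_one_class (c \<odot>\<^bsub>FF\<^esub> x)"
proof
  fix n assume x: "x \<in> carrier FF"
  interpret N: abelian_subgroup "NN n" DD by (rule NN_subgroup)
  define y where "y = (if n = 1 then x else \<zero>\<^bsub>FF\<^esub>)"
  have y: "y \<in> carrier FF" "degree_one_class x n = NN n +>\<^bsub>DD\<^esub> coset_of y"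
    using x by (simp_all add: y_def degree_one_class_def coset_of_zero)
  have "c \<odot>\<^bsub>FF\<^esub> \<zero>\<^bsub>FF\<^esub> = \<zero>\<^bsub>FF\<^esub>" by (rule F.r_eqI) simp_all
  then have g: "degree_one_class (c \<odot>\<^bsub>FF\<^esub> x) n = NN n +>\<^bsub>DD\<^esub> coset_of (c \<odot>\<^bsub>FF\<^esub> y)"
    by (simp add: y_def degree_one_class_def coset_of_zero)
  have "NN n +>\<^bsub>DD\<^esub> (c \<odot>\<^bsub>DD\<^esub> a) = degree_one_class (c \<odot>\<^bsub>FF\<^esub> x) n" if a: "a \<in> NN n +>\<^bsub>DD\<^esub> coset_of y" for a
  proof -
    obtain h where "h \<in> NN n" "a = h \<oplus>\<^bsub>DD\<^esub> coset_of y" using a by (auto simp: a_r_coset_def')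
    then obtain z where z: "z \<in> below n" "a = coset_of z \<oplus>\<^bsub>DD\<^esub> coset_of y" by (auto simp: NN_eq)
    have zF: "z \<in> carrier FF" using below_carrier[OF z(1)] .
    have "c \<odot>\<^bsub>FF\<^esub> (z \<oplus>\<^bsub>FF\<^esub> y) = (c \<odot>\<^bsub>FF\<^esub> z) \<oplus>\<^bsub>FF\<^esub> (c \<odot>\<^bsub>FF\<^esub> y)"
      using zF y by (intro F.r_eqI) (simp_all add: pm_scale_add)
    then have "c \<odot>\<^bsub>DD\<^esub> a = coset_of (c \<odot>\<^bsub>FF\<^esub> z) \<oplus>\<^bsub>DD\<^esub> coset_of (c \<odot>\<^bsub>FF\<^esub> y)"
      using zF y by (simp add: z coset_of_add coset_of_smult)
    moreover have "coset_of (c \<odot>\<^bsub>FF\<^esub> z) \<in> NN n" using below_smult[OF z(1)] by (simp add: NN_eq)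
    ultimately have "c \<odot>\<^bsub>DD\<^esub> a \<in> NN n +>\<^bsub>DD\<^esub> coset_of (c \<odot>\<^bsub>FF\<^esub> y)" by (auto simp: a_r_coset_def')
    then show ?thesis
      unfolding g using N.a_repr_independence'[of "c \<odot>\<^bsub>DD\<^esub> a"] y(1) N.a_subgroup by (metis D.a_repr_independence' F.smult_closed coset_of_closed)
  qed
  moreover have "coset_of y \<in> NN n +>\<^bsub>DD\<^esub> coset_of y" using y(1) by (intro N.a_rcos_self) (simp add: coset_of_closed)
  ultimately have "(\<Union>a\<in>NN n +>\<^bsub>DD\<^esub> coset_of y. NN n +>\<^bsub>DD\<^esub> (c \<odot>\<^bsub>DD\<^esub> a)) = degree_one_class (c \<odot>\<^bsub>FF\<^esub> x) n" by blast
  then show "(c \<odot>\<^bsub>GG\<^esub> degree_one_class x) n = degree_one_class (c \<odot>\<^bsub>FF\<^esub> x) n"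
    by (simp add: assoc_graded_def Let_def y(2))
qed

definition generator_class :: "(double_gen \<times> bit \<Rightarrow>\<^sub>0 'k) \<Rightarrow> nat \<Rightarrow> ('k, 'k free4, bit \<Rightarrow>\<^sub>0 'k) tens set set" where
  "generator_class c = degree_one_class (F.el (letters c))"

lemma el_letters: "F.el (letters c) \<in> below 2"
proof -
  have "keys (letters c) \<subseteq> {z. length (fst z) < 2}"
    unfolding letters_def by (rule keys_lin_subset) auto
  then show ?thesis by (simp add: below_def)
qed

lemma generator_class_add: "generator_class c \<oplus>\<^bsub>GG\<^esub> generator_class c' = generator_class (c + c')"
proof -
  have "F.el (letters c) \<oplus>\<^bsub>FF\<^esub> F.el (letters c') = F.el (letters (c + c'))"
    by (rule F.r_eqI) (simp_all add: letters_def lin_add)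
  then show ?thesis by (simp add: generator_class_def degree_one_class_add)
qed

lemma generator_class_scale: "a \<odot>\<^bsub>GG\<^esub> generator_class c = generator_class (pm_scale a c)"
proof -
  have "a \<odot>\<^bsub>FF\<^esub> F.el (letters c) = F.el (letters (pm_scale a c))"
    by (rule F.r_eqI) (simp_all add: letters_def lin_scale)
  then show ?thesis by (simp add: generator_class_def degree_one_class_smult)
qed

text \<open>A representative of degree at most one is the sum of its part in words of length one and
  an element of degree 0, and the latter vanishes in the associated graded algebra.\<close>

lemma generator_class_surj:
  assumes X: "X \<in> hcomp GG 1"
  shows "\<exists>c. X = generator_class c"
proof -
  have "\<exists>x\<in>fl 1. X 1 = NN 1 +>\<^bsub>DD\<^esub> x" and m: "\<And>m. m \<noteq> 1 \<Longrightarrow> X m = NN m"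
    using X by (simp_all add: assoc_graded_def Let_def)
  then obtain y where y: "y \<in> below 2" "X 1 = NN 1 +>\<^bsub>DD\<^esub> coset_of y"
    by (auto simp: fl_eq numeral_2_eq_2)
  define p where "p = gpart (\<lambda>z. length (fst z)) 1 (rF y)"
  \<comment> \<open>All words in the support of \<open>p\<close> have length one, so
    \<open>hd\<close> recovers the letter.\<close>
  define c where "c = lin (\<lambda>(w, e). single (hd w, e) 1) p"
  have "letters c = p"
  proof -
    have "letters c = lin (\<lambda>z. single z 1) p"
      unfolding c_def letters_def plin_lin_push[OF plin_lin]
    proof (rule lin_cong)
      fix z assume "z \<in> keys p"
      then have "length (fst z) = 1"
        using subsetD[OF keys_gpart[of "\<lambda>z. length (fst z)" 1 "rF y"], of z] by (simp add: p_def)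
      then obtain x e where "z = ([x], e)"
        by (metis One_nat_def length_0_conv length_Suc_conv prod.collapse)
      then show "lin (\<lambda>(x, e). single ([x], e) 1) (case z of (w, e) \<Rightarrow> single (hd w, e) 1) = single z (1 :: 'k)"
        by simp
    qed
    then show ?thesis by (simp add: lin_id)
  qed
  define y1 where "y1 = F.el (letters c)"
  define y0 where "y0 = y \<ominus>\<^bsub>FF\<^esub> y1"
  have yF: "y \<in> carrier FF" "y1 \<in> carrier FF" "y0 \<in> carrier FF"
    using below_carrier[OF y(1)] by (simp_all add: y1_def y0_def)
  have "keys (rF y - p) \<subseteq> {z. length (fst z) < 1}"
  proof
    fix z assume "z \<in> keys (rF y - p)"
    then have "lookup (rF y) z \<noteq> lookup p z" by (simp add: in_keys_iff lookup_minus)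
    then have "length (fst z) \<noteq> 1" "z \<in> keys (rF y)" by (auto simp: p_def in_keys_iff split: if_splits)
    moreover have "length (fst z) < 2" using y(1) \<open>z \<in> keys (rF y)\<close> by (auto simp: below_def)
    ultimately have "length (fst z) < 1" by linarith
    then show "z \<in> {z. length (fst z) < 1}" by blast
  qed
  then have "y0 \<in> below 1"
    using yF by (simp add: below_def y0_def y1_def \<open>letters c = p\<close>)
  then have n0: "coset_of y0 \<in> NN 1" by (simp add: NN_eq)
  interpret N: abelian_subgroup "NN 1" DD by (rule NN_subgroup)
  have "y = y0 \<oplus>\<^bsub>FF\<^esub> y1" using yF by (intro F.r_eqI) (simp_all add: y0_def)
  then have "coset_of y = coset_of y0 \<oplus>\<^bsub>DD\<^esub> coset_of y1" using yF by (simp add: coset_of_add)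
  then have "NN 1 +>\<^bsub>DD\<^esub> coset_of y = (NN 1 +>\<^bsub>DD\<^esub> coset_of y0) +>\<^bsub>DD\<^esub> coset_of y1"
    using yF N.a_subset by (simp add: D.a_coset_add_assoc coset_of_closed)
  then have "X 1 = NN 1 +>\<^bsub>DD\<^esub> coset_of y1" by (simp only: y(2) N.a_rcos_const[OF n0])
  then have "X = generator_class c"
    using m by (auto simp: fun_eq_iff generator_class_def degree_one_class_def y1_def NN_zero)
  then show ?thesis ..
qed

text \<open>The endomorphism is \<open>\<beta>\<close>: form the class in degree one, apply the
  given isomorphism, and read the eight coordinates of degree one. If the combination lies in the
  ideal, its class equals that of 0, and injectivity of \<open>\<beta>\<close> gives the
  claim.\<close>

lemma PBW_degree_one:
  assumes two: "(2 :: 'k) \<noteq> 0" and PBW: "is_PBW_deformation \<kappa>" and c: "letters c \<in> rF ` II"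
  shows "c = 0"
proof -
  obtain r where r: "malg (jordan_double :: ('k, _, _) graded_modalg) r bml (single ((0, 0), (0, 0)) 1) ddeg"
    using malg_double[OF two] by blast
  let ?T = "smash (jordan_double :: ('k, _, _) graded_modalg) kC2"
  have "galg ?T (tco r (\<lambda>x. x)) (dml 0 0 0) (tens (single ((0, 0), (0, 0)) 1) 1) mdeg"
    using smash_galg[OF r] unfolding dml_eq[symmetric] by (simp add: mdeg_def[abs_def])
  then interpret T: galg ?T "tco r (\<lambda>x. x)" "dml 0 0 0" "tens (single ((0, 0), (0, 0)) 1) 1" mdeg .
  obtain f where f: "f \<in> alg_iso GG ?T" and fh: "\<And>n. f ` hcomp GG n = hcomp ?T n"
    using PBW unfolding is_PBW_deformation_def graded_isomorphic_def by blast
  define \<beta> where "\<beta> c = restr (tco r (\<lambda>x. x) (f (generator_class c)))" for c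
  have generator_class: "generator_class c \<in> carrier GG" "f (generator_class c) \<in> carrier ?T" for c
  proof -
    show P: "generator_class c \<in> carrier GG" unfolding generator_class_def by (rule hcomp_carrier[OF degree_one_class_hcomp[OF el_letters]])
    then show "f (generator_class c) \<in> carrier ?T" using f by (auto simp: alg_iso_def ring_iso_def ring_hom_def)
  qed
  have "plin \<beta>"
  proof (rule plinI)
    fix c c' a
    have "f (generator_class (c + c')) = f (generator_class c) \<oplus>\<^bsub>?T\<^esub> f (generator_class c')"
      using f generator_class(1)[of c] generator_class(1)[of c'] by (simp add: alg_iso_def ring_iso_def ring_hom_def flip: generator_class_add)
    then show "\<beta> (c + c') = \<beta> c + \<beta> c'"
      by (simp add: \<beta>_def generator_class plin_add[OF plin_restr])
    have "f (generator_class (pm_scale a c)) = a \<odot>\<^bsub>?T\<^esub> f (generator_class c)"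
      using f generator_class(1)[of c] by (simp add: alg_iso_def flip: generator_class_scale)
    then show "\<beta> (pm_scale a c) = pm_scale a (\<beta> c)"
      by (simp add: \<beta>_def generator_class plin_scale[OF plin_restr])
  qed
  \<comment> \<open>The given isomorphism maps degree one onto degree one, and there every element
    is a \<open>generator_class\<close>.\<close>
  moreover have "surj \<beta>"
    unfolding surj_def
  proof
    fix t :: "double_gen \<times> bit \<Rightarrow>\<^sub>0 'k"
    let ?p = "lin (\<lambda>z. single (letter_index z) 1) t"
    have "keys ?p \<subseteq> {i. mdeg i = 1}" by (rule keys_lin_subset) (simp add: mdeg_letter_index)
    then have "T.el ?p \<in> hcomp ?T 1" by (simp add: T.hcomp_eq)
    then obtain X where X: "X \<in> hcomp GG 1" "f X = T.el ?p" unfolding fh[of 1, symmetric] by (elim imageE) simp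
    then obtain c where "X = generator_class c" using generator_class_surj by blast
    with X have "t = \<beta> c" by (simp add: \<beta>_def restr_lin_letter_index)
    then show "\<exists>c. t = \<beta> c" ..
  qed
  ultimately have "inj \<beta>" by (rule surj_imp_inj_finite[OF finite_double_gen_bit])
  have z: "coset_of (F.el (letters c)) = \<zero>\<^bsub>DD\<^esub>"
    using c by (intro coset_of_mem mem_deform_ideal) simp_all
  have "letters 0 = (0 :: _ \<Rightarrow>\<^sub>0 'k)" by (simp add: letters_def)
  then have "coset_of (F.el (letters 0)) = \<zero>\<^bsub>DD\<^esub>"
    by (simp add: coset_of_zero F.el_eqI[of "\<zero>\<^bsub>FF\<^esub>"])
  with z have "generator_class c = generator_class 0" by (simp add: generator_class_def degree_one_class_def fun_eq_iff)
  then have "\<beta> c = \<beta> 0" by (simp add: \<beta>_def)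
  with \<open>inj \<beta>\<close> show "c = 0" by (rule injD)
qed

end

section \<open>Overlaps\<close>

text \<open>
  The ambiguities \<open>u' * (v * u)\<close>, \<open>v' * (v * u)\<close> (both of the first shape) and \<open>u * (v' * u')\<close>.
\<close>

lemma overlap_left:
  fixes u v w :: "'r::ring_1"
  shows "w * (v * u - u * v + v ^ 2 - k1) - (v * u - u * v + v ^ 2 - k1) * w
    - (v * w + w * v - k4) * (u + v) + (u * w + w * u - k3) * v + v * (u * w + w * u - k3)
    - (u - v) * (v * w + w * v - k4)
    = k1 * w - w * k1 + k4 * (u + v) + (u - v) * k4 - k3 * v - v * k3"
  by (simp add: algebra_simps power2_eq_square)

lemma overlap_right:
  fixes u u' v' :: "'r::ring_1"
  shows "u * (v' * u' - u' * v' - v' ^ 2 - k2) - (v' * u' - u' * v' - v' ^ 2 - k2) * u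
    - (u * v' + v' * u - k5) * (u' - v') + (u * u' + u' * u - k3) * v' + v' * (u * u' + u' * u - k3)
    - (u' + v') * (u * v' + v' * u - k5)
    = k2 * u - u * k2 + k5 * (u' - v') + (u' + v') * k5 - k3 * v' - v' * k3"
  by (simp add: algebra_simps power2_eq_square)

lemma plin_letters: "plin letters"
  by (simp add: letters_def)

lemma lift_letters: "lift (letters (single (x, e) c)) = pm_scale c (gen (Some x) * ge e)"
  by (simp add: letters_def lift_def gen_def single_append single_gw flip: single_Cons)

lemma lift_letters_linear:
  "lift (letters (c + d)) = lift (letters c) + lift (letters d)" "lift (letters (c - d)) = lift (letters c) - lift (letters d)"
  "lift (letters (single (x, e) r)) = pm_scale r (gen (Some x) * ge e)"
  by (simp_all add: plin_add[OF plin_letters] plin_diff[OF plin_letters] plin_add[OF plin_lift] plin_diff[OF plin_lift] lift_letters)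

lemma pm_scale_double: "pm_scale (2 * c) x = pm_scale c x + pm_scale c x"
  by (simp only: mult_2 pm_scale_add_left)

text \<open>With the value on the i-th relation written as a i + b i g, nine of the twelve
  coefficients must vanish. The overlap with u' yields b 1, a 4, b 4, a 3; the one with v' adds a 6,
  b 6, a 5; the last one adds b 2 and b 5.\<close>

lemma kappa_form_if_PBW:
  fixes \<kappa> :: "'k free4 \<Rightarrow> (bit \<Rightarrow>\<^sub>0 'k::field)"
  assumes two: "(2 :: 'k) \<noteq> 0" and PBW: "is_PBW_deformation \<kappa>"
  shows "\<exists>l1 l2 l3. kappa_form l1 l2 l3 \<kappa>"
proof -
  define a where "a i = lookup (\<kappa> (rel i)) 0" for i
  define b where "b i = lookup (\<kappa> (rel i)) 1" for i
  let ?J = "preideal \<kappa>"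
  let ?g = "gen None :: double_gen option list \<Rightarrow>\<^sub>0 'k"
  define K where "K i = pm_scale (a i) 1 + pm_scale (b i) ?g" for i
  note J = two_sided_preideal[of \<kappa>]
  define u v u' v' where "u = (gen (Some Gu) :: double_gen option list \<Rightarrow>\<^sub>0 'k)"
    and "v = (gen (Some Gv) :: double_gen option list \<Rightarrow>\<^sub>0 'k)"
    and "u' = (gen (Some Gu') :: double_gen option list \<Rightarrow>\<^sub>0 'k)"
    and "v' = (gen (Some Gv') :: double_gen option list \<Rightarrow>\<^sub>0 'k)"
  note uv = u_def v_def u'_def v'_def
  have R: "emb (rel i) - K i \<in> ?J" if "i \<in> {1..6}" for i
    using lift_dgen_preideal[OF that, of \<kappa>] by (simp add: lift_dgen lin_ge K_def a_def b_def)
  have e: "emb (rel 1) = v * u - u * v + v ^ 2" "emb (rel 2) = v' * u' - u' * v' - v' ^ 2"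
    "emb (rel 3) = u * u' + u' * u" "emb (rel 4) = v * u' + u' * v" "emb (rel 5) = u * v' + v' * u"
    "emb (rel 6) = v * v' + v' * v"
    by (simp_all add: rel_def uv plin_add[OF plin_emb] plin_diff[OF plin_emb] emb_mult power2_eq_square)
  have R': "v * u - u * v + v ^ 2 - K 1 \<in> ?J" "v' * u' - u' * v' - v' ^ 2 - K 2 \<in> ?J"
    "u * u' + u' * u - K 3 \<in> ?J" "v * u' + u' * v - K 4 \<in> ?J" "u * v' + v' * u - K 5 \<in> ?J"
    "v * v' + v' * v - K 6 \<in> ?J"
    using R[of 1, unfolded e] R[of 2, unfolded e] R[of 3, unfolded e] R[of 4, unfolded e]
      R[of 5, unfolded e] R[of 6, unfolded e] by simp_all
  have gx: "?g * u + u * ?g \<in> ?J" "?g * v + v * ?g \<in> ?J" "?g * u' + u' * ?g \<in> ?J" "?g * v' + v' * ?g \<in> ?J"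
    using gset_preideal[of \<kappa>] by (auto simp: gset_def uv)
  have zero: "c = 0" if "lift (letters c) \<in> ?J" for c
    using PBW_degree_one[OF two PBW] that by (simp add: lift_preideal)
  \<comment> \<open>Only products with the group element on the left need rewriting; in
    \<open>x * K i\<close> the power of g already stands at the right.\<close>
  have comm: "cong ?J (K i * x) (pm_scale (a i) x - pm_scale (b i) (x * ?g))" if "?g * x + x * ?g \<in> ?J" for i x
    using two_sided_scale[OF J that, of "b i"]
    by (simp add: cong_def K_def distrib_right pm_scale_mult_left pm_scale_add)
  have comm': "x * K i = pm_scale (a i) x + pm_scale (b i) (x * ?g)" for i x
    by (simp add: K_def distrib_left pm_scale_mult_right)
  have mem: "y \<in> ?J" if "x \<in> ?J" "cong ?J x y" for x y
    using two_sided_diff[OF J that(1) that(2)[unfolded cong_def]] by simp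
  have left: "lift (letters (single (w, 1) (- 2 * b 1) + single (Gu, 0) (2 * a n) - single (Gv, 1) (2 * b n) - single (Gv, 0) (2 * a m))) \<in> ?J"
    if w: "?g * gen (Some w) + gen (Some w) * ?g \<in> ?J"
      and n: "v * gen (Some w) + gen (Some w) * v - K n \<in> ?J" and m: "u * gen (Some w) + gen (Some w) * u - K m \<in> ?J" for w n m
  proof (rule mem)
    let ?w = "gen (Some w) :: double_gen option list \<Rightarrow>\<^sub>0 'k"
    show "K 1 * ?w - ?w * K 1 + K n * (u + v) + (u - v) * K n - K m * v - v * K m \<in> ?J"
      \<comment> \<open>The overlap identity rewrites this expression of degree one as a combination
        of deformed relations: the cubic words cancel, and the factors u + v and u - v account for
        the summand v^2 of the first relation.\<close>
      unfolding overlap_left[symmetric]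
      by (intro two_sided_add[OF J] two_sided_diff[OF J] two_sided_left[OF J] two_sided_right[OF J] R' n m)
    have "K 1 * ?w - ?w * K 1 + K n * (u + v) + (u - v) * K n - K m * v - v * K m
      - lift (letters (single (w, 1) (- 2 * b 1) + single (Gu, 0) (2 * a n) - single (Gv, 1) (2 * b n) - single (Gv, 0) (2 * a m)))
      = (K 1 * ?w - (pm_scale (a 1) ?w - pm_scale (b 1) (?w * ?g)))
        + (K n * u - (pm_scale (a n) u - pm_scale (b n) (u * ?g)))
        + (K n * v - (pm_scale (a n) v - pm_scale (b n) (v * ?g)))
        - (K m * v - (pm_scale (a m) v - pm_scale (b m) (v * ?g)))"
      by (simp add: lift_letters_linear comm' distrib_left left_diff_distrib pm_scale_double pm_scale_add pm_scale_diff ge_def flip: uv)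
    also have "\<dots> \<in> ?J"
      by (intro two_sided_diff[OF J two_sided_add[OF J two_sided_add[OF J]]] comm[unfolded cong_def] w gx)
    finally show "cong ?J (K 1 * ?w - ?w * K 1 + K n * (u + v) + (u - v) * K n - K m * v - v * K m)
      (lift (letters (single (w, 1) (- 2 * b 1) + single (Gu, 0) (2 * a n) - single (Gv, 1) (2 * b n) - single (Gv, 0) (2 * a m))))"
      unfolding cong_def .
  qed
  have right: "lift (letters (single (Gu, 1) (- 2 * b 2) + single (Gu', 0) (2 * a 5) + single (Gv', 1) (2 * b 5) - single (Gv', 0) (2 * a 3))) \<in> ?J"
  proof (rule mem)
    show "K 2 * u - u * K 2 + K 5 * (u' - v') + (u' + v') * K 5 - K 3 * v' - v' * K 3 \<in> ?J"
      unfolding overlap_right[symmetric]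
      by (intro two_sided_add[OF J] two_sided_diff[OF J] two_sided_left[OF J] two_sided_right[OF J] R')
    have "K 2 * u - u * K 2 + K 5 * (u' - v') + (u' + v') * K 5 - K 3 * v' - v' * K 3
      - lift (letters (single (Gu, 1) (- 2 * b 2) + single (Gu', 0) (2 * a 5) + single (Gv', 1) (2 * b 5) - single (Gv', 0) (2 * a 3)))
      = (K 2 * u - (pm_scale (a 2) u - pm_scale (b 2) (u * ?g)))
        + (K 5 * u' - (pm_scale (a 5) u' - pm_scale (b 5) (u' * ?g)))
        - (K 5 * v' - (pm_scale (a 5) v' - pm_scale (b 5) (v' * ?g)))
        - (K 3 * v' - (pm_scale (a 3) v' - pm_scale (b 3) (v' * ?g)))"
      by (simp add: lift_letters_linear comm' distrib_right right_diff_distrib pm_scale_double pm_scale_add pm_scale_diff ge_def flip: uv)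
    also have "\<dots> \<in> ?J"
      by (intro two_sided_diff[OF J two_sided_diff[OF J two_sided_add[OF J]]] comm[unfolded cong_def] gx)
    finally show "cong ?J (K 2 * u - u * K 2 + K 5 * (u' - v') + (u' + v') * K 5 - K 3 * v' - v' * K 3)
      (lift (letters (single (Gu, 1) (- 2 * b 2) + single (Gu', 0) (2 * a 5) + single (Gv', 1) (2 * b 5) - single (Gv', 0) (2 * a 3))))"
      unfolding cong_def .
  qed
  have z: "lookup c y = 0" if "lift (letters c) \<in> ?J" for c y
    using zero[OF that] by simp
  \<comment> \<open>The letter \<open>w\<close> selects the relations involved: u' meets v and u in
    relations 4 and 3, and v' meets them in 6 and 5.\<close>
  note L1 = z[OF left[of Gu' 4 3, OF gx(3)[unfolded uv] R'(4)[unfolded u'_def] R'(3)[unfolded u'_def]]]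
  note L2 = z[OF left[of Gv' 6 5, OF gx(4)[unfolded uv] R'(6)[unfolded v'_def] R'(5)[unfolded v'_def]]]
  have 1: "b 1 = 0" "a 4 = 0" "b 4 = 0" "a 3 = 0"
    using L1[of "(Gu', 1)"] L1[of "(Gu, 0)"] L1[of "(Gv, 1)"] L1[of "(Gv, 0)"] two
    by (simp_all add: lookup_add lookup_minus lookup_single)
  have 2: "a 6 = 0" "b 6 = 0" "a 5 = 0"
    using L2[of "(Gu, 0)"] L2[of "(Gv, 1)"] L2[of "(Gv, 0)"] two
    by (simp_all add: lookup_add lookup_minus lookup_single)
  have 3: "b 2 = 0" "b 5 = 0"
    using z[OF right, of "(Gu, 1)"] z[OF right, of "(Gv', 1)"] two
    by (simp_all add: lookup_add lookup_minus lookup_single)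
  have k: "\<kappa> (rel i) = pm_scale (a i) 1 + pm_scale (b i) grp_g" for i
  proof (rule poly_mapping_eqI)
    show "lookup (\<kappa> (rel i)) y = lookup (pm_scale (a i) 1 + pm_scale (b i) grp_g) y" for y
      by (cases y) (simp_all add: a_def b_def grp_g_def lookup_add lookup_one lookup_single)
  qed
  have "{4..6 :: nat} = {4, 5, 6}" by auto
  then have "kappa_form (a 1) (a 2) (b 3) \<kappa>"
    unfolding kappa_form_def k using 1 2 3 by simp
  then show ?thesis by blast
qed

text \<open>The words v u, v' u' and u u' each occur in exactly one of the six relations, with
  coefficient 1; reading off their coefficients therefore gives a linear map with the prescribed
  values.\<close>

lemma exists_kappa:
  "\<exists>\<kappa> :: 'k free4 \<Rightarrow> (bit \<Rightarrow>\<^sub>0 'k::field). linear_on free_modalg rel_space kC2 \<kappa> \<and> kappa_form l1 l2 l3 \<kappa>"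
proof -
  define \<kappa> :: "'k free4 \<Rightarrow> (bit \<Rightarrow>\<^sub>0 'k)" where
    "\<kappa> p = pm_scale (l1 * lookup p [Gv, Gu] + l2 * lookup p [Gv', Gu']) 1 + pm_scale (l3 * lookup p [Gu, Gu']) grp_g" for p
  have "{4..6 :: nat} = {4, 5, 6}" by auto
  then have "kappa_form l1 l2 l3 \<kappa>"
    by (simp add: kappa_form_def \<kappa>_def rel_def gen_def mult_single plus_list_def power2_eq_square
        lookup_add lookup_minus lookup_single)
  moreover have "linear_on free_modalg rel_space kC2 \<kappa>"
    by (simp add: linear_on_def \<kappa>_def lookup_add distrib_left pm_scale_add_left pm_scale_add mult_ac add_ac)
  ultimately show ?thesis by blast
qed

theorem proposition5p2:
  assumes "odd CHAR('k::field)"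
  shows
    "(\<exists>\<phi> \<in> alg_iso (quot_alg free_modalg rel_ideal) (jordan_double :: ('k, _, _) graded_modalg).
        \<phi> (rel_ideal +>\<^bsub>free_modalg\<^esub> gen Gu) = pure jordan jordan_op (jordan_el Ju) \<one>\<^bsub>jordan_op\<^esub> \<and>
        \<phi> (rel_ideal +>\<^bsub>free_modalg\<^esub> gen Gv) = pure jordan jordan_op (jordan_el Jv) \<one>\<^bsub>jordan_op\<^esub> \<and>
        \<phi> (rel_ideal +>\<^bsub>free_modalg\<^esub> gen Gu') = pure jordan jordan_op \<one>\<^bsub>jordan\<^esub> (jordan_el Ju) \<and>
        \<phi> (rel_ideal +>\<^bsub>free_modalg\<^esub> gen Gv') = pure jordan jordan_op \<one>\<^bsub>jordan\<^esub> (jordan_el Jv)) \<and>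
     (\<forall>l1 l2 l3 :: 'k. \<exists>\<kappa>.
        linear_on free_modalg rel_space kC2 \<kappa> \<and> kappa_form l1 l2 l3 \<kappa> \<and> is_PBW_deformation \<kappa>) \<and>
     (\<forall>\<kappa> :: 'k free4 \<Rightarrow> (bit \<Rightarrow>\<^sub>0 'k).
        linear_on free_modalg rel_space kC2 \<kappa> \<longrightarrow>
        (is_PBW_deformation \<kappa> \<longleftrightarrow> (\<exists>l1 l2 l3. kappa_form l1 l2 l3 \<kappa>)))"
proof (intro conjI allI impI)
  note two = two_nonzero[OF assms]
  show "\<exists>\<phi> \<in> alg_iso (quot_alg free_modalg rel_ideal) (jordan_double :: ('k, _, _) graded_modalg).
        \<phi> (rel_ideal +>\<^bsub>free_modalg\<^esub> gen Gu) = pure jordan jordan_op (jordan_el Ju) \<one>\<^bsub>jordan_op\<^esub> \<and>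
        \<phi> (rel_ideal +>\<^bsub>free_modalg\<^esub> gen Gv) = pure jordan jordan_op (jordan_el Jv) \<one>\<^bsub>jordan_op\<^esub> \<and>
        \<phi> (rel_ideal +>\<^bsub>free_modalg\<^esub> gen Gu') = pure jordan jordan_op \<one>\<^bsub>jordan\<^esub> (jordan_el Ju) \<and>
        \<phi> (rel_ideal +>\<^bsub>free_modalg\<^esub> gen Gv') = pure jordan jordan_op \<one>\<^bsub>jordan\<^esub> (jordan_el Jv)"
    by (rule double_presentation[OF two])
  show "\<exists>\<kappa>. linear_on free_modalg rel_space kC2 \<kappa> \<and> kappa_form l1 l2 l3 \<kappa> \<and> is_PBW_deformation \<kappa>" for l1 l2 l3 :: 'k
    using exists_kappa[of l1 l2 l3] PBW_if_kappa_form[OF two] by blast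
  show "is_PBW_deformation \<kappa> \<longleftrightarrow> (\<exists>l1 l2 l3. kappa_form l1 l2 l3 \<kappa>)" for \<kappa> :: "'k free4 \<Rightarrow> (bit \<Rightarrow>\<^sub>0 'k)"
    using kappa_form_if_PBW[OF two] PBW_if_kappa_form[OF two] by blast
qed

end
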